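(* For $\alpha=2$, the $k$-polygon is $2\pi/m$-nondegenerate for every integer $m>1$ and every $k=4,\dots,1000$. In addition, there is $\delta>0$ such that for all $\alpha\in(2-\delta,2+\delta)\setminus\{2\}$ the $k$-polygon is $2\pi$-nondegenerate for every $k=4,\dots,1000$.
   Context: $E=\mathbb{R}^2$, $J=\begin{pmatrix}0&-1\\1&0\end{pmatrix}$, $e_1=(1,0)^T$, $\zeta=2\pi/k$, $\mathcal J_k=J\oplus\dots\oplus J$ on $E^k$. The $k$ bodies have equal masses $1$. $\phi_\alpha(r)=r^{1-\alpha}/(\alpha-1)$ for $\alpha>1$. The amended potential is $V(u)=\frac12\sum_{j=1}^k\|u_j\|^2+\sum_{1\le i<j\le k}\phi_\alpha(\|u_j-u_i\|)$ on collision-free $u\in E^k$. The $k$-polygon is the central configuration $$a=s_1^{1/(\alpha+1)}\big(\exp(J\zeta)e_1,\dots,\exp(kJ\zeta)e_1\big),\qquad s_1=\frac1{2^\alpha}\sum_{j=1}^{k-1}\frac1{\sin^{\alpha-1}(j\zeta/2)},$$ which is a critical point of $V$. Let $E^k_{red}=\{u\in E^k:\sum_ju_j=0\}$, let $P_{E^k_{red}}$ be the orthogonal projection of $(E^k)^{\mathbb{C}}$ onto $(E^k_{red})^{\mathbb{C}}$, and $M_a(\lambda)=\lambda^2\mathcal I-2i\lambda\mathcal J_k+\nabla^2V[a]$. The configuration $a$ is $2\pi$-nondegenerate if $P_{E^k_{red}}M_a(\ell)|_{(E^k_{red})^{\mathbb{C}}}$ is invertible for every $\ell\in\mathbb{Z}\setminus\{0\}$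 and $P_{E^k_{red}}M_a(0)|_{(E^k_{red})^{\mathbb{C}}}$ has one-dimensional kernel generated by $\mathcal J_ka$. It is $2\pi/m$-nondegenerate if the same holds with the first requirement imposed only for $\ell\in m\mathbb{Z}\setminus\{0\}$. *)

theory Defs
  imports "HOL-Analysis.Analysis"
begin

text \<open>
  The number of bodies \<open>k\<close> is a variable of the statement, so \<open>E\<^sup>k\<close> with \<open>E = \<real>\<^sup>2\<close> cannot be
  a type.  Its elements, and those of its complexification, are functions on the indices
  \<open>1, \<dots>, k\<close> extended by zero to all of \<open>nat\<close>.
\<close>

type_synonym 'a config = "nat \<Rightarrow> 'a^2"

definition Ek :: "nat \<Rightarrow> real config set" where
  "Ek k = {u. \<forall>j. j \<notin> {1..k} \<longrightarrow> u j = 0}"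

definition Ek_red :: "nat \<Rightarrow> real config set" where
  "Ek_red k = {u \<in> Ek k. (\<Sum>j=1..k. u j) = 0}"

definition complexify :: "real config set \<Rightarrow> complex config set" where
  "complexify S = {\<lambda>j. \<chi> p. of_real (x j $ p) + \<i> * of_real (y j $ p) | x y. x \<in> S \<and> y \<in> S}"

definition of_real_config :: "real config \<Rightarrow> complex config" where
  "of_real_config u = (\<lambda>j. \<chi> p. of_real (u j $ p))"

definition herm_inner :: "nat \<Rightarrow> complex config \<Rightarrow> complex config \<Rightarrow> complex" where
  "herm_inner k v w = (\<Sum>j=1..k. \<Sum>p\<in>UNIV. v j $ p * cnj (w j $ p))"

definition orth_proj :: "nat \<Rightarrow> complex config set \<Rightarrow> complex config \<Rightarrow> complex config" where
  "orth_proj k S w = (THE v. v \<in> S \<and> (\<forall>s\<in>S. herm_inner k (\<lambda>j. w j - v j) s = 0))"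

text \<open>The matrix \<open>J\<close>, over an arbitrary ring so that it also acts on the complexification.\<close>

definition Jmat :: "'a::ring_1^2^2" where
  "Jmat = vector [vector [0, -1], vector [1, 0]]"

definition Jk :: "'a::ring_1 config \<Rightarrow> 'a config" where
  "Jk u = (\<lambda>j. Jmat *v u j)"

text \<open>
  The exponential of a matrix, by its power series.  The library's \<open>exp\<close> does not apply, because
  \<open>*\<close> on the type \<open>real^2^2\<close> is the entrywise product.
\<close>

definition mat_exp :: "real^2^2 \<Rightarrow> real^2^2" where
  "mat_exp A = (\<Sum>n. (((**) A) ^^ n) (mat 1) /\<^sub>R fact n)"

definition phi :: "real \<Rightarrow> real \<Rightarrow> real" where
  "phi \<alpha> r = r powr (1 - \<alpha>) / (\<alpha> - 1)"

definition V :: "real \<Rightarrow> nat \<Rightarrow> real config \<Rightarrow> real" where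
  "V \<alpha> k u = (1/2) * (\<Sum>j=1..k. (norm (u j))\<^sup>2)
             + (\<Sum>i=1..k. \<Sum>j\<in>{i<..k}. phi \<alpha> (norm (u j - u i)))"

text \<open>
  \<open>partial j p F u\<close> is the partial derivative at \<open>u\<close> in the coordinate \<open>p\<close> of the body \<open>j\<close>.  The
  potential is smooth at every collision-free \<open>u\<close>, so there \<open>\<nabla>\<^sup>2V[u]\<close> is the matrix of its second
  partial derivatives; \<open>hessV\<close> is the complex-linear operator given by this matrix.
\<close>

definition partial :: "nat \<Rightarrow> 2 \<Rightarrow> (real config \<Rightarrow> real) \<Rightarrow> real config \<Rightarrow> real" where
  "partial j p F u = deriv (\<lambda>t. F (u(j := u j + t *\<^sub>R axis p 1))) 0"

definition hessV :: "real \<Rightarrow> nat \<Rightarrow> real config \<Rightarrow> complex config \<Rightarrow> complex config" where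
  "hessV \<alpha> k u w = (\<lambda>j. if j \<in> {1..k}
     then (\<chi> p. \<Sum>i=1..k. \<Sum>q\<in>UNIV. of_real (partial j p (partial i q (V \<alpha> k)) u) * w i $ q)
     else 0)"

definition M_op ::
    "real \<Rightarrow> nat \<Rightarrow> real config \<Rightarrow> complex \<Rightarrow> complex config \<Rightarrow> complex config" where
  "M_op \<alpha> k a z w =
     (\<lambda>j. z\<^sup>2 *s w j - (2 * \<i> * z) *s Jk w j + hessV \<alpha> k a w j)"

definition M_red ::
    "real \<Rightarrow> nat \<Rightarrow> real config \<Rightarrow> complex \<Rightarrow> complex config \<Rightarrow> complex config" where
  "M_red \<alpha> k a z w = orth_proj k (complexify (Ek_red k)) (M_op \<alpha> k a z w)"

text \<open>
  \<open>nondegenerate m \<alpha> k a\<close>: the configuration \<open>a\<close> is \<open>2\<pi>/m\<close>-nondegenerate.  For \<open>m = 1\<close> this is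
  \<open>2\<pi>\<close>-nondegeneracy.
\<close>

definition nondegenerate :: "int \<Rightarrow> real \<Rightarrow> nat \<Rightarrow> real config \<Rightarrow> bool" where
  "nondegenerate m \<alpha> k a \<longleftrightarrow>
     (\<forall>l::int. m dvd l \<and> l \<noteq> 0 \<longrightarrow>
        bij_betw (M_red \<alpha> k a (of_int l)) (complexify (Ek_red k)) (complexify (Ek_red k))) \<and>
     of_real_config (Jk a) \<noteq> (\<lambda>j. 0) \<and>
     {w \<in> complexify (Ek_red k). M_red \<alpha> k a 0 w = (\<lambda>j. 0)}
       = {\<lambda>j. c *s of_real_config (Jk a) j | c. True}"

definition s1 :: "real \<Rightarrow> nat \<Rightarrow> real" where
  "s1 \<alpha> k = (1 / 2 powr \<alpha>) * (\<Sum>j=1..k-1. 1 / sin (real j * (2 * pi / real k) / 2) powr (\<alpha> - 1))"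

definition polygon :: "real \<Rightarrow> nat \<Rightarrow> real config" where
  "polygon \<alpha> k = (\<lambda>j. if j \<in> {1..k}
     then s1 \<alpha> k powr (1 / (\<alpha> + 1)) *\<^sub>R
            (mat_exp ((real j * (2 * pi / real k)) *\<^sub>R Jmat) *v axis 1 1)
     else 0)"

end

theory Submission
  imports Defs
begin

text \<open>
  Identify \<open>E\<close> with the complex plane and describe a complex displacement \<open>w\<close> by the two
  coordinates \<open>x = w\<^sub>1 + \<i> w\<^sub>2\<close> and \<open>y = w\<^sub>1 - \<i> w\<^sub>2\<close>, in which \<open>J\<close> is diagonal.  Since the polygon is
  invariant under rotation by \<open>2\<pi>/k\<close>, the operator \<open>M\<^sub>a(\<lambda>)\<close> respects the Fourier modes
  \<open>x\<^sub>j = \<xi> \<omega>\<^bsup>(n+1)j\<^esup>\<close>, \<open>y\<^sub>j = \<eta> \<omega>\<^bsup>(n-1)j\<^esup>\<close> with \<open>\<omega> = exp(2\<pi>\<i>/k)\<close>, and acts on the mode \<open>n\<close> by a real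
  symmetric two-by-two block (\<open>M_op_hat\<close>).  All its entries are expressed by the numbers
  \<open>K\<^sub>n = stiffness \<alpha> k n\<close>.  The condition on the center of mass deletes one coordinate in each of the
  modes \<open>1\<close> and \<open>k-1\<close>, and what is left there is positive.  The block \<open>0\<close> has determinant
  \<open>\<lambda>\<^sup>2(\<lambda>\<^sup>2 + \<alpha> - 3)\<close>: at \<open>\<lambda> = 0\<close> its kernel is spanned by the rotation \<open>J a\<close>, and its zeros
  \<open>\<lambda> = \<plusminus>1\<close> at \<open>\<alpha> = 2\<close> come from the elliptic Kepler motions, which \<open>m > 1\<close> or \<open>\<alpha> \<noteq> 2\<close> excludes.  Hence
  everything depends on the blocks \<open>2 \<le> n \<le> k-2\<close> (\<open>nondegenerate_polygon\<close>).  Their determinants are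
  positive for large \<open>\<bar>\<lambda>\<bar>\<close>, uniformly for \<open>\<alpha>\<close> near \<open>2\<close>, so by continuity it is enough that at \<open>\<alpha> = 2\<close> they are
  invertible for every integer \<open>\<lambda>\<close> (\<open>eventually_block_det_nonzero\<close>).

  At \<open>\<alpha> = 2\<close> one has \<open>K\<^sub>n = R\<^sub>n/R\<^sub>1\<close> with
  \<open>R\<^sub>n = \<Sum>\<^sub>e sin\<^sup>2(n e \<pi>/k) / sin\<^sup>3(e \<pi>/k)\<close>, and a singular block is a relation
  \<open>mode_form \<lambda> R\<^sub>1 R\<^sub>n\<^sub>-\<^sub>1 R\<^sub>n R\<^sub>n\<^sub>+\<^sub>1 = 0\<close> with integer coefficients.  Suppose that it holds.
  Up to a common factor the \<open>R\<^sub>n\<close> lie in a cyclotomic field, so the relation survives Galois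
  conjugation, and one of the conjugations turns the \<open>R\<^sub>n\<close>, again up to a common factor, into the
  sums \<open>S\<^sub>n\<close> of the same terms with the alternating signs \<open>altsign\<close> (\<open>csum_galois\<close>).  Thus the same integer \<open>\<lambda>\<close> solves
  two real relations.  The first one and the Cauchy-Schwarz inequality give \<open>\<lambda>\<^sup>2 \<le> R\<^sub>n/R\<^sub>1\<close>
  (\<open>mode_form_zero_upper\<close>); the second one and the inequality of the means bound \<open>S\<^sub>n/S\<^sub>1\<close> by
  \<open>\<lambda>\<^sup>2\<close> plus a small term (\<open>mode_form_zero_lower\<close>).  But \<open>S\<^sub>n/S\<^sub>1\<close> exceeds \<open>R\<^sub>n/R\<^sub>1\<close> by more than this
  term.  Indeed the gap between the two quotients increases along steps of length two up to
  \<open>n = k/2\<close> (\<open>csum_gap_mono\<close>), because the third differences of the two sequences are explicit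
  cotangents and tangents, and at \<open>n = 4, 5\<close> it is already large enough for all \<open>k \<le> 1000\<close>
  (\<open>initial_gaps_up_to_1000\<close>).  For \<open>n = 2, 3\<close> the integer \<open>\<lambda>\<close> is so small that direct
  estimates finish the argument (\<open>mode_form_plain_nonzero\<close>).
\<close>

section \<open>Galois conjugation of roots of unity\<close>

definition eval_int_poly :: "int poly \<Rightarrow> complex \<Rightarrow> complex" where
  "eval_int_poly P z = poly (map_poly of_int P) z"

lemma eval_int_poly_add [simp]: "eval_int_poly (P + Q) z = eval_int_poly P z + eval_int_poly Q z"
proof -
  have "map_poly of_int (P + Q) = (map_poly of_int P + map_poly of_int Q :: complex poly)"
    by (rule poly_eqI) (simp add: coeff_map_poly)
  then show ?thesis by (simp add: eval_int_poly_def)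
qed

lemma eval_int_poly_mult [simp]: "eval_int_poly (P * Q) z = eval_int_poly P z * eval_int_poly Q z"
proof -
  have "map_poly of_int (P * Q) = (map_poly of_int P * map_poly of_int Q :: complex poly)"
    by (rule poly_eqI) (simp add: coeff_map_poly coeff_mult)
  then show ?thesis by (simp add: eval_int_poly_def)
qed

lemma eval_int_poly_const [simp]: "eval_int_poly [:c:] z = of_int c"
  by (simp add: eval_int_poly_def map_poly_pCons)

lemma eval_int_poly_pCons [simp]: "eval_int_poly (pCons c P) z = of_int c + z * eval_int_poly P z"
  by (simp add: eval_int_poly_def map_poly_pCons)

lemma eval_int_poly_0 [simp]: "eval_int_poly 0 z = 0"
  by (simp add: eval_int_poly_def)

lemma eval_int_poly_1 [simp]: "eval_int_poly 1 z = 1"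
  using eval_int_poly_const[of 1 z] by (simp add: one_pCons)

lemma eval_int_poly_minus [simp]: "eval_int_poly (- P) z = - eval_int_poly P z"
  using eval_int_poly_add[of P "- P" z] by (simp add: add_eq_0_iff)

lemma eval_int_poly_diff [simp]: "eval_int_poly (P - Q) z = eval_int_poly P z - eval_int_poly Q z"
  using eval_int_poly_add[of P "- Q" z] by simp

lemma eval_int_poly_smult [simp]: "eval_int_poly (smult c P) z = of_int c * eval_int_poly P z"
  using eval_int_poly_mult[of "[:c:]" P z] by simp

lemma eval_int_poly_monom [simp]: "eval_int_poly (monom c n) z = of_int c * z ^ n"
  by (simp add: eval_int_poly_def map_poly_monom poly_monom)

lemma eval_int_poly_pcompose_monom: "eval_int_poly (pcompose P (monom 1 n)) z = eval_int_poly P (z ^ n)"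
  by (induction P) (auto simp: pcompose_pCons)

lemma dvd_of_primitive_dvd_smult:
  fixes f P :: "int poly"
  assumes "content f = 1" "c \<noteq> 0" "f dvd smult c P"
  shows "f dvd P"
proof -
  from assms(3) obtain q where q: "smult c P = f * q" by (elim dvdE)
  have "c dvd content (smult c P)" by simp
  hence "c dvd content q" using q assms(1) by (simp add: content_mult)
  hence "[:c:] dvd q" by (simp add: const_poly_dvd_iff_dvd_content)
  then obtain q' where "q = smult c q'" by (auto elim!: dvdE)
  with q have "smult c P = smult c (f * q')" by simp
  hence "P = f * q'" using assms(2) by (metis smult_cancel)
  thus ?thesis by simp
qed

text \<open>
  An integer polynomial of least degree among those that vanish at \<open>z\<close>, made primitive.
  Pseudo-division shows that it divides a nonzero multiple of every other such polynomial, and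
  primitivity removes the multiple (Gauss).
\<close>

lemma integer_minimal_polynomial:
  fixes z :: complex
  assumes "P0 \<noteq> 0" "eval_int_poly P0 z = 0"
  obtains f where "f \<noteq> 0" "eval_int_poly f z = 0" "\<And>P. eval_int_poly P z = 0 \<Longrightarrow> f dvd P"
proof -
  define A where "A = {P::int poly. P \<noteq> 0 \<and> eval_int_poly P z = 0}"
  have "P0 \<in> A" using assms by (simp add: A_def)
  then obtain f0 where f0: "f0 \<in> A" "\<And>P. P \<in> A \<Longrightarrow> degree f0 \<le> degree P"
    using ex_has_least_nat[of "\<lambda>P. P \<in> A" P0 degree] by blast
  define f where "f = primitive_part f0"
  have f00: "f0 \<noteq> 0" using f0 by (simp add: A_def)
  have fne: "f \<noteq> 0" and cf: "content f = 1" and df: "degree f = degree f0"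
    using f00 by (auto simp: f_def)
  have "eval_int_poly f0 z = of_int (content f0) * eval_int_poly f z"
    unfolding f_def using content_times_primitive_part[of f0] by (metis eval_int_poly_smult)
  hence fz: "eval_int_poly f z = 0" using f0 f00 by (auto simp: A_def)
  have dvd: "f dvd P" if P: "eval_int_poly P z = 0" for P
  proof -
    obtain q r where qr: "pseudo_divmod P f = (q, r)" by (cases "pseudo_divmod P f")
    define c where "c = lead_coeff f ^ (Suc (degree P) - degree f)"
    have *: "smult c P = f * q + r" and r: "r = 0 \<or> degree r < degree f"
      using pseudo_divmod[OF fne qr] by (auto simp: c_def)
    have "eval_int_poly r z = eval_int_poly (smult c P) z - eval_int_poly (f * q) z" by (simp only: *) simp
    hence "eval_int_poly r z = 0" using P fz by simp
    hence "r = 0" using r f0(2)[of r] df by (auto simp: A_def simp flip: not_less)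
    hence "f dvd smult c P" using * by simp
    moreover have "c \<noteq> 0" using fne by (simp add: c_def)
    ultimately show ?thesis using dvd_of_primitive_dvd_smult[OF cf] by blast
  qed
  show ?thesis using that[OF fne fz dvd] .
qed

text \<open>
  The Frobenius map modulo \<open>p\<close>: the middle binomial coefficients are divisible by \<open>p\<close>, and the
  coefficients are fixed by Fermat's little theorem.
\<close>

lemma prime_poly_freshman:
  fixes p :: nat and G :: "int poly"
  assumes "prime p"
  shows "[:int p:] dvd (pcompose G (monom 1 p) - G ^ p)"
proof (induction G)
  case 0
  show ?case using prime_gt_0_nat[OF assms] by (simp add: zero_power)
next
  case (pCons a G)
  have fd: "[:int p:] dvd ((u + v) ^ p - (u ^ p + v ^ p))" for u v :: "int poly"
  proof -
    have "(u + v) ^ p = (\<Sum>k\<le>p. of_nat (p choose k) * u ^ k * v ^ (p - k))"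
      by (rule binomial_ring)
    also have "{..p} = insert 0 (insert p {1..<p})" using prime_gt_0_nat[OF assms] by auto
    also have "(\<Sum>k\<in>\<dots>. of_nat (p choose k) * u ^ k * v ^ (p - k))
        = u ^ p + v ^ p + (\<Sum>k\<in>{1..<p}. of_nat (p choose k) * u ^ k * v ^ (p - k))"
      using prime_gt_0_nat[OF assms] by simp
    finally have "(u + v) ^ p - (u ^ p + v ^ p) = (\<Sum>k\<in>{1..<p}. of_nat (p choose k) * u ^ k * v ^ (p - k))"
      by simp
    moreover have "[:int p:] dvd (\<Sum>k\<in>{1..<p}. of_nat (p choose k) * u ^ k * v ^ (p - k))"
    proof (rule dvd_sum)
      fix k assume k: "k \<in> {1..<p}"
      have "p dvd (p choose k)" by (rule dvd_choose_prime) (use k assms in auto)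
      then obtain q where "p choose k = p * q" by (elim dvdE)
      hence *: "(of_nat (p choose k) :: int poly) = [:int p:] * of_nat q"
        by (simp add: of_nat_poly)
      show "[:int p:] dvd of_nat (p choose k) * u ^ k * v ^ (p - k)"
        unfolding * by (simp only: mult.assoc dvd_triv_left)
    qed
    ultimately show ?thesis by simp
  qed
  have e1: "pCons a G = [:a:] + monom 1 1 * G" by (simp add: monom_Suc)
  have e2: "pcompose (pCons a G) (monom 1 p) = [:a:] + monom 1 p * pcompose G (monom 1 p)"
    by (simp add: pcompose_pCons)
  have m: "(monom 1 1 * G) ^ p = monom 1 p * G ^ p"
    by (simp add: power_mult_distrib monom_power)
  have a: "[:int p:] dvd [:a:] - [:a:] ^ p"
  proof -
    have nn: "int p dvd (b ^ p - b)" if "b \<ge> 0" for b :: int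
      using that
    proof (induction b rule: int_ge_induct)
      case base then show ?case using prime_gt_0_nat[OF assms] by (simp add: zero_power)
    next
      case (step b)
      have "int p dvd ((b + 1) ^ p - (b ^ p + 1 ^ p))"
        using fd[of "[:b:]" "[:1:]"] by (simp add: poly_const_pow)
      with step have "int p dvd ((b + 1) ^ p - (b ^ p + 1 ^ p)) + (b ^ p - b)" by (intro dvd_add)
      thus ?case by (simp add: algebra_simps)
    qed
    have "int p dvd a ^ p - a"
    proof (cases "a \<ge> 0")
      case False
      have "a mod int p \<ge> 0" using prime_gt_0_nat[OF assms] by simp
      from nn[OF this] have "((a mod int p) ^ p - a mod int p) mod int p = 0" by simp
      hence "((a mod int p) ^ p mod int p - a) mod int p = 0" by (simp only: mod_diff_left_eq mod_diff_right_eq)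
      hence "(a ^ p - a) mod int p = 0" by (simp only: power_mod mod_diff_left_eq)
      thus ?thesis by auto
    qed (use nn in auto)
    hence "int p dvd a - a ^ p" by (simp add: dvd_diff_commute)
    thus ?thesis by (simp add: poly_const_pow const_poly_dvd_const_poly_iff)
  qed
  have "pcompose (pCons a G) (monom 1 p) - pCons a G ^ p
      = ([:a:] - [:a:] ^ p) + monom 1 p * (pcompose G (monom 1 p) - G ^ p)
        - (([:a:] + monom 1 1 * G) ^ p - ([:a:] ^ p + (monom 1 1 * G) ^ p))"
    unfolding e2 unfolding e1 m by (simp add: algebra_simps)
  also have "[:int p:] dvd \<dots>"
    by (intro dvd_diff dvd_add a fd dvd_mult pCons.IH)
  finally show ?case .
qed

text \<open>
  Replace \<open>B\<close> by its remainder after division by \<open>f\<close>, which is possible because the leading coefficient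
  of \<open>f\<close> is a unit.  Then all other terms have degree less than \<open>f\<close>, so the multiple of \<open>f\<close> vanishes.
\<close>

lemma const_notin_monic_ideal:
  fixes f A B :: "int poly" and c p :: int
  assumes lc: "lead_coeff f dvd 1" and deg: "degree f > 0" and eq: "[:c:] = f * A + [:p:] * B"
  shows "p dvd c"
proof -
  have fne: "f \<noteq> 0" using deg by auto
  obtain q r where qr: "pseudo_divmod B f = (q, r)" by (cases "pseudo_divmod B f")
  define e where "e = lead_coeff f ^ (Suc (degree B) - degree f)"
  have B: "smult e B = f * q + r" and r: "r = 0 \<or> degree r < degree f"
    using pseudo_divmod[OF fne qr] by (auto simp: e_def)
  have "smult e [:c:] = f * smult e A + [:p:] * smult e B"
    unfolding eq by (simp add: smult_add_right)
  also have "\<dots> = f * (smult e A + [:p:] * q) + smult p r"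
    unfolding B by (simp add: algebra_simps smult_add_right)
  finally have eq': "[:e * c:] - smult p r = f * (smult e A + [:p:] * q)" by simp
  have "degree ([:e * c:] - smult p r) < degree f"
    using r deg by (intro degree_diff_less) (auto intro: le_less_trans[OF degree_smult_le])
  hence "smult e A + [:p:] * q = 0"
    using eq' fne by (metis degree_mult_eq le_add1 linorder_not_less)
  hence "[:e * c:] = smult p r" using eq' by simp
  hence "e * c = p * coeff r 0" by (metis coeff_pCons_0 coeff_smult)
  hence "p dvd e * c" by simp
  moreover have "e dvd 1" unfolding e_def using lc by (metis dvd_power_same power_one)
  ultimately show ?thesis by (metis dvd_mult_unit_iff mult.commute)
qed

text \<open>
  Dedekind's argument for the irreducibility of cyclotomic polynomials.  Write
  \<open>x\<^sup>N - 1 = f g\<close> with the minimal polynomial \<open>f\<close> of \<open>z\<close>.  If \<open>z\<^sup>p\<close> were no root of \<open>f\<close>, it would be a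
  root of \<open>g\<close>, so \<open>f\<close> would divide \<open>g(x\<^sup>p)\<close>, which is \<open>g\<^sup>p\<close> modulo \<open>p\<close>; then \<open>f\<close> and \<open>g\<close> would not
  be coprime modulo \<open>p\<close>, although \<open>x\<^sup>N - 1\<close> is separable modulo \<open>p\<close>.
\<close>

lemma galois_conjugate_prime_power:
  fixes z :: complex and p N :: nat
  assumes N: "N > 0" "z ^ N = 1" and p: "prime p" "\<not> p dvd N" and P: "eval_int_poly P z = 0"
  shows "eval_int_poly P (z ^ p) = 0"
proof -
  define C where "C = (monom 1 N - 1 :: int poly)"
  have Cev: "eval_int_poly C u = u ^ N - 1" for u by (simp add: C_def)
  have Cne: "C \<noteq> 0"
  proof
    assume "C = 0"
    hence "coeff C N = 0" by simp
    thus False using N by (simp add: C_def)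
  qed
  have lcC: "lead_coeff C = 1"
  proof -
    have "degree C = N" unfolding C_def using N
      by (metis degree_1 degree_monom_eq diff_conv_add_uminus degree_add_eq_left degree_minus one_neq_zero)
    thus ?thesis using N by (simp add: C_def)
  qed
  obtain f where f: "f \<noteq> 0" "eval_int_poly f z = 0" "\<And>P. eval_int_poly P z = 0 \<Longrightarrow> f dvd P"
    using integer_minimal_polynomial[OF Cne, of z] Cev N by auto
  obtain g where g: "C = f * g" using f(3)[of C] Cev N by (auto elim: dvdE)
  have lcf: "lead_coeff f dvd 1" using lcC g by (metis dvd_triv_left lead_coeff_mult)
  have degf: "degree f > 0"
  proof (rule ccontr)
    assume "\<not> degree f > 0"
    then obtain c where "f = [:c:]" by (meson degree_eq_zeroE neq0_conv)
    thus False using f by auto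
  qed
  have "eval_int_poly f (z ^ p) = 0"
  proof (rule ccontr)
    assume nz: "eval_int_poly f (z ^ p) \<noteq> 0"
    have "eval_int_poly C (z ^ p) = 0" using N Cev by (simp flip: power_mult add: mult.commute power_mult)
    hence "eval_int_poly g (z ^ p) = 0" using g nz by simp
    hence "eval_int_poly (pcompose g (monom 1 p)) z = 0" by (simp add: eval_int_poly_pcompose_monom)
    then obtain u where u: "pcompose g (monom 1 p) = f * u" using f(3) by (blast elim: dvdE)
    obtain v where v: "pcompose g (monom 1 p) - g ^ p = [:int p:] * v"
      using prime_poly_freshman[OF p(1), of g] by (elim dvdE)
    \<comment> \<open>So \<open>g\<^sup>p\<close> is a multiple of \<open>f\<close> modulo \<open>p\<close>.\<close>
    have gp: "g ^ p = f * u - [:int p:] * v" using u v by (simp add: algebra_simps)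
    \<comment> \<open>Multiplying the derivative of \<open>x\<^sup>N - 1 = f g\<close> by \<open>x\<close> puts the constant \<open>N\<close> into the ideal \<open>(f, g)\<close>.\<close>
    have "pderiv C = f * pderiv g + g * pderiv f" unfolding g by (simp add: pderiv_mult algebra_simps)
    moreover have "pderiv C = smult (int N) (monom 1 (N - 1))"
      by (simp add: C_def pderiv_diff pderiv_monom smult_monom)
    ultimately have "monom 1 1 * smult (int N) (monom 1 (N - 1)) = monom 1 1 * (f * pderiv g + g * pderiv f)"
      by simp
    moreover have "monom 1 1 * smult (int N) (monom 1 (N - 1)) = smult (int N) (C + 1)"
      using N by (simp add: C_def mult_monom smult_monom)
    ultimately have NN: "[:int N:] = f * (monom 1 1 * pderiv g - smult (int N) g) + g * (monom 1 1 * pderiv f)"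
      unfolding g by (simp add: algebra_simps smult_add_right one_pCons)
    define a b where "a = f * (monom 1 1 * pderiv g - smult (int N) g)" and "b = g * (monom 1 1 * pderiv f)"
    \<comment> \<open>With \<open>N = a + b\<close>, also \<open>N\<^sup>p\<close> lies in \<open>(f, g\<^sup>p)\<close>, which is contained in \<open>(f, p)\<close>.\<close>
    have "f dvd (a + b) ^ p - b ^ p"
    proof -
      have "(a + b) - b dvd (a + b) ^ p - b ^ p"
        by (simp only: power_diff_sumr2) (rule dvd_triv_left)
      moreover have "f dvd a" by (simp add: a_def)
      ultimately show ?thesis by (metis add_diff_cancel_right' dvd_trans)
    qed
    then obtain s where s: "(a + b) ^ p - b ^ p = f * s" by (elim dvdE)
    have "[:int N ^ p:] = (a + b) ^ p"
      unfolding a_def b_def NN[symmetric] by (simp add: poly_const_pow)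
    also have "\<dots> = f * s + g ^ p * (monom 1 1 * pderiv f) ^ p"
      using s by (simp add: b_def power_mult_distrib algebra_simps)
    also have "\<dots> = f * (s + u * (monom 1 1 * pderiv f) ^ p) + [:int p:] * (- v * (monom 1 1 * pderiv f) ^ p)"
      unfolding gp by (simp add: algebra_simps)
    finally have "int p dvd int N ^ p" using const_notin_monic_ideal[OF lcf degf] by blast
    hence "p dvd N ^ p" by (metis int_dvd_int_iff of_nat_power)
    thus False using p prime_dvd_power by blast
  qed
  moreover obtain q where "P = f * q" using f(3)[OF P] by (elim dvdE)
  ultimately show ?thesis by simp
qed

lemma galois_conjugate_coprime_power:
  fixes z :: complex and h N :: nat
  assumes N: "N > 0" "z ^ N = 1" and h: "coprime h N" "h > 0" and P: "eval_int_poly P z = 0"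
  shows "eval_int_poly P (z ^ h) = 0"
  using h
proof (induction h rule: prime_divisors_induct)
  case zero
  then show ?case by simp
next
  case (unit h)
  then show ?case using P by simp
next
  case (factor p h)
  have zh: "(z ^ h) ^ N = 1" by (metis N(2) mult.commute power_mult power_one)
  have "eval_int_poly P (z ^ h) = 0" using factor by auto
  moreover have "\<not> p dvd N" using factor
    by (meson coprime_common_divisor dvd_triv_left not_prime_unit)
  ultimately have "eval_int_poly P ((z ^ h) ^ p) = 0"
    using galois_conjugate_prime_power[OF N(1) zh factor(1)] by blast
  thus ?case by (simp flip: power_mult add: mult.commute)
qed

section \<open>Conjugate elements of a cyclotomic field\<close>

text \<open>
  The pair \<open>(a, b)\<close> comes from one rational polynomial, evaluated at \<open>z\<close> and at \<open>w\<close>.  For conjugate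
  roots of unity \<open>z\<close>, \<open>w\<close> this is the graph of the field isomorphism with \<open>z \<mapsto> w\<close>.  The
  common denominator \<open>d\<close> avoids rational polynomials.
\<close>

definition conj_pair :: "complex \<Rightarrow> complex \<Rightarrow> complex \<Rightarrow> complex \<Rightarrow> bool" where
  "conj_pair z w a b \<longleftrightarrow>
     (\<exists>P d. d \<noteq> (0::int) \<and> of_int d * a = eval_int_poly P z \<and> of_int d * b = eval_int_poly P w)"

lemma conj_pairI: "d \<noteq> (0::int) \<Longrightarrow> of_int d * a = eval_int_poly P z \<Longrightarrow> of_int d * b = eval_int_poly P w \<Longrightarrow> conj_pair z w a b"
  by (auto simp: conj_pair_def)

lemma conj_pair_of_int: "conj_pair z w (of_int c) (of_int c)"
  by (rule conj_pairI[of 1 _ "[:c:]"]) auto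

lemma conj_pair_generator: "conj_pair z w z w"
  by (rule conj_pairI[of 1 _ "[:0, 1:]"]) auto

lemma conj_pair_add:
  assumes "conj_pair z w a b" "conj_pair z w a' b'"
  shows "conj_pair z w (a + a') (b + b')"
proof -
  from assms obtain P d P' d' where "d \<noteq> 0" "of_int d * a = eval_int_poly P z" "of_int d * b = eval_int_poly P w"
    "d' \<noteq> 0" "of_int d' * a' = eval_int_poly P' z" "of_int d' * b' = eval_int_poly P' w"
    unfolding conj_pair_def by blast
  thus ?thesis
    by (intro conj_pairI[of "d * d'" _ "smult d' P + smult d P'"]) (auto simp: algebra_simps)
qed

lemma conj_pair_mult:
  assumes "conj_pair z w a b" "conj_pair z w a' b'"
  shows "conj_pair z w (a * a') (b * b')"
proof -
  from assms obtain P d P' d' where *: "d \<noteq> 0" "of_int d * a = eval_int_poly P z" "of_int d * b = eval_int_poly P w"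
    "d' \<noteq> 0" "of_int d' * a' = eval_int_poly P' z" "of_int d' * b' = eval_int_poly P' w"
    unfolding conj_pair_def by blast
  show ?thesis
    by (rule conj_pairI[of "d * d'" _ "P * P'"])
      (use * in \<open>auto simp: algebra_simps simp flip: *(2,3,5,6)\<close>)
qed

lemma conj_pair_diff:
  "conj_pair z w a b \<Longrightarrow> conj_pair z w a' b' \<Longrightarrow> conj_pair z w (a - a') (b - b')"
  using conj_pair_add[of z w a b "- a'" "- b'"] conj_pair_mult[OF conj_pair_of_int[of z w "-1"], of a' b']
  by simp

lemma conj_pair_power: "conj_pair z w a b \<Longrightarrow> conj_pair z w (a ^ n) (b ^ n)"
  using conj_pair_of_int[of z w 1] by (induction n) (auto intro: conj_pair_mult)

lemma conj_pair_sum: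
  "(\<And>x. x \<in> A \<Longrightarrow> conj_pair z w (a x) (b x)) \<Longrightarrow> conj_pair z w (sum a A) (sum b A)"
  using conj_pair_of_int[of z w 0] by (induction A rule: infinite_finite_induct) (auto intro: conj_pair_add)

text \<open>
  Multiply by \<open>u - 1\<close> and sum by parts.  This makes the inverse a polynomial in \<open>u\<close>, with the same
  polynomial for all conjugates of \<open>u\<close>.
\<close>

lemma root_of_unity_inverse:
  fixes u :: complex
  assumes "M > 0" "u ^ M = 1" "u \<noteq> 1"
  shows "inverse (u - 1) = (\<Sum>j<M. of_nat j * u ^ j) / of_nat M"
proof -
  have "(u - 1) * (\<Sum>j<m. of_nat j * u ^ j) = of_nat m * u ^ m - u * (\<Sum>j<m. u ^ j)" for m
    by (induction m) (auto simp: algebra_simps)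
  moreover have "(\<Sum>j<M. u ^ j) = 0" using assms by (simp add: geometric_sum)
  ultimately have "(u - 1) * (\<Sum>j<M. of_nat j * u ^ j) = of_nat M" using assms by simp
  thus ?thesis using assms by (simp add: field_simps)
qed

lemma conj_pair_inverse_root:
  assumes "conj_pair z w u v" "M > 0" "u ^ M = 1" "u \<noteq> 1" "v ^ M = 1" "v \<noteq> 1"
  shows "conj_pair z w (inverse (u - 1)) (inverse (v - 1))"
proof -
  have "conj_pair z w (\<Sum>j<M. of_nat j * u ^ j) (\<Sum>j<M. of_nat j * v ^ j)"
  proof (intro conj_pair_sum conj_pair_mult conj_pair_power assms(1))
    show "conj_pair z w (of_nat j) (of_nat j)" for j
      using conj_pair_of_int[of z w "int j"] by simp
  qed
  then obtain P d where *: "d \<noteq> 0" "of_int d * (\<Sum>j<M. of_nat j * u ^ j) = eval_int_poly P z"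
    "of_int d * (\<Sum>j<M. of_nat j * v ^ j) = eval_int_poly P w"
    unfolding conj_pair_def by blast
  show ?thesis
    by (rule conj_pairI[of "d * int M" _ P])
      (use * assms in \<open>auto simp: root_of_unity_inverse[of M]\<close>)
qed

text \<open>
  The isomorphism maps \<open>0\<close> to \<open>0\<close>: here the conjugacy of \<open>z\<close> and \<open>z\<^sup>h\<close> enters.
\<close>

lemma conj_pair_zero:
  assumes "N > 0" "z ^ N = 1" "coprime h N" "h > 0" "conj_pair z (z ^ h) 0 b"
  shows "b = 0"
proof -
  from assms(5) obtain P d where "d \<noteq> 0" "eval_int_poly P z = 0" "of_int d * b = eval_int_poly P (z ^ h)"
    unfolding conj_pair_def by auto
  thus ?thesis using galois_conjugate_coprime_power[OF assms(1-4)] by auto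
qed

text \<open>
  At \<open>u = exp(\<i>t)\<close> this is \<open>2\<i> sin(f t)\<close>.
\<close>

definition chord :: "nat \<Rightarrow> complex \<Rightarrow> complex" where
  "chord f u = u ^ f - inverse u ^ f"

definition chord_sum :: "nat \<Rightarrow> nat \<Rightarrow> complex \<Rightarrow> complex" where
  "chord_sum M n u = (\<Sum>f=1..M. chord (n * f) u ^ 2 * inverse (chord f u) ^ 3)"

lemma inverse_chord:
  assumes "u \<noteq> 0" "u ^ (2 * f) \<noteq> 1"
  shows "inverse (chord f u) = u ^ f * inverse (u ^ (2 * f) - 1)"
proof -
  have "chord f u = (u ^ (2 * f) - 1) / u ^ f"
    using assms by (simp add: chord_def field_simps power_mult power2_eq_square mult_2 power_add)
  thus ?thesis using assms by (simp add: divide_inverse inverse_mult_distrib mult.commute)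
qed

lemma conj_pair_chord_sum:
  assumes N: "N > 0" "z ^ N = 1" "w ^ N = 1"
    and ne: "\<And>f. 1 \<le> f \<Longrightarrow> f \<le> M \<Longrightarrow> z ^ (2 * f) \<noteq> 1 \<and> w ^ (2 * f) \<noteq> 1"
  shows "conj_pair z w (chord_sum M n z) (chord_sum M n w)"
proof -
  have inv: "inverse u = u ^ (N - 1)" if "u ^ N = 1" for u :: complex
  proof -
    have "u * u ^ (N - 1) = 1" using that N by (metis power_eq_if not_gr0)
    thus ?thesis by (simp add: inverse_unique)
  qed
  have z0: "z \<noteq> 0" "w \<noteq> 0" using N by (auto simp: power_0_left split: if_splits)
  have c: "conj_pair z w (chord f z) (chord f w)" for f
    unfolding chord_def inv[OF N(2)] inv[OF N(3)]
    by (intro conj_pair_diff conj_pair_power conj_pair_generator)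
  have i: "conj_pair z w (inverse (chord f z)) (inverse (chord f w))" if f: "f \<in> {1..M}" for f
  proof -
    have "z ^ (2 * f) \<noteq> 1" "w ^ (2 * f) \<noteq> 1" using ne f by auto
    moreover have "(z ^ (2 * f)) ^ N = 1" "(w ^ (2 * f)) ^ N = 1"
      using N by (metis mult.commute power_mult power_one)+
    ultimately show ?thesis
      using inverse_chord[OF z0(1), of f] inverse_chord[OF z0(2), of f] N(1)
      by (auto intro!: conj_pair_mult conj_pair_power conj_pair_generator conj_pair_inverse_root[of _ _ _ _ N])
  qed
  show ?thesis unfolding chord_sum_def
    by (intro conj_pair_sum conj_pair_mult conj_pair_power c i)
qed

text \<open>
  At \<open>\<alpha> = 2\<close> and up to a factor, this is the determinant of the block of a Fourier mode \<open>n\<close>, with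
  \<open>(v1, va, vb, vc)\<close> standing for the sums of index \<open>1\<close>, \<open>n - 1\<close>, \<open>n\<close> and \<open>n + 1\<close>.  It is homogeneous
  in these four and has integer coefficients.
\<close>

definition mode_form :: "'a::field \<Rightarrow> 'a \<Rightarrow> 'a \<Rightarrow> 'a \<Rightarrow> 'a \<Rightarrow> 'a" where
  "mode_form l v1 va vb vc =
     (2 * (l + 1)^2 * v1 + vc) * (2 * (l - 1)^2 * v1 + va) - 9 * (vb - v1)^2"

lemma mode_form_conj:
  assumes N: "N > 0" "z ^ N = 1" and h: "coprime h N" "h > 0"
    and ne: "\<And>f. 1 \<le> f \<Longrightarrow> f \<le> M \<Longrightarrow> z ^ (2 * f) \<noteq> 1 \<and> (z ^ h) ^ (2 * f) \<noteq> 1"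
    and eq: "mode_form (of_int l) (chord_sum M 1 z) (chord_sum M n1 z) (chord_sum M n2 z) (chord_sum M n3 z) = 0"
  shows "mode_form (of_int l) (chord_sum M 1 (z ^ h)) (chord_sum M n1 (z ^ h)) (chord_sum M n2 (z ^ h)) (chord_sum M n3 (z ^ h)) = 0"
proof -
  have zh: "(z ^ h) ^ N = 1" using N by (metis mult.commute power_mult power_one)
  note cp = conj_pair_chord_sum[OF N zh ne]
  have i: "conj_pair z (z ^ h) (of_int l) (of_int l)" "conj_pair z (z ^ h) 1 1" "conj_pair z (z ^ h) 2 2"
     "conj_pair z (z ^ h) 9 9"
    using conj_pair_of_int[of z "z ^ h" l] conj_pair_of_int[of z "z ^ h" 1]
      conj_pair_of_int[of z "z ^ h" 2] conj_pair_of_int[of z "z ^ h" 9] by simp_all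
  have "conj_pair z (z ^ h)
     (mode_form (of_int l) (chord_sum M 1 z) (chord_sum M n1 z) (chord_sum M n2 z) (chord_sum M n3 z))
     (mode_form (of_int l) (chord_sum M 1 (z ^ h)) (chord_sum M n1 (z ^ h)) (chord_sum M n2 (z ^ h)) (chord_sum M n3 (z ^ h)))"
    unfolding mode_form_def
    by (intro conj_pair_diff conj_pair_add conj_pair_mult conj_pair_power cp i)
  thus ?thesis using conj_pair_zero[OF N h] eq by simp
qed

text \<open>
  For the constant weight \<open>1\<close> this is \<open>stiffness 2 k n\<close> up to a factor independent of \<open>n\<close>; the general
  weight \<open>s\<close> covers the Galois conjugate sums as well.
\<close>

definition csum :: "(nat \<Rightarrow> real) \<Rightarrow> nat \<Rightarrow> nat \<Rightarrow> real" where
  "csum s k n = (\<Sum>e=1..<k. s e * (sin (n * (e * pi / k)))^2 / sin (e * pi / k) ^ 3)"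

text \<open>
  The sign \<open>(-1)\<^bsup>e+1\<^esup>\<close> of \<open>e \<le> k/2\<close>, continued symmetrically under \<open>e \<mapsto> k - e\<close>.
\<close>

definition altsign :: "nat \<Rightarrow> nat \<Rightarrow> real" where
  "altsign k e = (-1) ^ (min e (k - e) + 1)"

text \<open>
  One representative from each pair \<open>{e, k - e}\<close>: either the smaller one or the even one.  The even
  ones are the multiples that occur for the root of unity \<open>exp(2\<pi>\<i>/k)\<close> of odd order.
\<close>

lemma sum_symmetric_odd:
  fixes F :: "nat \<Rightarrow> 'a::comm_semiring_1"
  assumes k: "k = 2 * m + 1" and sym: "\<And>e. e \<in> {1..<k} \<Longrightarrow> F (k - e) = F e"
  shows "(\<Sum>e=1..<k. F e) = 2 * (\<Sum>f=1..m. F f)" "(\<Sum>e=1..<k. F e) = 2 * (\<Sum>f=1..m. F (2 * f))"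
proof -
  have "{1..<k} = {1..m} \<union> (\<lambda>f. k - f) ` {1..m}"
  proof safe
    fix x assume "x \<in> {1..<k}" "x \<notin> (\<lambda>f. k - f) ` {1..m}"
    moreover have "x = k - (k - x)" using \<open>x \<in> {1..<k}\<close> by auto
    ultimately have "k - x \<notin> {1..m}" by blast
    thus "x \<in> {1..m}" using \<open>x \<in> {1..<k}\<close> k by auto
  qed (use k in auto)
  moreover have "{1..m} \<inter> (\<lambda>f. k - f) ` {1..m} = {}" using k by auto
  moreover have "inj_on (\<lambda>f. k - f) {1..m}" using k by (auto simp: inj_on_def)
  ultimately have "(\<Sum>e=1..<k. F e) = (\<Sum>f=1..m. F f) + (\<Sum>f=1..m. F (k - f))"
    by (simp add: sum.union_disjoint sum.reindex)
  also have "(\<Sum>f=1..m. F (k - f)) = (\<Sum>f=1..m. F f)"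
    using k by (intro sum.cong refl sym) auto
  finally show "(\<Sum>e=1..<k. F e) = 2 * (\<Sum>f=1..m. F f)" by (simp add: mult_2)
  have "{1..<k} = (\<lambda>f. 2 * f) ` {1..m} \<union> (\<lambda>f. k - 2 * f) ` {1..m}"
  proof safe
    fix x assume x: "x \<in> {1..<k}" "x \<notin> (\<lambda>f. k - 2 * f) ` {1..m}"
    have "odd (k - x)"
    proof
      assume "even (k - x)"
      then obtain f where "k - x = 2 * f" by (elim evenE)
      hence "x = k - 2 * f" "f \<in> {1..m}" using x(1) k by auto
      thus False using x(2) by blast
    qed
    hence "even x" using k x(1) by auto
    then obtain f where "x = 2 * f" by (elim evenE)
    thus "x \<in> (\<lambda>f. 2 * f) ` {1..m}" using x(1) k by auto
  qed (use k in auto)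
  moreover have "(\<lambda>f. 2 * f) ` {1..m} \<inter> (\<lambda>f. k - 2 * f) ` {1..m} = {}"
  proof -
    have "2 * a \<noteq> k - 2 * b" if "b \<in> {1..m}" for a b using that k by presburger
    thus ?thesis by auto
  qed
  moreover have "inj_on (\<lambda>f. k - 2 * f) {1..m}" using k by (auto simp: inj_on_def)
  moreover have "inj_on (\<lambda>f. 2 * f) {1..m}" by (auto simp: inj_on_def)
  ultimately have "(\<Sum>e=1..<k. F e) = (\<Sum>f=1..m. F (2 * f)) + (\<Sum>f=1..m. F (k - 2 * f))"
    by (simp add: sum.union_disjoint sum.reindex)
  also have "(\<Sum>f=1..m. F (k - 2 * f)) = (\<Sum>f=1..m. F (2 * f))"
    using k by (intro sum.cong refl sym) auto
  finally show "(\<Sum>e=1..<k. F e) = 2 * (\<Sum>f=1..m. F (2 * f))" by (simp add: mult_2)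
qed

lemma chord_cis: "chord f (cis t) = 2 * \<i> * of_real (sin (f * t))"
  by (simp add: chord_def cis_inverse Complex.DeMoivre complex_eq_iff)

lemma chord_minus: "chord f (- u) = (-1) ^ f * chord f u"
  by (simp add: chord_def power_minus[of u] power_minus[of "inverse u"] algebra_simps)

lemma chord_term_cis:
  "chord (n * f) (cis t) ^ 2 * inverse (chord f (cis t)) ^ 3 = of_real (sin (n * (f * t)) ^ 2 / sin (f * t) ^ 3) / (2 * \<i>)"
  by (simp add: chord_cis field_simps power2_eq_square power3_eq_cube mult.assoc)

lemma chord_term_minus_cis:
  "chord (n * f) (- cis t) ^ 2 * inverse (chord f (- cis t)) ^ 3
     = (-1) ^ f * (chord (n * f) (cis t) ^ 2 * inverse (chord f (cis t)) ^ 3)"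
  by (cases "even f") (simp_all add: chord_minus power_mult_distrib flip: power_mult power_even_eq)

lemma sin_complement:
  assumes "e \<in> {1..<k}"
  shows "sin (real (k - e) * pi / real k) = sin (real e * pi / real k)"
    "sin (real n * (real (k - e) * pi / real k)) ^ 2 = sin (real n * (real e * pi / real k)) ^ 2"
proof -
  have *: "real (k - e) * pi / real k = pi - real e * pi / real k"
    using assms by (simp add: field_simps of_nat_diff)
  show "sin (real (k - e) * pi / real k) = sin (real e * pi / real k)" unfolding * by simp
  have "sin (real n * (pi - x)) ^ 2 = sin (real n * x) ^ 2" for x
    by (simp add: algebra_simps sin_diff sin_npi cos_npi power_mult_distrib flip: power_mult power_even_eq)
  thus "sin (real n * (real (k - e) * pi / real k)) ^ 2 = sin (real n * (real e * pi / real k)) ^ 2"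
    unfolding * .
qed

lemma csum_symmetric:
  assumes s: "\<And>e. e \<in> {1..<k} \<Longrightarrow> s (k - e) = s e" and e: "e \<in> {1..<k}"
  shows "s (k - e) * (sin (real n * (real (k - e) * pi / real k)))\<^sup>2 / sin (real (k - e) * pi / real k) ^ 3
     = s e * (sin (real n * (real e * pi / real k)))\<^sup>2 / sin (real e * pi / real k) ^ 3"
  using sin_complement[OF e] s[OF e] by simp

lemma altsign_sym: "e \<in> {1..<k} \<Longrightarrow> altsign k (k - e) = altsign k e"
  by (auto simp: altsign_def min.commute)

lemma mode_form_scale:
  "mode_form l (c * v1) (c * va) (c * vb) (c * vc) = c^2 * mode_form l v1 va vb vc"
  by (simp add: mode_form_def algebra_simps power2_eq_square)

lemma mode_form_of_real:
  "mode_form (of_int l) (of_real v1) (of_real va) (of_real vb) (of_real vc)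
    = (of_real (mode_form (of_int l) v1 va vb vc) :: complex)"
  by (simp add: mode_form_def)

lemma cis_power_ne_1:
  assumes "0 < real f * t" "real f * t < 2 * pi"
  shows "cis t ^ f \<noteq> 1"
proof
  assume "cis t ^ f = 1"
  hence "cos (real f * t) = 1" by (simp add: Complex.DeMoivre complex_eq_iff)
  then obtain n where "real f * t = real_of_int n * (2 * pi)"
    using cos_one_2pi_int by (metis (no_types, opaque_lifting) mult.commute mult.left_commute)
  hence "0 < real_of_int n" "real_of_int n < 1" using assms by (auto simp: zero_less_mult_iff)
  thus False by simp
qed

text \<open>
  For even \<open>k\<close> take \<open>z = exp(\<pi>\<i>/k)\<close>, of order \<open>2k\<close>; then \<open>-z = z\<^bsup>k+1\<^esup>\<close> is a conjugate.  For odd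
  \<open>k = 2m + 1\<close> take \<open>z = exp(2\<pi>\<i>/k)\<close>, of order \<open>k\<close>; then \<open>z\<^bsup>m+1\<^esup> = -exp(\<pi>\<i>/k)\<close> is a conjugate.
  In both cases the chords at the conjugate differ from the original ones, up to a reordering, by
  signs \<open>(-1)\<^sup>f\<close>, which cancel in the squares of the numerators but not in the cubes.
\<close>

theorem csum_galois:
  assumes k: "k \<ge> 3"
    and eq: "mode_form (of_int l) (csum (\<lambda>_. 1) k 1) (csum (\<lambda>_. 1) k n1) (csum (\<lambda>_. 1) k n2) (csum (\<lambda>_. 1) k n3) = 0"
  shows "mode_form (of_int l) (csum (altsign k) k 1) (csum (altsign k) k n1) (csum (altsign k) k n2) (csum (altsign k) k n3) = 0"
proof (cases "even k")
  case True
  define z where "z = cis (pi / k)"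
  have zN: "z ^ (2 * k) = 1" using k by (simp add: z_def Complex.DeMoivre)
  have zh: "z ^ (k + 1) = - z" using k by (simp add: z_def Complex.DeMoivre)
  have ne: "z ^ (2 * f) \<noteq> 1 \<and> (z ^ (k + 1)) ^ (2 * f) \<noteq> 1" if "1 \<le> f" "f \<le> k - 1" for f
  proof -
    have "z ^ (2 * f) \<noteq> 1" unfolding z_def
      by (rule cis_power_ne_1) (use that k in \<open>auto simp: field_simps\<close>)
    thus ?thesis unfolding zh by simp
  qed
  \<comment> \<open>Only for even \<open>k\<close> is \<open>k + 1\<close> odd and therefore an exponent of a conjugation.\<close>
  have cop: "coprime (k + 1) (2 * k)" using True by simp
  have R: "chord_sum (k - 1) n z = inverse (2 * \<i>) * of_real (csum (\<lambda>_. 1) k n)" for n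
    unfolding chord_sum_def csum_def z_def chord_term_cis using k
    by (simp add: sum_distrib_left sum_divide_distrib field_simps atLeastLessThanSuc_atLeastAtMost[symmetric])
  have "even (min e (k - e)) = even e" if "e \<in> {1..<k}" for e using True that by (auto simp: min_def)
  hence sgn: "(-1) ^ e = - altsign k e" if "e \<in> {1..<k}" for e
    using that by (auto simp: altsign_def minus_one_power_iff)
  have S: "chord_sum (k - 1) n (z ^ (k + 1)) = (- inverse (2 * \<i>)) * of_real (csum (altsign k) k n)" for n
  proof -
    have "chord_sum (k - 1) n (z ^ (k + 1)) = (\<Sum>e=1..<k. (-1) ^ e * (of_real (sin (n * (e * pi / k)) ^ 2 / sin (e * pi / k) ^ 3) / (2 * \<i>)))"
      unfolding zh unfolding z_def chord_sum_def chord_term_minus_cis chord_term_cis using k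
      by (intro sum.cong) auto
    also have "\<dots> = (\<Sum>e=1..<k. - inverse (2 * \<i>) * of_real (altsign k e * sin (n * (e * pi / k)) ^ 2 / sin (e * pi / k) ^ 3))"
    proof (intro sum.cong refl)
      fix e assume e: "e \<in> {1..<k}"
      have "((-1) ^ e :: complex) = of_real ((-1) ^ e)" by simp
      also have "\<dots> = - of_real (altsign k e)" using sgn[OF e] by simp
      finally have "((-1) ^ e :: complex) = - of_real (altsign k e)" .
      thus "(-1) ^ e * (of_real (sin (n * (e * pi / k)) ^ 2 / sin (e * pi / k) ^ 3) / (2 * \<i>))
         = - inverse (2 * \<i>) * of_real (altsign k e * sin (n * (e * pi / k)) ^ 2 / sin (e * pi / k) ^ 3)"
        by (simp add: field_simps)
    qed
    also have "\<dots> = (- inverse (2 * \<i>)) * of_real (csum (altsign k) k n)"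
      by (simp only: csum_def of_real_sum sum_distrib_left)
    finally show ?thesis .
  qed
  have "mode_form (of_int l) (chord_sum (k - 1) 1 z) (chord_sum (k - 1) n1 z) (chord_sum (k - 1) n2 z) (chord_sum (k - 1) n3 z) = 0"
    unfolding R mode_form_scale mode_form_of_real eq by simp
  from mode_form_conj[OF _ zN cop _ ne this] k
  have "mode_form (of_int l) (chord_sum (k - 1) 1 (z ^ (k + 1))) (chord_sum (k - 1) n1 (z ^ (k + 1))) (chord_sum (k - 1) n2 (z ^ (k + 1))) (chord_sum (k - 1) n3 (z ^ (k + 1))) = 0"
    by simp
  thus ?thesis unfolding S mode_form_scale mode_form_of_real by simp
next
  case False
  then obtain m where m: "k = 2 * m + 1" by (elim oddE)
  define z where "z = cis (2 * pi / k)"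
  have zN: "z ^ k = 1" using k by (simp add: z_def Complex.DeMoivre)
  have zh: "z ^ (m + 1) = - cis (pi / k)"
  proof -
    have "real (m + 1) * (2 * pi / k) = pi + pi / k" using m k by (simp add: field_simps)
    thus ?thesis by (simp only: z_def Complex.DeMoivre) (simp add: complex_eq_iff)
  qed
  have ne: "z ^ (2 * f) \<noteq> 1 \<and> (z ^ (m + 1)) ^ (2 * f) \<noteq> 1" if f: "1 \<le> f" "f \<le> m" for f
  proof -
    have fk: "real f < real k" "2 * real f < real k" using f m by simp_all
    have "cis (2 * pi / k) ^ f \<noteq> 1"
      by (rule cis_power_ne_1) (use f k fk in \<open>auto simp: field_simps\<close>)
    moreover have "(- cis (pi / k)) ^ (2 * f) = cis (2 * pi / k) ^ f"
      by (simp add: Complex.DeMoivre algebra_simps)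
    moreover have "z ^ (2 * f) \<noteq> 1"
    proof -
      have "cis (2 * pi / k) ^ (2 * f) \<noteq> 1"
        by (rule cis_power_ne_1) (use f k fk in \<open>auto simp: field_simps\<close>)
      thus ?thesis by (simp add: z_def)
    qed
    ultimately show ?thesis unfolding zh by simp
  qed
  have cop: "coprime (m + 1) k"
  proof (rule coprimeI)
    fix c assume "c dvd m + 1" "c dvd k"
    hence "c dvd 2 * (m + 1) - k" by (meson dvd_diff_nat dvd_mult)
    thus "is_unit c" using m by simp
  qed
  have R: "chord_sum m n z = inverse (4 * \<i>) * of_real (csum (\<lambda>_. 1) k n)" for n
  proof -
    have "csum (\<lambda>_. 1) k n = 2 * (\<Sum>f=1..m. 1 * (sin (n * (real (2 * f) * pi / k)))^2 / sin (real (2 * f) * pi / k) ^ 3)"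
      unfolding csum_def by (rule sum_symmetric_odd(2)[OF m]) (rule csum_symmetric, auto)
    moreover have "chord_sum m n z = (\<Sum>f=1..m. of_real (sin (n * (real (2 * f) * pi / k)) ^ 2 / sin (real (2 * f) * pi / k) ^ 3) / (2 * \<i>))"
      unfolding z_def chord_sum_def chord_term_cis by (simp add: mult_ac)
    ultimately show ?thesis by (simp add: sum_distrib_left sum_divide_distrib field_simps)
  qed
  have S: "chord_sum m n (z ^ (m + 1)) = (- inverse (4 * \<i>)) * of_real (csum (altsign k) k n)" for n
  proof -
    have a: "altsign k f = - ((-1) ^ f)" if "f \<in> {1..m}" for f
    proof -
      have "min f (k - f) = f" using that m by auto
      thus ?thesis by (simp add: altsign_def)
    qed
    have "csum (altsign k) k n = 2 * (\<Sum>f=1..m. altsign k f * (sin (n * (f * pi / k)))^2 / sin (f * pi / k) ^ 3)"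
      unfolding csum_def by (rule sum_symmetric_odd(1)[OF m]) (rule csum_symmetric, auto simp: altsign_sym)
    also have "\<dots> = - 2 * (\<Sum>f=1..m. (-1) ^ f * (sin (n * (f * pi / k)))^2 / sin (f * pi / k) ^ 3)"
      using a by (simp add: sum_negf)
    finally have c: "csum (altsign k) k n = - 2 * (\<Sum>f=1..m. (-1) ^ f * (sin (n * (f * pi / k)))^2 / sin (f * pi / k) ^ 3)" .
    have "chord_sum m n (z ^ (m + 1)) = (\<Sum>f=1..m. (-1) ^ f * (of_real (sin (n * (f * pi / k)) ^ 2 / sin (f * pi / k) ^ 3) / (2 * \<i>)))"
      unfolding zh chord_sum_def chord_term_minus_cis chord_term_cis by simp
    also have "\<dots> = inverse (2 * \<i>) * of_real (\<Sum>f=1..m. (-1) ^ f * (sin (n * (f * pi / k)))^2 / sin (f * pi / k) ^ 3)"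
      by (simp add: sum_distrib_left field_simps)
    finally show ?thesis unfolding c by (simp add: field_simps)
  qed
  have "mode_form (of_int l) (chord_sum m 1 z) (chord_sum m n1 z) (chord_sum m n2 z) (chord_sum m n3 z) = 0"
    unfolding R mode_form_scale mode_form_of_real eq by simp
  from mode_form_conj[OF _ zN cop _ ne this] k
  have "mode_form (of_int l) (chord_sum m 1 (z ^ (m + 1))) (chord_sum m n1 (z ^ (m + 1))) (chord_sum m n2 (z ^ (m + 1))) (chord_sum m n3 (z ^ (m + 1))) = 0"
    by simp
  thus ?thesis unfolding S mode_form_scale mode_form_of_real by simp
qed

section \<open>Differences of the sums and their closed forms\<close>

text \<open>
  Half of the second differences of \<open>csum\<close>.
\<close>

definition ctsum :: "(nat \<Rightarrow> real) \<Rightarrow> nat \<Rightarrow> nat \<Rightarrow> real" where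
  "ctsum s k n = (\<Sum>e=1..<k. s e * cos (2 * n * (e * pi / k)) / sin (e * pi / k))"

text \<open>
  Minus one half of the differences of \<open>ctsum\<close>.  The cosecants are gone, so that these sums are
  geometric.
\<close>

definition sinsum :: "(nat \<Rightarrow> real) \<Rightarrow> nat \<Rightarrow> nat \<Rightarrow> real" where
  "sinsum s k n = (\<Sum>e=1..<k. s e * sin ((2 * n + 1) * (e * pi / k)))"

lemma sin_node_pos: "e \<in> {1..<k} \<Longrightarrow> sin (real e * pi / real k) > 0"
  by (rule sin_gt_zero) (auto simp: field_simps)

lemma csum_0 [simp]: "csum s k 0 = 0"
  by (simp add: csum_def)

lemma csum_1: "csum s k 1 = ctsum s k 0"
  unfolding csum_def ctsum_def
  by (rule sum.cong) (use sin_node_pos[of _ k] in \<open>force simp: power2_eq_square power3_eq_cube\<close>)+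

lemma csum_Suc_Suc: "csum s k (Suc (Suc n)) = 2 * csum s k (Suc n) - csum s k n + 2 * ctsum s k (Suc n)"
proof -
  have trig: "(sin (real (Suc (Suc n)) * x))\<^sup>2 = 2 * (sin (real (Suc n) * x))\<^sup>2 - (sin (real n * x))\<^sup>2 + 2 * (sin x)\<^sup>2 * cos (2 * real (Suc n) * x)" for x
  proof -
    define y where "y = real (Suc n) * x"
    have a: "real (Suc (Suc n)) * x = y + x" "real n * x = y - x" "2 * real (Suc n) * x = 2 * y"
      by (auto simp: y_def algebra_simps)
    show ?thesis unfolding a y_def[symmetric] sin_add sin_diff cos_double
      using sin_cos_squared_add[of x] sin_cos_squared_add[of y] by algebra
  qed
  have "csum s k (Suc (Suc n)) = (\<Sum>e=1..<k. 2 * (s e * (sin (real (Suc n) * (real e * pi / real k)))\<^sup>2 / sin (real e * pi / real k) ^ 3)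
     - s e * (sin (real n * (real e * pi / real k)))\<^sup>2 / sin (real e * pi / real k) ^ 3
     + 2 * (s e * cos (2 * real (Suc n) * (real e * pi / real k)) / sin (real e * pi / real k)))"
    unfolding csum_def
  proof (rule sum.cong[OF refl])
    fix e assume "e \<in> {1..<k}"
    hence s0: "sin (real e * pi / real k) \<noteq> 0" using sin_node_pos[of e k] by simp
    have f: "A * (2 * P - Q + 2 * X\<^sup>2 * Y) / X ^ 3 = 2 * (A * P / X ^ 3) - A * Q / X ^ 3 + 2 * (A * Y / X)"
      if "X \<noteq> 0" for A P Q X Y :: real
      using that by (simp add: field_simps power2_eq_square power3_eq_cube)
    show "s e * (sin (real (Suc (Suc n)) * (real e * pi / real k)))\<^sup>2 / sin (real e * pi / real k) ^ 3 =
      2 * (s e * (sin (real (Suc n) * (real e * pi / real k)))\<^sup>2 / sin (real e * pi / real k) ^ 3)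
     - s e * (sin (real n * (real e * pi / real k)))\<^sup>2 / sin (real e * pi / real k) ^ 3
     + 2 * (s e * cos (2 * real (Suc n) * (real e * pi / real k)) / sin (real e * pi / real k))"
      unfolding trig by (rule f[OF s0])
  qed
  also have "\<dots> = 2 * csum s k (Suc n) - csum s k n + 2 * ctsum s k (Suc n)"
    by (simp only: sum.distrib sum_subtractf sum_distrib_left[symmetric] csum_def ctsum_def)
  finally show ?thesis .
qed

lemma ctsum_Suc: "ctsum s k (Suc n) = ctsum s k n - 2 * sinsum s k n"
proof -
  have trig: "cos (2 * real (Suc n) * x) = cos (2 * real n * x) - 2 * sin x * sin ((2 * real n + 1) * x)" for x
  proof -
    define y where "y = (2 * real n + 1) * x"
    have a: "2 * real (Suc n) * x = y + x" "2 * real n * x = y - x"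
      by (auto simp: y_def algebra_simps)
    show ?thesis unfolding a y_def[symmetric] cos_add cos_diff by simp
  qed
  have "ctsum s k (Suc n) = (\<Sum>e=1..<k. s e * cos (2 * real n * (real e * pi / real k)) / sin (real e * pi / real k)
     - 2 * (s e * sin ((2 * real n + 1) * (real e * pi / real k))))"
    unfolding ctsum_def
  proof (rule sum.cong[OF refl])
    fix e assume "e \<in> {1..<k}"
    hence s0: "sin (real e * pi / real k) \<noteq> 0" using sin_node_pos[of e k] by simp
    have f: "A * (P - 2 * X * Q) / X = A * P / X - 2 * (A * Q)" if "X \<noteq> 0" for A P Q X :: real
      using that by (simp add: field_simps)
    show "s e * cos (2 * real (Suc n) * (real e * pi / real k)) / sin (real e * pi / real k) =
       s e * cos (2 * real n * (real e * pi / real k)) / sin (real e * pi / real k)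
     - 2 * (s e * sin ((2 * real n + 1) * (real e * pi / real k)))"
      unfolding trig by (rule f[OF s0])
  qed
  also have "\<dots> = ctsum s k n - 2 * sinsum s k n"
    by (simp add: sum_subtractf sum_distrib_left ctsum_def sinsum_def)
  finally show ?thesis .
qed

lemma csum_reflect:
  assumes "n \<le> k"
  shows "csum s k (k - n) = csum s k n"
  unfolding csum_def
proof (rule sum.cong[OF refl])
  fix e assume e: "e \<in> {1..<k}"
  have "real (k - n) * (real e * pi / real k) = real e * pi - real n * (real e * pi / real k)"
    using assms e by (simp add: field_simps of_nat_diff)
  hence "sin (real (k - n) * (real e * pi / real k)) ^ 2 = sin (real n * (real e * pi / real k)) ^ 2"
    by (simp add: sin_diff sin_npi cos_npi power_mult_distrib flip: power_mult power_even_eq)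
  thus "s e * (sin (real (k - n) * (real e * pi / real k)))\<^sup>2 / sin (real e * pi / real k) ^ 3
     = s e * (sin (real n * (real e * pi / real k)))\<^sup>2 / sin (real e * pi / real k) ^ 3" by simp
qed

text \<open>
  The angle \<open>(2n+1)\<pi>/(2k)\<close>, in which the third differences are elementary.
\<close>

definition half_node :: "nat \<Rightarrow> nat \<Rightarrow> real" where
  "half_node k n = (2 * n + 1) * pi / (2 * k)"

lemma half_node_pos: "k > 0 \<Longrightarrow> half_node k n > 0"
  by (simp add: half_node_def)

lemma half_node_less:
  assumes "2 * n + 1 < k"
  shows "half_node k n < pi / 2"
proof -
  have "real (2 * n + 1) * pi < real k * pi" using assms by (intro mult_strict_right_mono) auto
  thus ?thesis using assms by (simp add: half_node_def field_simps)
qed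

lemma odd_pi_minus:
  "cos ((2 * real n + 1) * pi - a) = - cos a" "sin ((2 * real n + 1) * pi - a) = sin a"
proof -
  have "(2 * real n + 1) * pi = real (2 * n + 1) * pi" by simp
  thus "cos ((2 * real n + 1) * pi - a) = - cos a" "sin ((2 * real n + 1) * pi - a) = sin a"
    by (simp_all only: cos_diff sin_diff cos_npi sin_npi) simp_all
qed

lemma half_node_strict_mono: "k > 0 \<Longrightarrow> n < m \<Longrightarrow> half_node k n < half_node k m"
  by (simp add: half_node_def field_simps)

text \<open>
  Multiplication by \<open>2 sin\<close> of the angle makes the sum telescope.
\<close>

lemma sinsum_plain:
  assumes "n < k"
  shows "sinsum (\<lambda>_. 1) k n = cot (half_node k n)"
proof -
  define a where "a = half_node k n"
  have ka: "real k * (2 * a) = (2 * real n + 1) * pi" using assms by (simp add: a_def half_node_def)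
  have "real (2 * n + 1) * pi < real (2 * k) * pi" using assms by (intro mult_strict_right_mono) auto
  hence "0 < a" "a < pi" using assms half_node_pos[of k n] by (auto simp: a_def half_node_def field_simps)
  hence sa: "sin a > 0" by (rule sin_gt_zero)
  have tel: "(\<Sum>e=1..<Suc m. 2 * sin (real e * (2 * a)) * sin a) = cos a - cos (real m * (2 * a) + a)" for m
  proof (induction m)
    case (Suc m)
    have "2 * sin (real (Suc m) * (2 * a)) * sin a = cos (real (Suc m) * (2 * a) - a) - cos (real (Suc m) * (2 * a) + a)"
      by (simp add: cos_diff cos_add)
    moreover have "real (Suc m) * (2 * a) - a = real m * (2 * a) + a" by (simp add: algebra_simps)
    ultimately have "2 * sin (real (Suc m) * (2 * a)) * sin a = cos (real m * (2 * a) + a) - cos (real (Suc m) * (2 * a) + a)"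
      by metis
    thus ?case using Suc by (subst sum.atLeastLessThan_Suc) (simp_all del: of_nat_Suc)
  qed simp
  obtain m where m: "k = Suc m" using assms by (cases k) auto
  have "real m * (2 * a) + a = (2 * real n + 1) * pi - a" using ka m by (simp add: algebra_simps)
  also have "cos \<dots> = - cos a"
    by (rule odd_pi_minus)
  finally have "(\<Sum>e=1..<k. 2 * sin (real e * (2 * a)) * sin a) = 2 * cos a" using tel[of m] m by simp
  moreover have "(2 * real n + 1) * (real e * pi / real k) = real e * (2 * a)" for e
    using assms by (simp add: a_def half_node_def field_simps)
  ultimately have "sinsum (\<lambda>_. 1) k n * (2 * sin a) = 2 * cos a"
    by (simp add: sinsum_def sum_distrib_left sum_distrib_right mult_ac)
  thus ?thesis using sa by (simp add: cot_def a_def[symmetric] field_simps)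
qed

lemma alternating_sin_sum:
  "(\<Sum>e=1..m. (-1) ^ (e + 1) * sin (real e * (2 * a))) * (2 * cos a)
     = sin a - (-1) ^ m * sin (real m * (2 * a) + a)"
proof (induction m)
  case (Suc m)
  have "sin (real (Suc m) * (2 * a)) * (2 * cos a) = sin (real (Suc m) * (2 * a) + a) + sin (real (Suc m) * (2 * a) - a)"
    by (simp add: sin_diff sin_add)
  moreover have "real (Suc m) * (2 * a) - a = real m * (2 * a) + a" by (simp add: algebra_simps)
  ultimately have *: "sin (real (Suc m) * (2 * a)) * (2 * cos a) = sin (real (Suc m) * (2 * a) + a) + sin (real m * (2 * a) + a)"
    by metis
  have "(\<Sum>e=1..Suc m. (-1) ^ (e + 1) * sin (real e * (2 * a))) * (2 * cos a)
    = (\<Sum>e=1..m. (-1) ^ (e + 1) * sin (real e * (2 * a))) * (2 * cos a)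
      + (-1) ^ m * (sin (real (Suc m) * (2 * a)) * (2 * cos a))"
    by (simp add: algebra_simps)
  also have "\<dots> = sin a - (-1) ^ Suc m * sin (real (Suc m) * (2 * a) + a)"
    unfolding Suc.IH * by (simp add: algebra_simps)
  finally show ?case .
qed simp

lemma sinsum_alt_even:
  assumes "even k" "2 * n + 1 < k"
  shows "sinsum (altsign k) k n = tan (half_node k n)"
proof -
  define a where "a = half_node k n"
  have ka: "real k * (2 * a) = (2 * real n + 1) * pi" using assms by (simp add: a_def half_node_def)
  have "0 < a" "a < pi / 2" using assms half_node_less half_node_pos[of k n] by (auto simp: a_def)
  hence ca: "cos a > 0" by (intro cos_gt_zero) auto
  obtain m where m: "k = Suc m" using assms by (cases k) auto
  have "real m * (2 * a) + a = (2 * real n + 1) * pi - a" using ka m by (simp add: algebra_simps)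
  also have "sin \<dots> = sin a"
    by (rule odd_pi_minus)
  finally have s: "sin (real m * (2 * a) + a) = sin a" .
  have om: "odd m" using assms m by simp
  have *: "(2 * real n + 1) * (real e * pi / real k) = real e * (2 * a)" for e
    using assms by (simp add: a_def half_node_def field_simps)
  have "sinsum (altsign k) k n = (\<Sum>e=1..m. (-1) ^ (e + 1) * sin (real e * (2 * a)))"
    unfolding sinsum_def * using m
  proof (intro sum.cong)
    fix e assume "e \<in> {1..m}"
    hence "even (min e (k - e)) = even e" using assms m by (auto simp: min_def)
    thus "altsign k e * sin (real e * (2 * a)) = (-1) ^ (e + 1) * sin (real e * (2 * a))"
      by (simp add: altsign_def minus_one_power_iff)
  qed auto
  hence "sinsum (altsign k) k n * (2 * cos a) = 2 * sin a"
    using alternating_sin_sum[of a m] s om by simp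
  thus ?thesis using ca by (simp add: tan_def a_def[symmetric] field_simps)
qed

text \<open>
  The half-angle form of \<open>sec a \<plusminus> tan a\<close>.
\<close>

lemma tan_add_sec:
  assumes "0 \<le> a" "a < pi / 2"
  shows "tan (pi / 4 + a / 2) = (sin a + 1) / cos a" "tan (pi / 4 - a / 2) = (1 - sin a) / cos a"
proof -
  define x where "x = a / 2"
  have x: "0 \<le> x" "x < pi / 4" "a = 2 * x" using assms by (auto simp: x_def)
  have cx: "cos x > 0" using x by (intro cos_gt_zero_pi) auto
  have c2: "cos (2 * x) > 0" using x by (intro cos_gt_zero_pi) auto
  have fac: "cos (2 * x) = (cos x - sin x) * (cos x + sin x)"
    using cos_double[of x] by (simp add: power2_eq_square algebra_simps)
  have s2: "1 + sin (2 * x) = (cos x + sin x)^2" "1 - sin (2 * x) = (cos x - sin x)^2"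
    using sin_cos_squared_add3[of x] sin_double[of x] by (simp_all add: power2_eq_square algebra_simps)
  have nz: "cos x - sin x \<noteq> 0" "cos x + sin x \<noteq> 0" using c2 fac by auto
  have q: "tan (pi / 4 + x) = (cos x + sin x) / (cos x - sin x)" "tan (pi / 4 - x) = (cos x - sin x) / (cos x + sin x)"
  proof -
    define c where "c = sqrt 2 / 2"
    have c: "c \<noteq> 0" by (simp add: c_def)
    have "tan (pi / 4 + x) = (c * (cos x + sin x)) / (c * (cos x - sin x))"
      "tan (pi / 4 - x) = (c * (cos x - sin x)) / (c * (cos x + sin x))"
      unfolding tan_def
      by (intro arg_cong2[where f = "(/)"];
          simp add: sin_add cos_add sin_diff cos_diff sin_45 cos_45 c_def algebra_simps)+
    thus "tan (pi / 4 + x) = (cos x + sin x) / (cos x - sin x)" "tan (pi / 4 - x) = (cos x - sin x) / (cos x + sin x)"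
      using c by simp_all
  qed
  show "tan (pi / 4 + a / 2) = (sin a + 1) / cos a"
    unfolding x(3) using q(1) nz s2(1) fac by (simp add: add.commute power2_eq_square)
  show "tan (pi / 4 - a / 2) = (1 - sin a) / cos a"
    unfolding x(3) using q(2) nz s2(2) fac by (simp add: power2_eq_square)
qed

text \<open>
  The symmetric signs leave an alternating sum over half of the range, and its upper end contributes
  \<open>\<plusminus>1\<close> according to the parity of \<open>m + n\<close>.  This is why for odd \<open>k\<close> only indices at distance two
  are comparable.
\<close>

lemma sinsum_alt_odd:
  assumes k: "k = 2 * m + 1" and n: "n \<le> m"
  shows "sinsum (altsign k) k n =
    (if even (m + n) then - tan (pi / 4 - half_node k n / 2) else tan (pi / 4 + half_node k n / 2))"
proof -
  define a where "a = half_node k n"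
  have *: "(2 * real n + 1) * (real e * pi / real k) = real e * (2 * a)" for e
    using k by (simp add: a_def half_node_def field_simps)
  have sym: "altsign k (k - e) * sin (real (k - e) * (2 * a)) = altsign k e * sin (real e * (2 * a))"
    if e: "e \<in> {1..<k}" for e
  proof -
    have "real (k - e) * (2 * a) = (2 * real n + 1) * pi - real e * (2 * a)"
      using e by (simp add: a_def half_node_def field_simps of_nat_diff)
    also have "sin \<dots> = sin (real e * (2 * a))"
      by (rule odd_pi_minus)
    finally show ?thesis using altsign_sym[OF e] by simp
  qed
  have "sinsum (altsign k) k n = 2 * (\<Sum>e=1..m. altsign k e * sin (real e * (2 * a)))"
    unfolding sinsum_def * by (rule sum_symmetric_odd(1)[OF k], rule sym)
  also have "(\<Sum>e=1..m. altsign k e * sin (real e * (2 * a))) = (\<Sum>e=1..m. (-1) ^ (e + 1) * sin (real e * (2 * a)))"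
    by (rule sum.cong) (use k in \<open>auto simp: altsign_def min_def\<close>)
  finally have S: "sinsum (altsign k) k n = 2 * (\<Sum>e=1..m. (-1) ^ (e + 1) * sin (real e * (2 * a)))" .
  show ?thesis
  proof (cases "n = m")
    case True
    have a: "a = pi / 2" using k by (simp add: a_def half_node_def True field_simps)
    have "sinsum (altsign k) k n = 0" unfolding S by (simp add: a sin_npi)
    moreover have "even (m + n)" "pi / 4 - half_node k n / 2 = 0" using True a by (simp_all add: a_def)
    ultimately show ?thesis by (simp only: if_True tan_zero minus_zero)
  next
    case False
    hence "0 < a" "a < pi / 2" using half_node_pos[of k n] half_node_less[of n k] n k by (auto simp: a_def)
    hence ca: "cos a > 0" by (intro cos_gt_zero) auto
    have "real m * (2 * a) + a = real k * a" using k by (simp add: algebra_simps)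
    also have "k > 0" using k by simp
    hence "real k * a = real n * pi + pi / 2" by (simp add: a_def half_node_def field_simps)
    finally have "real m * (2 * a) + a = real n * pi + pi / 2" .
    hence "sin (real m * (2 * a) + a) = (-1) ^ n" by (simp add: sin_add cos_npi)
    hence "sinsum (altsign k) k n * cos a = sin a - (-1) ^ (m + n)"
      using alternating_sin_sum[of a m] unfolding S by (simp add: power_add)
    hence "sinsum (altsign k) k n = (sin a - (-1) ^ (m + n)) / cos a" using ca by (simp add: field_simps)
    thus ?thesis using tan_add_sec[of a] \<open>0 < a\<close> \<open>a < pi / 2\<close>
      by (auto simp: a_def[symmetric] minus_divide_left)
  qed
qed

section \<open>Growth of the normalized sums\<close>

text \<open>
  A discrete concavity argument.  If \<open>g\<close> were negative somewhere before \<open>M'\<close>, some increment \<open>H\<close>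
  before that point would be negative and all later ones as well, so \<open>g\<close> would be negative at both
  \<open>M\<close> and \<open>M'\<close>; but these two values are opposite.
\<close>

lemma antisymmetric_slopes_nonneg:
  fixes g H :: "nat \<Rightarrow> real"
  assumes g0: "g 0 \<ge> 0"
    and step: "\<And>n. n < M \<Longrightarrow> g (Suc n) = g n + 2 * H (Suc n)"
    and stays: "\<And>i j. i \<le> j \<Longrightarrow> j \<le> M \<Longrightarrow> H i < 0 \<Longrightarrow> H j < 0"
    and anti: "g M + g M' = 0" and M': "M' \<le> M"
    and n: "n \<le> M'"
  shows "g n \<ge> 0"
proof (rule ccontr)
  assume neg: "\<not> g n \<ge> 0"
  have "\<exists>i. i \<le> n \<and> H i < 0"
  proof (rule ccontr)
    assume no: "\<not> (\<exists>i. i \<le> n \<and> H i < 0)"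
    have "j \<le> n \<Longrightarrow> g j \<ge> 0" for j
    proof (induction j)
      case (Suc j)
      hence "H (Suc j) \<ge> 0" using no by force
      thus ?case using Suc step[of j] n M' by simp
    qed (use g0 in simp)
    thus False using neg by blast
  qed
  then obtain i where i: "i \<le> n" "H i < 0" by blast
  have dec: "n + j \<le> M \<Longrightarrow> g (n + j) \<le> g n" for j
  proof (induction j)
    case (Suc j)
    have "H (Suc (n + j)) < 0" using stays[of i "Suc (n + j)"] i Suc.prems by simp
    thus ?case using Suc step[of "n + j"] by simp
  qed simp
  have "g M \<le> g n" "g M' \<le> g n" using dec[of "M - n"] dec[of "M' - n"] n M' by simp_all
  thus False using anti neg by simp
qed

text \<open>
  To become negative from \<open>H 0 \<ge> 0\<close> the sequence needs a negative increment, and the increments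
  decrease.
\<close>

lemma concave_stays_negative:
  fixes H K :: "nat \<Rightarrow> real"
  assumes H0: "H 0 \<ge> 0"
    and step: "\<And>n. n < M \<Longrightarrow> H (Suc n) = H n + K n"
    and dec: "\<And>n. Suc n < M \<Longrightarrow> K (Suc n) \<le> K n"
    and ij: "i \<le> j" "j \<le> M" and neg: "H i < 0"
  shows "H j < 0"
proof -
  have "\<exists>p<i. K p < 0"
  proof (rule ccontr)
    assume no: "\<not> (\<exists>p<i. K p < 0)"
    have "q \<le> i \<Longrightarrow> H q \<ge> 0" for q
    proof (induction q)
      case (Suc q)
      have "K q \<ge> 0" using no Suc.prems by (meson Suc_le_lessD not_less)
      thus ?case using Suc step[of q] ij by simp
    qed (use H0 in simp)
    thus False using neg by force
  qed
  then obtain p where p: "p < i" "K p < 0" by blast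
  have K: "p + q < M \<Longrightarrow> K (p + q) < 0" for q
  proof (induction q)
    case (Suc q)
    thus ?case using dec[of "p + q"] by simp
  qed (use p in simp)
  have "i + q \<le> M \<Longrightarrow> H (i + q) < 0" for q
  proof (induction q)
    case (Suc q)
    have "K (i + q) < 0" using K[of "i + q - p"] p Suc.prems by simp
    thus ?case using Suc step[of "i + q"] by simp
  qed (use neg in simp)
  from this[of "j - i"] show ?thesis using ij by simp
qed

lemma cot_antimono:
  assumes "0 < x" "x \<le> y" "y \<le> pi / 2"
  shows "cot y \<le> cot (x::real)"
proof -
  have "cos y \<le> cos x" "0 \<le> cos y" using assms by (auto intro!: cos_monotone_0_pi_le cos_ge_zero)
  moreover have "sin x \<le> sin y" "0 < sin x" using assms by (auto intro!: sin_monotone_2pi_le sin_gt_zero)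
  ultimately show ?thesis unfolding cot_def by (intro frac_le) auto
qed

lemma half_node_mono: "n \<le> m \<Longrightarrow> half_node k n \<le> half_node k m"
  by (simp add: half_node_def divide_right_mono)

lemma half_node_le: "2 * n + 1 \<le> k \<Longrightarrow> half_node k n \<le> pi / 2"
proof -
  assume "2 * n + 1 \<le> k"
  hence "real (2 * n + 1) * pi \<le> real k * pi" by (intro mult_right_mono) auto
  thus ?thesis using \<open>2 * n + 1 \<le> k\<close> by (simp add: half_node_def field_simps)
qed

lemma tan_mono_le2: "- (pi / 2) < x \<Longrightarrow> x \<le> y \<Longrightarrow> y < pi / 2 \<Longrightarrow> tan x \<le> tan y"
  using tan_monotone[of x y] by (cases "x = y") auto

text \<open>
  Immediate from the closed forms, in which \<open>half_node\<close> increases and the case distinction depends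
  only on the parity of \<open>j\<close>.
\<close>

lemma sinsum_alt_mono:
  assumes "2 * (j + 2) + 1 \<le> k"
  shows "sinsum (altsign k) k j \<le> sinsum (altsign k) k (j + 2)"
proof (cases "even k")
  case True
  hence lt: "2 * (j + 2) + 1 < k" using assms by (cases "2 * (j + 2) + 1 = k") auto
  show ?thesis unfolding sinsum_alt_even[OF True lt]
    using sinsum_alt_even[OF True, of j] lt half_node_pos[of k j] half_node_less[OF lt] half_node_mono[of j "j + 2" k]
    by (auto intro!: tan_mono_le2)
next
  case False
  then obtain m where m: "k = 2 * m + 1" by (elim oddE)
  have "j + 2 \<le> m" using assms m by simp
  hence *: "half_node k j \<le> half_node k (j + 2)" "half_node k (j + 2) \<le> pi / 2" "0 < half_node k j"
    using half_node_pos[of k j] half_node_le[OF assms] half_node_mono[of j "j + 2" k] m by auto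
  show ?thesis
  proof (cases "even (m + j)")
    case True
    hence "tan (pi / 4 - half_node k (j + 2) / 2) \<le> tan (pi / 4 - half_node k j / 2)"
      using * by (intro tan_mono_le2) auto
    thus ?thesis using sinsum_alt_odd[OF m] \<open>j + 2 \<le> m\<close> True by simp
  next
    case False
    have "j + 2 < m" using False \<open>j + 2 \<le> m\<close> by (cases "j + 2 = m") auto
    hence "half_node k (j + 2) < pi / 2" using half_node_less[of "j + 2" k] m by simp
    hence "tan (pi / 4 + half_node k j / 2) \<le> tan (pi / 4 + half_node k (j + 2) / 2)"
      using * by (intro tan_mono_le2) auto
    thus ?thesis using sinsum_alt_odd[OF m] \<open>j + 2 \<le> m\<close> False by simp
  qed
qed

lemma sinsum_alt_pair_nonneg:
  assumes "2 * (j + 1) + 1 \<le> k"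
  shows "sinsum (altsign k) k j + sinsum (altsign k) k (j + 1) \<ge> 0"
  using assms
proof (induction j)
  case 0
  show ?case
  proof (cases "even k")
    case True
    hence "k \<ge> 4" using 0 by presburger
    hence "0 < tan (half_node k 0)" "0 < tan (half_node k 1)"
      by (auto intro!: tan_gt_zero half_node_pos half_node_less)
    thus ?thesis using sinsum_alt_even[OF True, of 0] sinsum_alt_even[OF True, of 1] \<open>k \<ge> 4\<close> by simp
  next
    case False
    then obtain m where m: "k = 2 * m + 1" by (elim oddE)
    have m1: "m \<ge> 1" using 0 m by simp
    have h: "0 < half_node k 0" "half_node k 0 < half_node k 1" "half_node k 1 \<le> pi / 2"
      using half_node_pos[of k 0] half_node_le[of 1 k] half_node_strict_mono[of k 0 1] m m1 by auto
    show ?thesis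
    proof (cases "even m")
      case True
      hence "m > 1" using m1 by (cases "m = 1") auto
      hence "half_node k 1 < pi / 2" using half_node_less[of 1 k] m by simp
      hence "tan (pi / 4 - half_node k 0 / 2) \<le> tan (pi / 4 + half_node k 1 / 2)"
        using h by (intro tan_mono_le2) auto
      thus ?thesis using sinsum_alt_odd[OF m, of 0] sinsum_alt_odd[OF m, of 1] m1 True by simp
    next
      case False
      have "tan (pi / 4 - half_node k 1 / 2) \<le> tan (pi / 4 + half_node k 0 / 2)"
        using h by (intro tan_mono_le2) auto
      thus ?thesis using sinsum_alt_odd[OF m, of 0] sinsum_alt_odd[OF m, of 1] m1 False by simp
    qed
  qed
next
  case (Suc j)
  have "sinsum (altsign k) k j \<le> sinsum (altsign k) k (j + 2)" using Suc.prems by (intro sinsum_alt_mono) simp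
  thus ?case using Suc by simp
qed

definition csum_ratio :: "(nat \<Rightarrow> real) \<Rightarrow> nat \<Rightarrow> nat \<Rightarrow> real" where
  "csum_ratio s k n = csum s k n / csum s k 1"
definition ctsum_ratio :: "(nat \<Rightarrow> real) \<Rightarrow> nat \<Rightarrow> nat \<Rightarrow> real" where
  "ctsum_ratio s k n = ctsum s k n / csum s k 1"
definition sinsum_ratio :: "(nat \<Rightarrow> real) \<Rightarrow> nat \<Rightarrow> nat \<Rightarrow> real" where
  "sinsum_ratio s k n = sinsum s k n / csum s k 1"

text \<open>
  With \<open>csum_ratio_small\<close> this reduces all quotients to the third differences \<open>sinsum_ratio\<close>.
\<close>

lemma csum_ratio_rec:
  assumes "csum s k 1 \<noteq> 0"
  shows "csum_ratio s k 0 = 0" "csum_ratio s k 1 = 1" "ctsum_ratio s k 0 = 1"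
    "csum_ratio s k (Suc (Suc n)) = 2 * csum_ratio s k (Suc n) - csum_ratio s k n + 2 * ctsum_ratio s k (Suc n)"
    "ctsum_ratio s k (Suc n) = ctsum_ratio s k n - 2 * sinsum_ratio s k n"
  using assms csum_1[of s k]
  by (simp_all add: csum_ratio_def ctsum_ratio_def sinsum_ratio_def csum_Suc_Suc ctsum_Suc diff_divide_distrib add_divide_distrib)

lemma csum_ratio_small:
  assumes "csum s k 1 \<noteq> 0"
  shows "csum_ratio s k 2 = 4 - 4 * sinsum_ratio s k 0"
    "csum_ratio s k 3 = 9 - 12 * sinsum_ratio s k 0 - 4 * sinsum_ratio s k 1"
    "csum_ratio s k 4 = 16 - 24 * sinsum_ratio s k 0 - 12 * sinsum_ratio s k 1 - 4 * sinsum_ratio s k 2"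
    "csum_ratio s k 5 = 25 - 40 * sinsum_ratio s k 0 - 24 * sinsum_ratio s k 1 - 12 * sinsum_ratio s k 2 - 4 * sinsum_ratio s k 3"
    "ctsum_ratio s k 1 = 1 - 2 * sinsum_ratio s k 0"
    "ctsum_ratio s k 3 = 1 - 2 * sinsum_ratio s k 0 - 2 * sinsum_ratio s k 1 - 2 * sinsum_ratio s k 2"
proof -
  note r = csum_ratio_rec[OF assms]
  have t: "ctsum_ratio s k 1 = 1 - 2 * sinsum_ratio s k 0" "ctsum_ratio s k 2 = ctsum_ratio s k 1 - 2 * sinsum_ratio s k 1"
    "ctsum_ratio s k 3 = ctsum_ratio s k 2 - 2 * sinsum_ratio s k 2" "ctsum_ratio s k 4 = ctsum_ratio s k 3 - 2 * sinsum_ratio s k 3"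
    using r(5)[of 0] r(5)[of 1] r(5)[of 2] r(5)[of 3] r(3) by (simp_all add: eval_nat_numeral)
  have R: "csum_ratio s k 2 = 2 * csum_ratio s k 1 - csum_ratio s k 0 + 2 * ctsum_ratio s k 1"
     "csum_ratio s k 3 = 2 * csum_ratio s k 2 - csum_ratio s k 1 + 2 * ctsum_ratio s k 2"
     "csum_ratio s k 4 = 2 * csum_ratio s k 3 - csum_ratio s k 2 + 2 * ctsum_ratio s k 3"
     "csum_ratio s k 5 = 2 * csum_ratio s k 4 - csum_ratio s k 3 + 2 * ctsum_ratio s k 4"
    using r(4)[of 0] r(4)[of 1] r(4)[of 2] r(4)[of 3] by (simp_all add: eval_nat_numeral)
  show "csum_ratio s k 2 = 4 - 4 * sinsum_ratio s k 0"
    "csum_ratio s k 3 = 9 - 12 * sinsum_ratio s k 0 - 4 * sinsum_ratio s k 1"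
    "csum_ratio s k 4 = 16 - 24 * sinsum_ratio s k 0 - 12 * sinsum_ratio s k 1 - 4 * sinsum_ratio s k 2"
    "csum_ratio s k 5 = 25 - 40 * sinsum_ratio s k 0 - 24 * sinsum_ratio s k 1 - 12 * sinsum_ratio s k 2 - 4 * sinsum_ratio s k 3"
    "ctsum_ratio s k 1 = 1 - 2 * sinsum_ratio s k 0"
    "ctsum_ratio s k 3 = 1 - 2 * sinsum_ratio s k 0 - 2 * sinsum_ratio s k 1 - 2 * sinsum_ratio s k 2"
    using R t r(1,2) by linarith+
qed

lemma csum_ratio_reflect: "n \<le> k \<Longrightarrow> csum_ratio s k (k - n) = csum_ratio s k n"
  by (simp add: csum_ratio_def csum_reflect)

abbreviation one_weight :: "nat \<Rightarrow> real" where "one_weight \<equiv> \<lambda>_. 1"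

lemma csum_plain_pos:
  assumes "k \<ge> 2"
  shows "csum one_weight k 1 > 0"
  unfolding csum_def
proof (rule sum_pos)
  show "{1..<k} \<noteq> {}" using assms by simp
  show "1 * (sin (real 1 * (real e * pi / real k)))\<^sup>2 / sin (real e * pi / real k) ^ 3 > 0" if "e \<in> {1..<k}" for e
    using sin_node_pos[OF that] by simp
qed simp

lemma csum_plain_nonneg: "csum one_weight k n \<ge> 0"
  unfolding csum_def
proof (rule sum_nonneg)
  show "1 * (sin (real n * (real e * pi / real k)))\<^sup>2 / sin (real e * pi / real k) ^ 3 \<ge> 0" if "e \<in> {1..<k}" for e
    using sin_node_pos[OF that] by simp
qed

lemma csum_ratio_plain_nonneg: "k \<ge> 2 \<Longrightarrow> csum_ratio one_weight k n \<ge> 0"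
  unfolding csum_ratio_def using csum_plain_pos[of k] csum_plain_nonneg[of k n] by simp

lemma sinsum_ratio_plain: "n < k \<Longrightarrow> sinsum_ratio one_weight k n = cot (half_node k n) / csum one_weight k 1"
  by (simp add: sinsum_ratio_def sinsum_plain)

lemma sinsum_ratio_plain_nonneg:
  assumes "k \<ge> 2" "2 * n + 1 \<le> k"
  shows "sinsum_ratio one_weight k n \<ge> 0"
proof -
  have "cot (half_node k n) \<ge> 0"
    using assms cot_antimono[of "half_node k n" "pi/2"] half_node_pos[of k n] half_node_le[of n k] by (simp add: cot_def)
  thus ?thesis using csum_plain_pos[of k] assms by (simp add: sinsum_ratio_plain)
qed

lemma sinsum_ratio_plain_antimono:
  assumes "k \<ge> 2" "n \<le> m" "2 * m + 1 \<le> k"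
  shows "sinsum_ratio one_weight k m \<le> sinsum_ratio one_weight k n"
proof -
  have "cot (half_node k m) \<le> cot (half_node k n)"
    using assms by (intro cot_antimono half_node_pos half_node_mono half_node_le) auto
  thus ?thesis using csum_plain_pos[of k] assms by (simp add: sinsum_ratio_plain divide_right_mono)
qed

text \<open>
  The increments of the quotient are antisymmetric under \<open>n \<mapsto> k - 1 - n\<close>, and their own increments
  \<open>ctsum\<close> decrease; hence the quotient increases up to \<open>k/2\<close>.
\<close>

lemma csum_ratio_plain_ge_1:
  assumes k: "k \<ge> 2" and n: "1 \<le> n" "2 * n \<le> k"
  shows "csum_ratio one_weight k n \<ge> 1"
proof -
  note r = csum_ratio_rec[of one_weight k]
  have nz: "csum one_weight k 1 \<noteq> 0" using csum_plain_pos[OF k] by simp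
  define g where "g j = csum_ratio one_weight k (Suc j) - csum_ratio one_weight k j" for j
  define M where "M = k div 2"
  define M' where "M' = k - 1 - M"
  have dec: "ctsum_ratio one_weight k (Suc j) \<le> ctsum_ratio one_weight k j" if "j < M" for j
    using r(5)[OF nz, of j] sinsum_ratio_plain_nonneg[OF k, of j] that by (simp add: M_def)
  have g: "g j \<ge> 0" if "j \<le> M'" for j
  proof (rule antisymmetric_slopes_nonneg[where M = M and M' = M' and H = "ctsum_ratio one_weight k"])
    show "g 0 \<ge> 0" using r(1,2)[OF nz] by (simp add: g_def)
    show "g (Suc j) = g j + 2 * ctsum_ratio one_weight k (Suc j)" for j
      unfolding g_def using r(4)[OF nz, of j] by simp
    show "ctsum_ratio one_weight k j < 0" if "i \<le> j" "j \<le> M" "ctsum_ratio one_weight k i < 0" for i j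
    proof -
      have "i + q \<le> M \<Longrightarrow> ctsum_ratio one_weight k (i + q) \<le> ctsum_ratio one_weight k i" for q
      proof (induction q)
        case (Suc q)
        thus ?case using dec[of "i + q"] by simp
      qed simp
      from this[of "j - i"] show ?thesis using that by simp
    qed
    have "Suc M = k - M'" "Suc M' = k - M" "M' \<le> k" "M \<le> k" using k by (auto simp: M_def M'_def)
    thus "g M + g M' = 0" unfolding g_def using csum_ratio_reflect[of M' k] csum_ratio_reflect[of M k] by simp
    show "M' \<le> M" using k by (auto simp: M_def M'_def)
  qed (use that in auto)
  have "Suc j \<le> M \<Longrightarrow> csum_ratio one_weight k (Suc j) \<ge> 1" for j
  proof (induction j)
    case 0
    thus ?case using r(2)[OF nz] by simp
  next
    case (Suc j)
    have "Suc j \<le> M'" using Suc.prems k by (auto simp: M_def M'_def)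
    thus ?case using Suc g[of "Suc j"] by (simp add: g_def)
  qed
  from this[of "n - 1"] n show ?thesis by (simp add: M_def)
qed

text \<open>
  How far the Galois conjugate quotient lies above the original one.
\<close>

definition csum_gap :: "nat \<Rightarrow> nat \<Rightarrow> real" where
  "csum_gap k n = csum_ratio (altsign k) k n - csum_ratio one_weight k n"

text \<open>
  The function \<open>g n = csum_gap k (n + 2) - csum_gap k n\<close> is antisymmetric under
  \<open>n \<mapsto> k - 2 - n\<close>, so \<open>antisymmetric_slopes_nonneg\<close> applies once its increments, once negative,
  remain negative.  These are sums of two neighboring terms, which evens out the dependence on
  parity in the closed forms for odd \<open>k\<close>: their increments decrease by \<open>sinsum_alt_mono\<close> and because
  the cotangent decreases.
\<close>

lemma csum_gap_mono:
  assumes k: "k \<ge> 4" and S: "csum (altsign k) k 1 > 0"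
    and init: "sinsum_ratio (altsign k) k 0 \<le> sinsum_ratio one_weight k 0"
    and n: "2 * (n + 2) \<le> k"
  shows "csum_gap k n \<le> csum_gap k (n + 2)"
proof -
  have k2: "k \<ge> 2" using k by simp
  have nz: "csum one_weight k 1 \<noteq> 0" "csum (altsign k) k 1 \<noteq> 0" using csum_plain_pos[OF k2] S by auto
  note r = csum_ratio_rec[OF nz(1)] and q = csum_ratio_rec[OF nz(2)]
  define d where "d j = ctsum_ratio (altsign k) k j - ctsum_ratio one_weight k j" for j
  define E where "E j = sinsum_ratio one_weight k j - sinsum_ratio (altsign k) k j" for j
  have dS: "d (Suc j) = d j + 2 * E j" for j unfolding d_def E_def using r(5) q(5) by simp
  define g where "g j = csum_gap k (j + 2) - csum_gap k j" for j
  define H where "H j = d j + d (Suc j)" for j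
  \<comment> \<open>Up to the index \<open>M\<close> the closed forms of the third differences hold; \<open>M'\<close> is its mirror image.\<close>
  define M where "M = (k - 1) div 2"
  define M' where "M' = k - 2 - M"
  have gap2: "csum_gap k (Suc (Suc j)) = 2 * csum_gap k (Suc j) - csum_gap k j + 2 * d (Suc j)" for j
    unfolding csum_gap_def d_def using r(4) q(4) by simp
  have E: "E (j + 2) \<le> E j" if "j + 2 \<le> M" for j
  proof -
    have j: "2 * (j + 2) + 1 \<le> k" using that k by (auto simp: M_def)
    have "sinsum_ratio (altsign k) k j \<le> sinsum_ratio (altsign k) k (j + 2)"
      unfolding sinsum_ratio_def using sinsum_alt_mono[OF j] S by (simp add: divide_right_mono)
    moreover have "sinsum_ratio one_weight k (j + 2) \<le> sinsum_ratio one_weight k j"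
      using j k2 by (intro sinsum_ratio_plain_antimono) auto
    ultimately show ?thesis by (simp add: E_def)
  qed
  have d0: "d 0 = 0" unfolding d_def using r(3) q(3) by simp
  have d1: "d 1 \<ge> 0" using dS[of 0] d0 init by (simp add: E_def)
  have H0: "H 0 \<ge> 0" using d0 d1 by (simp add: H_def)
  have "g n \<ge> 0"
  proof (rule antisymmetric_slopes_nonneg[where M = M and M' = M' and H = H])
    show "g 0 \<ge> 0" using gap2[of 0] r(1,2) q(1,2) d1 by (simp add: g_def csum_gap_def eval_nat_numeral)
    show "g (Suc j) = g j + 2 * H (Suc j)" for j
      using gap2[of j] gap2[of "Suc j"] by (simp add: g_def H_def)
    show "H j < 0" if "i \<le> j" "j \<le> M" "H i < 0" for i j
    proof (rule concave_stays_negative[where H = H and K = "\<lambda>n. 2 * (E n + E (Suc n))" and M = M])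
      show "H 0 \<ge> 0" by (rule H0)
      show "H (Suc n) = H n + 2 * (E n + E (Suc n))" for n using dS[of n] dS[of "Suc n"] by (simp add: H_def)
      show "2 * (E (Suc n) + E (Suc (Suc n))) \<le> 2 * (E n + E (Suc n))" if "Suc n < M" for n
        using E[of n] that by simp
    qed (use that in auto)
    have *: "M + 2 = k - M'" "M' + 2 = k - M" "M' \<le> k" "M \<le> k" using k by (auto simp: M_def M'_def)
    show "g M + g M' = 0" unfolding g_def csum_gap_def *(1,2)
      using csum_ratio_reflect[OF *(3)] csum_ratio_reflect[OF *(4)] by simp
    show "M' \<le> M" using k by (auto simp: M_def M'_def)
    show "n \<le> M'" using n k by (auto simp: M_def M'_def)
  qed
  thus ?thesis by (simp add: g_def)
qed

text \<open>
  Two consecutive third differences have a nonnegative sum, so that the sequence decreases along steps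
  of length two.
\<close>

lemma ctsum_ratio_alt_le:
  assumes S: "csum (altsign k) k 1 > 0"
  shows "2 * n \<le> k + 1 \<Longrightarrow> ctsum_ratio (altsign k) k n \<le> max 1 (ctsum_ratio (altsign k) k 1)"
proof (induction n rule: less_induct)
  case (less n)
  have nz: "csum (altsign k) k 1 \<noteq> 0" using S by simp
  note q = csum_ratio_rec[OF nz]
  show ?case
  proof (cases "n < 2")
    case True
    hence "n = 0 \<or> n = 1" by auto
    thus ?thesis using q(3) by auto
  next
    case False
    define j where "j = n - 2"
    have 3: "n = Suc (Suc j)" using False by (simp add: j_def)
    have "sinsum_ratio (altsign k) k j + sinsum_ratio (altsign k) k (j + 1) \<ge> 0"
      unfolding sinsum_ratio_def add_divide_distrib[symmetric] using sinsum_alt_pair_nonneg[of j k] S less.prems 3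
      by simp
    hence "ctsum_ratio (altsign k) k n \<le> ctsum_ratio (altsign k) k j"
      using q(5)[of j] q(5)[of "Suc j"] 3 by simp
    also have "\<dots> \<le> max 1 (ctsum_ratio (altsign k) k 1)" using less.IH[of j] less.prems 3 by simp
    finally show ?thesis .
  qed
qed

lemma two_le_add_of_mult:
  fixes x y z :: real
  assumes "x \<ge> 0" "y \<ge> 0" "z\<^sup>2 \<le> x * y"
  shows "2 * \<bar>z\<bar> \<le> x + y"
proof -
  have "(2 * \<bar>z\<bar>)\<^sup>2 \<le> (x + y)\<^sup>2"
    using assms(3) zero_le_power2[of "x - y"]
    by (simp add: power_mult_distrib power2_sum power2_diff)
  thus ?thesis by (rule power2_le_imp_le) (use assms in simp)
qed

text \<open>
  Expand the product and bound the mixed terms below by the inequality of the means.  The result is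
  \<open>(2 \<bar>l\<^sup>2 - 1\<bar> + \<bar>b - 1\<bar>)\<^sup>2 \<le> 9 (b - 1)\<^sup>2\<close>.
\<close>

lemma mode_form_zero_upper:
  fixes l a b c :: real
  assumes "(b - 1)\<^sup>2 \<le> a * c" "a \<ge> 0" "c \<ge> 0" and eq: "mode_form l 1 a b c = 0"
  shows "\<bar>l\<^sup>2 - 1\<bar> \<le> \<bar>b - 1\<bar>"
proof -
  have "((l\<^sup>2 - 1) * (b - 1))\<^sup>2 = (l\<^sup>2 - 1)\<^sup>2 * (b - 1)\<^sup>2" by (simp add: power_mult_distrib)
  also have "\<dots> \<le> (l\<^sup>2 - 1)\<^sup>2 * (a * c)" using assms(1) by (intro mult_left_mono) auto
  also have "\<dots> = ((l + 1)\<^sup>2 * a) * ((l - 1)\<^sup>2 * c)" by algebra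
  finally have "2 * \<bar>(l\<^sup>2 - 1) * (b - 1)\<bar> \<le> (l + 1)\<^sup>2 * a + (l - 1)\<^sup>2 * c"
    using assms by (intro two_le_add_of_mult) auto
  hence cross: "2 * (\<bar>l\<^sup>2 - 1\<bar> * \<bar>b - 1\<bar>) \<le> (l + 1)\<^sup>2 * a + (l - 1)\<^sup>2 * c" by (simp add: abs_mult)
  have "(2 * (l + 1)\<^sup>2 + c) * (2 * (l - 1)\<^sup>2 + a) = 4 * (l\<^sup>2 - 1)\<^sup>2 + 2 * ((l + 1)\<^sup>2 * a + (l - 1)\<^sup>2 * c) + a * c"
    by algebra
  hence "9 * (b - 1)\<^sup>2 = 4 * (l\<^sup>2 - 1)\<^sup>2 + 2 * ((l + 1)\<^sup>2 * a + (l - 1)\<^sup>2 * c) + a * c"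
    using eq by (simp add: mode_form_def)
  hence "4 * \<bar>l\<^sup>2 - 1\<bar>\<^sup>2 + 4 * (\<bar>l\<^sup>2 - 1\<bar> * \<bar>b - 1\<bar>) + \<bar>b - 1\<bar>\<^sup>2 \<le> 9 * \<bar>b - 1\<bar>\<^sup>2"
    using cross assms(1) by (simp add: power2_abs)
  hence "(2 * \<bar>l\<^sup>2 - 1\<bar> + \<bar>b - 1\<bar>)\<^sup>2 \<le> (3 * \<bar>b - 1\<bar>)\<^sup>2"
    by (simp add: power2_eq_square algebra_simps)
  hence "2 * \<bar>l\<^sup>2 - 1\<bar> + \<bar>b - 1\<bar> \<le> 3 * \<bar>b - 1\<bar>" by (rule power2_le_imp_le) simp
  thus ?thesis by simp
qed

text \<open>
  The two factors have the product \<open>9 (b - 1)\<^sup>2\<close>, hence a sum of at least \<open>6 (b - 1)\<close>.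
\<close>

lemma mode_form_zero_lower:
  fixes l a b c t :: real
  assumes eq: "mode_form l 1 a b c = 0" and "a \<ge> 0" "b > 1" and t: "a + c = 2 * b + 2 * t"
  shows "b \<le> l\<^sup>2 + 5 / 2 + t / 2"
proof -
  define X Y where "X = 2 * (l + 1)\<^sup>2 + c" and "Y = 2 * (l - 1)\<^sup>2 + a"
  have XY: "X * Y = 9 * (b - 1)\<^sup>2" using eq by (simp add: mode_form_def X_def Y_def)
  have "Y \<ge> 0" using assms by (simp add: Y_def)
  moreover have "X * Y > 0" using XY assms by simp
  ultimately have "X \<ge> 0" by (simp add: zero_less_mult_iff)
  have "2 * \<bar>3 * (b - 1)\<bar> \<le> X + Y"
    using \<open>X \<ge> 0\<close> \<open>Y \<ge> 0\<close> by (rule two_le_add_of_mult) (simp only: XY power_mult_distrib, simp)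
  also have "X + Y = 4 * (l\<^sup>2 + 1) + 2 * b + 2 * t"
    using t by (simp add: X_def Y_def power2_eq_square algebra_simps)
  finally show ?thesis using assms by simp
qed

text \<open>
  Because \<open>sin\<^sup>2 ((n+1)x) - sin\<^sup>2 x = sin (n x) sin ((n+2)x)\<close>.
\<close>

lemma csum_cauchy:
  "(csum one_weight k (Suc n) - csum one_weight k 1)\<^sup>2 \<le> csum one_weight k n * csum one_weight k (Suc (Suc n))"
proof -
  define w where "w e = sqrt (sin (real e * pi / real k) ^ 3)" for e
  define p where "p n e = sin (real n * (real e * pi / real k)) / w e" for n e
  have w: "w e > 0" "(w e)\<^sup>2 = sin (real e * pi / real k) ^ 3" if "e \<in> {1..<k}" for e
    using sin_node_pos[OF that] by (auto simp: w_def)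
  have sq: "csum one_weight k n = (\<Sum>e=1..<k. (p n e)\<^sup>2)" for n
    unfolding csum_def by (rule sum.cong) (auto simp: p_def power_divide w)
  have "csum one_weight k (Suc n) - csum one_weight k 1 = (\<Sum>e=1..<k. p n e * p (Suc (Suc n)) e)"
    unfolding csum_def sum_subtractf[symmetric]
  proof (rule sum.cong[OF refl])
    fix e assume e: "e \<in> {1..<k}"
    define x y where "x = real e * pi / real k" and "y = real (Suc n) * x"
    have a: "real (Suc (Suc n)) * x = y + x" "real n * x = y - x" by (auto simp: y_def algebra_simps)
    have "sin (real n * x) * sin (real (Suc (Suc n)) * x) = (sin y)\<^sup>2 - (sin x)\<^sup>2"
      unfolding a sin_add sin_diff using sin_cos_squared_add[of x] sin_cos_squared_add[of y] by algebra
    hence "p n e * p (Suc (Suc n)) e = ((sin y)\<^sup>2 - (sin x)\<^sup>2) / sin x ^ 3"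
      using w[OF e] by (simp add: p_def x_def power2_eq_square)
    thus "1 * (sin (real (Suc n) * (real e * pi / real k)))\<^sup>2 / sin (real e * pi / real k) ^ 3 -
         1 * (sin (real 1 * (real e * pi / real k)))\<^sup>2 / sin (real e * pi / real k) ^ 3 = p n e * p (Suc (Suc n)) e"
      by (simp add: y_def x_def diff_divide_distrib)
  qed
  thus ?thesis unfolding sq using Cauchy_Schwarz_ineq_sum[of "p n" "p (Suc (Suc n))" "{1..<k}"] by simp
qed

lemma csum_ratio_cauchy:
  assumes "k \<ge> 2"
  shows "(csum_ratio one_weight k (Suc n) - 1)\<^sup>2 \<le> csum_ratio one_weight k n * csum_ratio one_weight k (Suc (Suc n))"
proof -
  have p: "csum one_weight k 1 > 0" by (rule csum_plain_pos[OF assms])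
  have "(csum one_weight k (Suc n) - csum one_weight k 1)\<^sup>2 / (csum one_weight k 1)\<^sup>2
      \<le> csum one_weight k n * csum one_weight k (Suc (Suc n)) / (csum one_weight k 1)\<^sup>2"
    using csum_cauchy[of k n] by (rule divide_right_mono) simp
  moreover have "csum_ratio one_weight k (Suc n) - 1 = (csum one_weight k (Suc n) - csum one_weight k 1) / csum one_weight k 1"
    using p by (simp add: csum_ratio_def field_simps)
  ultimately show ?thesis by (simp add: csum_ratio_def power_divide power2_eq_square)
qed

lemma mode_form_csum_ratio:
  assumes "csum s k 1 \<noteq> 0"
  shows "mode_form l (csum s k 1) (csum s k a) (csum s k b) (csum s k c) = 0
    \<longleftrightarrow> mode_form l 1 (csum_ratio s k a) (csum_ratio s k b) (csum_ratio s k c) = 0"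
proof -
  have *: "csum s k n = csum s k 1 * csum_ratio s k n" for n using assms by (simp add: csum_ratio_def)
  have "mode_form l (csum s k 1) (csum s k a) (csum s k b) (csum s k c)
     = mode_form l (csum s k 1 * 1) (csum s k 1 * csum_ratio s k a) (csum s k 1 * csum_ratio s k b) (csum s k 1 * csum_ratio s k c)"
    by (simp only: *[of a] *[of b] *[of c] mult_1_right)
  also have "\<dots> = (csum s k 1)\<^sup>2 * mode_form l 1 (csum_ratio s k a) (csum_ratio s k b) (csum_ratio s k c)"
    by (rule mode_form_scale)
  finally show ?thesis using assms by simp
qed

section \<open>Elementary estimates\<close>

lemma cos_ge_quadratic: "1 - x\<^sup>2 / 2 \<le> cos (x::real)"
proof -
  have "\<bar>sin (x / 2)\<bar> \<le> \<bar>x / 2\<bar>" by (rule abs_sin_x_le_abs_x)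
  hence "(sin (x / 2))\<^sup>2 \<le> (x / 2)\<^sup>2" by (simp only: abs_le_square_iff)
  moreover have "cos x = 1 - 2 * (sin (x / 2))\<^sup>2" using cos_double_sin[of "x / 2"] by simp
  ultimately show ?thesis by (simp add: power_divide)
qed

lemma sin_ge_cubic:
  assumes "(0::real) \<le> x"
  shows "x - x ^ 3 / 6 \<le> sin x"
proof -
  define f where "f t = sin t - t + t ^ 3 / 6" for t :: real
  have "f 0 \<le> f x"
  proof (rule DERIV_nonneg_imp_nondecreasing[OF assms])
    fix t :: real assume "0 \<le> t" "t \<le> x"
    have "(f has_real_derivative (cos t - 1 + t\<^sup>2 / 2)) (at t)"
      unfolding f_def by (auto intro!: derivative_eq_intros simp: power2_eq_square)
    moreover have "cos t - 1 + t\<^sup>2 / 2 \<ge> 0" using cos_ge_quadratic[of t] by simp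
    ultimately show "\<exists>y. (f has_real_derivative y) (at t) \<and> 0 \<le> y" by blast
  qed
  thus ?thesis by (simp add: f_def)
qed

lemma csc_bounds:
  assumes "(0::real) < x" "x \<le> pi / 2"
  shows "1 / x \<le> 1 / sin x" "1 / sin x \<le> 1 / x + x / 3" "1 \<le> 1 / sin x"
proof -
  have s: "sin x > 0" using assms by (intro sin_gt_zero) auto
  have "sin x \<le> x" using assms by (intro sin_x_le_x) auto
  thus "1 / x \<le> 1 / sin x" using s by (intro divide_left_mono) auto
  show "1 \<le> 1 / sin x" using s by (simp add: field_simps)
  have x2: "x\<^sup>2 \<le> 3"
  proof -
    have "x \<le> 1.6" using assms pi_approx by simp
    hence "x\<^sup>2 \<le> 1.6\<^sup>2" using assms by (intro power_mono) auto
    thus ?thesis by (simp add: power2_eq_square)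
  qed
  have "x \<le> (x - x ^ 3 / 6) * (1 + x\<^sup>2 / 3)"
  proof -
    have "(x - x ^ 3 / 6) * (1 + x\<^sup>2 / 3) - x = x ^ 3 / 18 * (3 - x\<^sup>2)"
      by (simp add: field_simps power2_eq_square power3_eq_cube)
    also have "\<dots> \<ge> 0" using x2 assms by (intro mult_nonneg_nonneg) auto
    finally show ?thesis by simp
  qed
  also have "\<dots> \<le> sin x * (1 + x\<^sup>2 / 3)" using sin_ge_cubic[of x] assms by (intro mult_right_mono) auto
  finally have "x \<le> sin x * (1 + x\<^sup>2 / 3)" .
  thus "1 / sin x \<le> 1 / x + x / 3" using s assms by (simp add: field_simps power2_eq_square)
qed

text \<open>
  A rational upper bound of the tangent, monotone in the bound \<open>X\<close> of its argument.
\<close>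

lemma tan_le_of_le:
  assumes "(0::real) \<le> x" "x \<le> X" "X\<^sup>2 < 2" "x < pi / 2"
  shows "tan x \<le> X / (1 - X\<^sup>2 / 2)"
proof -
  have c: "1 - x\<^sup>2 / 2 \<le> cos x" by (rule cos_ge_quadratic)
  have x2: "x\<^sup>2 \<le> X\<^sup>2" using assms by (intro power_mono) auto
  have "sin x \<le> X" using sin_x_le_x[of x] assms by simp
  moreover have "0 \<le> X" using assms by simp
  moreover have "1 - X\<^sup>2 / 2 \<le> cos x" using c x2 by linarith
  ultimately show ?thesis unfolding tan_def using assms by (intro frac_le) auto
qed

lemma cot_ge:
  assumes "(0::real) < x" "x \<le> pi / 2"
  shows "1 / x - x / 2 \<le> cot x"
proof -
  have s: "sin x > 0" using assms by (intro sin_gt_zero) auto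
  have "cos x \<ge> 0" using assms by (intro cos_ge_zero) auto
  have "cos x / x \<le> cos x / sin x"
    using s assms sin_x_le_x[of x] \<open>cos x \<ge> 0\<close> by (intro divide_left_mono) auto
  moreover have "(1 - x\<^sup>2 / 2) / x \<le> cos x / x"
    using cos_ge_quadratic[of x] assms by (intro divide_right_mono) auto
  moreover have "(1 - x\<^sup>2 / 2) / x = 1 / x - x / 2" using assms by (simp add: field_simps power2_eq_square)
  ultimately show ?thesis by (simp add: cot_def)
qed

text \<open>
  With \<open>u = tan (a/2)\<close>, which \<open>t\<close> bounds from above, the two tangents are \<open>(1 + u)/(1 - u)\<close> and
  \<open>(1 - u)/(1 + u)\<close>.
\<close>

lemma tan_quarter_bounds:
  assumes "0 \<le> a" "a \<le> X" "(X / 2)\<^sup>2 < 2" "a < pi / 2" and t: "t = (X / 2) / (1 - (X / 2)\<^sup>2 / 2)" "t < 1"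
  shows "tan (pi / 4 + a / 2) \<le> (1 + t) / (1 - t)" "(1 - t) / (1 + t) \<le> tan (pi / 4 - a / 2)"
    "tan (pi / 4 - a / 2) \<le> 1" "1 \<le> tan (pi / 4 + a / 2)"
proof -
  define u where "u = tan (a / 2)"
  have u0: "0 \<le> u"
  proof (cases "a = 0")
    case False
    thus ?thesis unfolding u_def using assms by (intro less_imp_le tan_gt_zero) auto
  qed (simp add: u_def)
  have ut: "u \<le> t" unfolding u_def t(1) by (rule tan_le_of_le) (use assms in auto)
  have c: "cos (a / 2) > 0" using assms by (intro cos_gt_zero_pi) auto
  have cq: "cos (pi / 4) \<noteq> 0" by (simp add: cos_45)
  have cp: "cos (pi / 4 + a / 2) > 0" "cos (pi / 4 - a / 2) > 0"
    using assms by (auto intro!: cos_gt_zero_pi)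
  have f: "tan (pi / 4 + a / 2) = (1 + u) / (1 - u)"
    using tan_add[OF cq, of "a / 2"] c cp unfolding u_def by (simp only: tan_45) simp
  have g: "tan (pi / 4 - a / 2) = (1 - u) / (1 + u)"
    using tan_diff[OF cq, of "a / 2"] c cp unfolding u_def by (simp only: tan_45) simp
  show "tan (pi / 4 + a / 2) \<le> (1 + t) / (1 - t)" unfolding f using u0 ut t by (intro frac_le) auto
  show "(1 - t) / (1 + t) \<le> tan (pi / 4 - a / 2)" unfolding g using u0 ut t by (intro frac_le) auto
  show "tan (pi / 4 - a / 2) \<le> 1" unfolding g using u0 by simp
  show "1 \<le> tan (pi / 4 + a / 2)" unfolding f using u0 ut t by simp
qed

lemma ln_2_le: "ln 2 \<le> (7 / 10 :: real)"
proof -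
  \<comment> \<open>\<open>1.19\<^sup>4 > 2\<close>\<close>
  have "(119/100 :: real) \<le> 1 + 7/40 + (7/40)\<^sup>2 / 2" by (simp add: power2_eq_square)
  also have "\<dots> \<le> exp (7/40)" by (rule exp_lower_Taylor_quadratic) simp
  finally have "(119/100 :: real) ^ 4 \<le> exp (7/40) ^ 4" by (intro power_mono) auto
  also have "\<dots> = exp (7/10)" using exp_of_nat_mult[of 4 "7/40 :: real"] by simp
  finally have "2 \<le> exp (7/10 :: real)" by (simp add: power4_eq_xxxx)
  hence "ln 2 \<le> ln (exp (7/10 :: real))" by (subst ln_le_cancel_iff) auto
  thus ?thesis by simp
qed

text \<open>
  Compare \<open>1/x\<close> with the increment of the logarithm; the constant is an upper bound of \<open>ln 2\<close>.
\<close>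

lemma harm_double:
  assumes "a > 0"
  shows "harm (2 * a) \<le> harm a + (7 / 10 :: real)"
proof -
  have "harm (a + j) \<le> harm a + (ln (real (a + j)) - ln (real a))" for j
  proof (induction j)
    case (Suc j)
    define x where "x = real (a + Suc j)"
    have x: "x > 1" using assms by (simp add: x_def)
    have "ln (1 - 1 / x) \<le> - (1 / x)" using x ln_le_minus_one[of "1 - 1 / x"] by simp
    moreover have "1 - 1 / x = (x - 1) / x" using x by (simp add: field_simps)
    ultimately have "inverse x \<le> ln x - ln (x - 1)" using x by (simp add: ln_divide_pos inverse_eq_divide)
    moreover have "x - 1 = real (a + j)" by (simp add: x_def)
    ultimately have l: "inverse x \<le> ln x - ln (real (a + j))" by (simp only:)
    have e: "harm (a + Suc j) = harm (a + j) + inverse x"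
      unfolding add_Suc_right harm_Suc x_def by simp
    show ?case unfolding e x_def[symmetric] using Suc.IH l by linarith
  qed simp
  from this[of a] have "harm (2 * a) \<le> harm a + (ln (real (2 * a)) - ln (real a))"
    unfolding mult_2 .
  also have "ln (real (2 * a)) - ln (real a) = ln 2" using assms by (simp add: ln_mult_pos)
  finally show ?thesis using ln_2_le by simp
qed

section \<open>The sums of cosecants\<close>

lemma csum_1_csc: "csum s k 1 = (\<Sum>e=1..<k. s e * (1 / sin (e * pi / k)))"
  unfolding csum_1 ctsum_def by simp

lemma sum_symmetric_even:
  fixes F :: "nat \<Rightarrow> 'a::comm_semiring_1"
  assumes k: "k = 2 * M" "M > 0" and sym: "\<And>e. e \<in> {1..<k} \<Longrightarrow> F (k - e) = F e"
  shows "(\<Sum>e=1..<k. F e) = 2 * (\<Sum>f=1..<M. F f) + F M"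
proof -
  have "{1..<k} = insert M ({1..<M} \<union> (\<lambda>f. k - f) ` {1..<M})"
  proof (intro equalityI subsetI)
    fix x assume x: "x \<in> {1..<k}"
    have "x = k - (k - x)" using x by auto
    hence "x \<in> (\<lambda>f. k - f) ` {1..<M}" if "k - x \<in> {1..<M}" using that by blast
    thus "x \<in> insert M ({1..<M} \<union> (\<lambda>f. k - f) ` {1..<M})" using x k by fastforce
  qed (use k in auto)
  moreover have "{1..<M} \<inter> (\<lambda>f. k - f) ` {1..<M} = {}" using k by auto
  moreover have "M \<notin> {1..<M} \<union> (\<lambda>f. k - f) ` {1..<M}" using k by auto
  moreover have "inj_on (\<lambda>f. k - f) {1..<M}" using k by (auto simp: inj_on_def)
  ultimately have "(\<Sum>e=1..<k. F e) = F M + ((\<Sum>f=1..<M. F f) + (\<Sum>f=1..<M. F (k - f)))"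
    by (simp add: sum.union_disjoint sum.reindex)
  also have "(\<Sum>f=1..<M. F (k - f)) = (\<Sum>f=1..<M. F f)"
    using k by (intro sum.cong refl sym) auto
  finally show ?thesis by (simp add: mult_2 add_ac)
qed

definition csc_node :: "nat \<Rightarrow> nat \<Rightarrow> real" where
  "csc_node k e = 1 / sin (e * pi / k)"

lemma csc_node_reflect: "e \<in> {1..<k} \<Longrightarrow> csc_node k (k - e) = csc_node k e"
  by (simp only: csc_node_def sin_complement(1))

lemma csc_node_bounds:
  fixes e k :: nat
  assumes "e > 0" "2 * e \<le> k"
  shows "k / (e * pi) \<le> csc_node k e" "csc_node k e \<le> k / (e * pi) + e * pi / (3 * real k)" "1 \<le> csc_node k e"
proof -
  have "real (2 * e) * pi \<le> real k * pi" using assms by (intro mult_right_mono) auto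
  hence "0 < e * pi / k" "e * pi / k \<le> pi / 2" using assms by (auto simp: field_simps)
  from csc_bounds[OF this] show "k / (e * pi) \<le> csc_node k e" "csc_node k e \<le> k / (e * pi) + e * pi / (3 * real k)" "1 \<le> csc_node k e"
    unfolding csc_node_def by (simp_all add: mult.commute)
qed

lemma sum_csc_le:
  assumes "2 * m \<le> k"
  shows "(\<Sum>e=1..m. csc_node k e) \<le> k / pi * harm m + pi / (6 * real k) * (real m * (real m + 1))"
  using assms
proof (induction m)
  case (Suc m)
  have "csc_node k (Suc m) \<le> k / (Suc m * pi) + Suc m * pi / (3 * real k)"
    using Suc.prems by (intro csc_node_bounds) auto
  also have "k > 0" using Suc.prems by simp
  hence "k / (Suc m * pi) + Suc m * pi / (3 * real k) = k / pi * inverse (real (Suc m)) + pi / (6 * real k) * (2 * real (Suc m))"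
    by (simp add: field_simps del: of_nat_Suc)
  finally have "(\<Sum>e=1..Suc m. csc_node k e) \<le> (k / pi * harm m + pi / (6 * real k) * (real m * (real m + 1))) + (k / pi * inverse (real (Suc m)) + pi / (6 * real k) * (2 * real (Suc m)))"
    using Suc by simp
  also have "\<dots> = k / pi * harm (Suc m) + pi / (6 * real k) * (real (Suc m) * (real (Suc m) + 1))"
    unfolding harm_Suc of_nat_Suc by (simp add: distrib_left distrib_right)
  finally show ?case .
qed (simp add: harm_def)

text \<open>
  Summation of \<open>csc x \<le> 1/x + x/3\<close> over the nodes up to \<open>\<pi>/2\<close>.  The term \<open>x/3\<close> contributes about
  \<open>\<pi>\<^sup>2/24\<close> to the bracket, and \<open>11/20\<close> also covers the middle node of even \<open>k\<close>.
\<close>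

lemma csum_plain_upper:
  assumes k: "k \<ge> 6"
  shows "csum one_weight k 1 \<le> 2 * k / pi * (harm ((k - 1) div 2) + 11 / 20)"
proof -
  define m where "m = (k - 1) div 2"
  have pi2: "pi\<^sup>2 \<le> 9.87"
  proof -
    have "pi\<^sup>2 \<le> 3.14160\<^sup>2" using pi_approx by (intro power_mono) auto
    thus ?thesis by (simp add: power2_eq_square)
  qed
  have S: "(\<Sum>e=1..m. csc_node k e) \<le> k / pi * harm m + pi / (6 * real k) * (real m * (real m + 1))"
    by (rule sum_csc_le) (use k in \<open>auto simp: m_def\<close>)
  have R: "csum one_weight k 1 = (\<Sum>e=1..<k. csc_node k e)" unfolding csum_1_csc csc_node_def by simp
  have "csum one_weight k 1 \<le> 2 * (k / pi * harm m + pi / (6 * real k) * (real m * (real m + 1))) + (if even k then 1 else 0)"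
  proof (cases "even k")
    case True
    then obtain M where M: "k = 2 * M" by (elim evenE)
    have "csum one_weight k 1 = 2 * (\<Sum>f=1..<M. csc_node k f) + csc_node k M" unfolding R
      by (rule sum_symmetric_even[OF M]) (use k M in \<open>auto simp: csc_node_reflect\<close>)
    also have "csc_node k M = 1" using M k by (simp add: csc_node_def)
    also have "{1..<M} = {1..m}" using M k by (auto simp: m_def)
    finally show ?thesis using S True by simp
  next
    case False
    then obtain m' where "k = 2 * m' + 1" by (elim oddE)
    hence M: "k = 2 * m + 1" by (simp add: m_def)
    have "csum one_weight k 1 = 2 * (\<Sum>f=1..m. csc_node k f)" unfolding R
      by (rule sum_symmetric_odd(1)[OF M]) (auto simp: csc_node_reflect)
    thus ?thesis using S False by simp
  qed
  also have "2 * (pi / (6 * real k) * (real m * (real m + 1))) + (if even k then 1 else 0) \<le> 2 * k / pi * (11 / 20)"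
  proof (cases "even k")
    case True
    then obtain M where M: "k = 2 * M" by (elim evenE)
    have "m = M - 1" unfolding m_def M using k M by presburger
    hence mm: "real m = k / 2 - 1" using M k by (simp add: of_nat_diff)
    have X: "real m * (real m + 1) = k\<^sup>2 / 4 - k / 2" unfolding mm by (simp add: power2_eq_square algebra_simps)
    have "2 * (pi / (6 * real k) * (real m * (real m + 1))) + 1 = pi * k / 12 - pi / 6 + 1"
      unfolding X using k by (simp add: field_simps power2_eq_square)
    also have "\<dots> \<le> 2 * k / pi * (11 / 20)"
    proof -
      have "pi\<^sup>2 * k / 12 + (pi - pi\<^sup>2 / 6) \<le> 9.87 * k / 12 + (3.1416 - 9.8 / 6)"
      proof -
        have "9.8 \<le> pi\<^sup>2"
        proof -
          have "3.14\<^sup>2 \<le> pi\<^sup>2" using pi_approx by (intro power_mono) auto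
          thus ?thesis by (simp add: power2_eq_square)
        qed
        thus ?thesis using pi2 pi_approx by (intro add_mono divide_right_mono mult_right_mono) auto
      qed
      also have "\<dots> \<le> 11 / 10 * k" using k by simp
      finally have "pi * (pi * k / 12 - pi / 6 + 1) \<le> 11 / 10 * k" by (simp add: algebra_simps power2_eq_square)
      thus ?thesis by (simp add: field_simps)
    qed
    finally show ?thesis using True by simp
  next
    case False
    then obtain m' where "k = 2 * m' + 1" by (elim oddE)
    hence M: "k = 2 * m + 1" by (simp add: m_def)
    hence mm: "real m = (real k - 1) / 2" by simp
    have "real m * (real m + 1) = ((real k)\<^sup>2 - 1) / 4" unfolding mm by (simp add: power2_eq_square field_simps)
    also have "\<dots> \<le> (real k)\<^sup>2 / 4" by simp
    finally have "real m * (real m + 1) \<le> (real k)\<^sup>2 / 4" by (simp add: algebra_simps)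
    hence "pi / (6 * real k) * (real m * (real m + 1)) \<le> pi / (6 * real k) * ((real k)\<^sup>2 / 4)" by (intro mult_left_mono) auto
    also have "\<dots> = pi * k / 24" using k by (simp add: power2_eq_square)
    finally have "2 * (pi / (6 * real k) * (real m * (real m + 1))) \<le> pi * k / 12" by simp
    also have "\<dots> \<le> 2 * k / pi * (11 / 20)"
    proof -
      have "pi\<^sup>2 * k \<le> 9.87 * k" using pi2 by (intro mult_right_mono) auto
      also have "\<dots> \<le> 12 * (11 / 10 * k)" by simp
      finally show ?thesis by (simp add: field_simps power2_eq_square)
    qed
    finally show ?thesis using False by simp
  qed
  hence "2 * (k / pi * harm m + pi / (6 * real k) * (real m * (real m + 1))) + (if even k then 1 else 0) \<le> 2 * k / pi * (harm m + 11 / 20)"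
    by (simp add: algebra_simps)
  finally show ?thesis by (simp add: m_def)
qed

text \<open>
  The Leibniz bounds; the upper one is needed to carry the lower one through the induction.
\<close>

lemma alternating_decreasing_nonneg:
  fixes d :: "nat \<Rightarrow> real"
  assumes nn: "\<And>i. i < n \<Longrightarrow> 0 \<le> d i" and dec: "\<And>i. Suc i < n \<Longrightarrow> d (Suc i) \<le> d i"
  shows "0 \<le> (\<Sum>i<n. (-1) ^ i * d i) \<and> (n > 0 \<longrightarrow> (\<Sum>i<n. (-1) ^ i * d i) \<le> d 0)"
  using nn dec
proof (induction n arbitrary: d)
  case (Suc n)
  have "(\<Sum>i<Suc n. (-1) ^ i * d i) = d 0 - (\<Sum>i<n. (-1) ^ i * d (Suc i))"
    by (subst sum.lessThan_Suc_shift) (simp add: sum_negf)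
  moreover have "0 \<le> (\<Sum>i<n. (-1) ^ i * d (Suc i)) \<and> (n > 0 \<longrightarrow> (\<Sum>i<n. (-1) ^ i * d (Suc i)) \<le> d (Suc 0))"
    by (rule Suc.IH) (use Suc.prems in auto)
  ultimately show ?case using Suc.prems(1)[of 0] Suc.prems(2)[of 0] by (cases n) auto
qed simp

text \<open>
  An alternating sum with end weight one half.  For convex \<open>z\<close> it depends little on its length \<open>M\<close>,
  in contrast to the plain alternating sum.
\<close>

definition alt_trapezoid :: "(nat \<Rightarrow> real) \<Rightarrow> nat \<Rightarrow> real" where
  "alt_trapezoid z M = 2 * (\<Sum>e=1..<M. (-1) ^ (e + 1) * z e) + (-1) ^ (M + 1) * z M"

lemma alt_trapezoid_Suc: "M \<ge> 1 \<Longrightarrow> alt_trapezoid z (Suc M) = alt_trapezoid z M + (-1) ^ (M + 1) * (z M - z (Suc M))"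
  by (simp add: alt_trapezoid_def algebra_simps)

text \<open>
  Lengthening the sum adds the differences \<open>z e - z (e + 1)\<close> with alternating signs.  By convexity
  they decrease, so all of them after \<open>M = 3\<close> have a nonnegative sum.
\<close>

lemma alt_trapezoid_ge_3:
  assumes M: "M \<ge> 3"
    and dec: "\<And>e. 1 \<le> e \<Longrightarrow> Suc e \<le> M \<Longrightarrow> z (Suc e) \<le> z e"
    and conv: "\<And>e. 1 \<le> e \<Longrightarrow> Suc (Suc e) \<le> M \<Longrightarrow> 2 * z (Suc e) \<le> z e + z (Suc (Suc e))"
  shows "2 * z 1 - 2 * z 2 + z 3 \<le> alt_trapezoid z M"
proof -
  have T: "alt_trapezoid z (3 + n) = 2 * z 1 - 2 * z 2 + z 3 + (\<Sum>i<n. (-1) ^ i * (z (3 + i) - z (4 + i)))" for n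
  proof (induction n)
    case 0
    show ?case by (simp add: alt_trapezoid_def eval_nat_numeral)
  next
    case (Suc n)
    have "alt_trapezoid z (3 + Suc n) = alt_trapezoid z (3 + n) + (-1) ^ (3 + n + 1) * (z (3 + n) - z (Suc (3 + n)))"
      using alt_trapezoid_Suc[of "3 + n" z] by simp
    thus ?case using Suc by (simp add: algebra_simps power_add)
  qed
  have "0 \<le> (\<Sum>i<M - 3. (-1) ^ i * (z (3 + i) - z (4 + i)))"
  proof (rule conjunct1[OF alternating_decreasing_nonneg])
    show "0 \<le> z (3 + i) - z (4 + i)" if "i < M - 3" for i using dec[of "3 + i"] that by (simp add: eval_nat_numeral)
    show "z (3 + Suc i) - z (4 + Suc i) \<le> z (3 + i) - z (4 + i)" if "Suc i < M - 3" for i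
    proof -
      have "Suc (Suc (3 + i)) \<le> M" using that by linarith
      from conv[OF _ this] show ?thesis by (simp add: eval_nat_numeral)
    qed
  qed
  thus ?thesis using T[of "M - 3"] M by simp
qed

lemma csc_node_decreasing:
  assumes "1 \<le> e" "2 * Suc e \<le> k"
  shows "csc_node k (Suc e) \<le> csc_node k e"
proof -
  have "real (2 * Suc e) * pi \<le> real k * pi" using assms by (intro mult_right_mono) auto
  hence le: "real (Suc e) * pi / k \<le> pi / 2" using assms by (simp add: field_simps)
  have "sin (e * pi / k) \<le> sin (Suc e * pi / k)"
    using le assms by (intro sin_monotone_2pi_le divide_right_mono mult_right_mono) (auto intro: order_trans[of _ 0])
  moreover have "0 < sin (e * pi / k)" using sin_node_pos[of e k] assms by simp
  ultimately show ?thesis unfolding csc_node_def by (intro divide_left_mono) auto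
qed

text \<open>
  The mean of the two neighboring sines is at most the sine in the middle, and \<open>1/x\<close> is decreasing and
  convex.
\<close>

lemma csc_node_convex:
  assumes "1 \<le> e" "2 * Suc (Suc e) \<le> k"
  shows "2 * csc_node k (Suc e) \<le> csc_node k e + csc_node k (Suc (Suc e))"
proof -
  define x h where "x = Suc e * pi / k" and "h = pi / k"
  have eq: "e * pi / k = x - h" "Suc (Suc e) * pi / k = x + h"
    by (simp_all add: x_def h_def distrib_right add_divide_distrib)
  define p q where "p = sin (x - h)" and "q = sin (x + h)"
  have p: "p > 0" "q > 0" "sin x > 0"
    unfolding p_def q_def eq[symmetric] unfolding x_def using assms by (intro sin_node_pos; simp)+
  have "p + q = 2 * sin x * cos h" by (simp add: p_def q_def sin_add sin_diff)
  also have "\<dots> \<le> 2 * sin x * 1" using p(3) by (intro mult_left_mono) auto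
  finally have pq: "p + q \<le> 2 * sin x" by simp
  have "2 / sin x \<le> 4 / (p + q)" using pq p by (simp add: field_simps)
  also have "\<dots> \<le> 1 / p + 1 / q"
  proof -
    have "0 \<le> (p - q)\<^sup>2 / (p * q * (p + q))" using p by simp
    also have "\<dots> = 1 / p + 1 / q - 4 / (p + q)"
      using p by (simp add: field_simps power2_eq_square)
    finally show ?thesis by simp
  qed
  finally show ?thesis unfolding csc_node_def eq p_def q_def x_def[symmetric] by simp
qed

lemma csum_alt_even:
  assumes "k = 2 * M" "M > 0"
  shows "csum (altsign k) k 1 = alt_trapezoid (csc_node k) M"
proof -
  have "csum (altsign k) k 1 = (\<Sum>e=1..<k. altsign k e * csc_node k e)" unfolding csum_1_csc csc_node_def by simp
  also have "\<dots> = 2 * (\<Sum>e=1..<M. altsign k e * csc_node k e) + altsign k M * csc_node k M"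
    by (rule sum_symmetric_even[OF assms]) (simp add: altsign_sym csc_node_reflect)
  also have "(\<Sum>e=1..<M. altsign k e * csc_node k e) = (\<Sum>e=1..<M. (-1) ^ (e + 1) * csc_node k e)"
    by (rule sum.cong) (use assms in \<open>auto simp: altsign_def min_def\<close>)
  also have "altsign k M = (-1) ^ (M + 1)" using assms by (simp add: altsign_def)
  finally show ?thesis by (simp add: alt_trapezoid_def)
qed

lemma csum_alt_odd:
  assumes "k = 2 * m + 1"
  shows "m > 0 \<Longrightarrow> csum (altsign k) k 1 = alt_trapezoid (csc_node k) m + (-1) ^ (m + 1) * csc_node k m"
    and "csum (altsign k) k 1 = 2 * (\<Sum>e=1..m. (-1) ^ (e + 1) * csc_node k e)"
proof -
  have "csum (altsign k) k 1 = (\<Sum>e=1..<k. altsign k e * csc_node k e)" unfolding csum_1_csc csc_node_def by simp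
  also have "\<dots> = 2 * (\<Sum>e=1..m. altsign k e * csc_node k e)"
    by (rule sum_symmetric_odd(1)[OF assms]) (simp add: altsign_sym csc_node_reflect)
  also have "(\<Sum>e=1..m. altsign k e * csc_node k e) = (\<Sum>e=1..m. (-1) ^ (e + 1) * csc_node k e)"
    by (rule sum.cong) (use assms in \<open>auto simp: altsign_def min_def\<close>)
  finally show 2: "csum (altsign k) k 1 = 2 * (\<Sum>e=1..m. (-1) ^ (e + 1) * csc_node k e)" .
  show "csum (altsign k) k 1 = alt_trapezoid (csc_node k) m + (-1) ^ (m + 1) * csc_node k m" if "m > 0"
  proof -
    have "{1..m} = insert m {1..<m}" using that by auto
    thus ?thesis unfolding 2 alt_trapezoid_def by (simp add: algebra_simps)
  qed
qed

lemma csc_three_lower: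
  assumes "k \<ge> 6"
  shows "4 / 3 * (k / pi - pi / k) \<le> 2 * csc_node k 1 - 2 * csc_node k 2 + csc_node k 3"
proof -
  define A B where "A = k / pi" and "B = pi / k"
  have "A \<le> csc_node k 1" "csc_node k 2 \<le> A / 2 + 2 / 3 * B" "A / 3 \<le> csc_node k 3"
    using csc_node_bounds(1)[of 1 k] csc_node_bounds(2)[of 2 k] csc_node_bounds(1)[of 3 k] assms
    by (simp_all add: A_def B_def)
  thus ?thesis unfolding A_def[symmetric] B_def[symmetric] by simp
qed

text \<open>
  The first three terms, with \<open>csc x \<ge> 1/x\<close> for the positive and \<open>csc x \<le> 1/x + x/3\<close> for the
  negative one.
\<close>

lemma alt_trapezoid_csc_lower:
  assumes "M \<ge> 3" "2 * M \<le> k"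
  shows "4 / 3 * (k / pi - pi / k) \<le> alt_trapezoid (csc_node k) M"
proof -
  have "2 * csc_node k 1 - 2 * csc_node k 2 + csc_node k 3 \<le> alt_trapezoid (csc_node k) M"
    by (rule alt_trapezoid_ge_3) (use assms in \<open>auto intro!: csc_node_decreasing csc_node_convex\<close>)
  thus ?thesis using csc_three_lower[of k] assms by simp
qed

lemma linear_le_csc_lower:
  assumes "k \<ge> 10"
  shows "38 / 100 * real k \<le> 4 / 3 * (k / pi - pi / k)"
proof -
  have "pi \<le> 3.1416" using pi_approx by simp
  have "real k / 3.1416 \<le> k / pi" by (rule frac_le) (use \<open>pi \<le> 3.1416\<close> in auto)
  moreover have "pi / k \<le> 3.1416 / real k" by (rule divide_right_mono) (use \<open>pi \<le> 3.1416\<close> in auto)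
  moreover have "3.1416 / real k \<le> 3.1416 / 100 * k"
  proof -
    have "100 \<le> real k * real k" using assms mult_mono[of 10 "real k" 10 "real k"] by simp
    thus ?thesis using assms by (simp add: field_simps)
  qed
  ultimately show ?thesis by simp
qed

definition altsum :: "nat \<Rightarrow> real" where "altsum k = csum (altsign k) k 1"

lemma altsum_even:
  assumes "even k" "k \<ge> 6"
  shows "4 / 3 * (k / pi - pi / k) \<le> altsum k"
proof -
  obtain M where M: "k = 2 * M" using assms by (elim evenE)
  show ?thesis unfolding altsum_def using alt_trapezoid_csc_lower[of M k] csum_alt_even[OF M] M assms by simp
qed

lemma altsum_odd:
  assumes k: "k = 2 * m + 1" and m: "odd m" "m \<ge> 3"
  shows "4 / 3 * (k / pi - pi / k) + 1 \<le> altsum k"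
proof -
  have "csc_node k m \<ge> 1" using csc_node_bounds(3)[of m k] k m by simp
  moreover have "4 / 3 * (k / pi - pi / k) \<le> alt_trapezoid (csc_node k) m"
    by (rule alt_trapezoid_csc_lower) (use k m in auto)
  ultimately have "4 / 3 * (k / pi - pi / k) + 1 \<le> alt_trapezoid (csc_node k) m + csc_node k m" by (intro add_mono)
  thus ?thesis unfolding altsum_def using csum_alt_odd(1)[OF k] m by simp
qed

text \<open>
  For even \<open>m\<close> the last term has the wrong sign; it belongs to a node between \<open>4\<pi>/9\<close> and \<open>\<pi>/2\<close>,
  where the bound \<open>1/x + x/3\<close> of the cosecant is at most \<open>17/12\<close>.
\<close>

lemma altsum_odd_even:
  assumes k: "k = 2 * m + 1" "even m" "m \<ge> 4"
  shows "193 / 100 \<le> altsum k"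
proof -
  have p: "pi \<le> 22 / 7" and k9: "9 \<le> real k" using pi_approx k by simp_all
  have kk: "9 / (22 / 7) \<le> k / pi" by (rule frac_le) (use p k9 in auto)
  have kk': "pi / k \<le> (22 / 7) / 9" by (rule frac_le) (use p k9 in auto)
  have "4 / 3 * (k / pi - pi / k) \<le> alt_trapezoid (csc_node k) m"
    by (rule alt_trapezoid_csc_lower) (use k in auto)
  moreover have "4 / 3 * (9 / (22 / 7) - 22 / 7 / 9) \<le> 4 / 3 * (k / pi - pi / k)"
    by (intro mult_left_mono diff_mono kk kk') simp
  ultimately have T: "alt_trapezoid (csc_node k) m \<ge> 335 / 100" by simp
  have mk: "4 / 9 * k \<le> m" "m \<le> k / 2" "k > 0" using k by simp_all
  have "k / (m * pi) \<le> k / ((4 / 9 * k) * 3)"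
    using mk pi_gt3 by (intro divide_left_mono mult_mono mult_pos_pos) auto
  also have "k / ((4 / 9 * k) * 3) = 3 / 4" using mk by simp
  finally have 1: "k / (m * pi) \<le> 3 / 4" .
  have "m * pi / (3 * real k) \<le> (k / 2) * 4 / (3 * real k)"
    using mk pi_less_4 by (intro divide_right_mono mult_mono) auto
  also have "\<dots> = 2 / 3" using mk by simp
  finally have 2: "m * pi / (3 * real k) \<le> 2 / 3" .
  have "csc_node k m \<le> k / (m * pi) + m * pi / (3 * real k)"
    using k by (intro csc_node_bounds(2)) auto
  hence "csc_node k m \<le> 1417 / 1000" using 1 2 by linarith
  thus ?thesis using csum_alt_odd(1)[OF k(1)] k T by (simp add: altsum_def)
qed

lemma altsum_8: "286 / 100 \<le> altsum 8"
proof -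
  have p: "pi \<le> 22 / 7" using pi_approx by simp
  have "8 / (22 / 7) \<le> 8 / pi" by (rule frac_le) (use p in auto)
  moreover have "pi / 8 \<le> (22 / 7) / 8" by (rule divide_right_mono[OF p]) simp
  ultimately have "4 / 3 * (8 / (22 / 7) - (22 / 7) / 8) \<le> 4 / 3 * (8 / pi - pi / 8)" by (intro mult_left_mono diff_mono) auto
  thus ?thesis using altsum_even[of 8] by simp
qed

lemma csum_alt_pos:
  assumes "k \<ge> 4"
  shows "csum (altsign k) k 1 > 0"
proof (cases "k < 6")
  case True
  have dec: "csc_node k 2 < csc_node k 1" if "2 * 2 \<le> k"
  proof -
    have "1 * pi / k < 2 * pi / k" using assms by (simp add: divide_strict_right_mono)
    moreover have "2 * pi / k \<le> pi / 2" using that by (simp add: field_simps)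
    ultimately have "sin (1 * pi / k) < sin (2 * pi / k)" using assms
      by (intro sin_monotone_2pi) (auto intro: order_less_le_trans[of _ 0])
    moreover have "sin (1 * pi / k) > 0" using sin_node_pos[of 1 k] assms by simp
    ultimately show ?thesis unfolding csc_node_def by (intro divide_strict_left_mono) auto
  qed
  have "k = 4 \<or> k = 5" using True assms by auto
  thus ?thesis
  proof
    assume k: "k = 4"
    have "csum (altsign k) k 1 = 2 * csc_node k 1 - csc_node k 2"
      using csum_alt_even[of k 2] k by (simp add: alt_trapezoid_def eval_nat_numeral)
    moreover have "csc_node k 1 \<ge> 1" using csc_node_bounds(3)[of 1 k] k by simp
    ultimately show ?thesis using dec k by simp
  next
    assume k: "k = 5"
    have "csum (altsign k) k 1 = 2 * (csc_node k 1 - csc_node k 2)"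
      using csum_alt_odd(2)[of k 2] k by (simp add: eval_nat_numeral)
    thus ?thesis using dec k by simp
  qed
next
  case False
  have "pi * pi < 4 * 4" by (rule mult_strict_mono) (use pi_less_4 in auto)
  also have "\<dots> \<le> real k * real k" using False by (intro mult_mono) auto
  finally have "pi / k < k / pi" using False by (simp add: field_simps)
  hence pos: "0 < 4 / 3 * (k / pi - pi / k)" by simp
  show ?thesis
  proof (cases "even k")
    case True
    thus ?thesis using altsum_even[of k] pos False by (simp add: altsum_def)
  next
    case odd: False
    then obtain m where m: "k = 2 * m + 1" by (elim oddE)
    show ?thesis
    proof (cases "even m")
      case True
      hence "m \<ge> 4" using m \<open>\<not> k < 6\<close> by presburger
      thus ?thesis using altsum_odd_even[OF m True] by (simp add: altsum_def)
    next
      case odd_m: False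
      have "m \<ge> 3" using m \<open>\<not> k < 6\<close> by simp
      thus ?thesis using altsum_odd[OF m odd_m] pos unfolding altsum_def by linarith
    qed
  qed
qed

section \<open>The initial gaps\<close>

text \<open>
  Combines \<open>cot x \<ge> 1/x - x/2\<close> at \<open>x = (2j+1)\<pi>/(2k)\<close> with the upper bound of the sum that
  normalizes.
\<close>

lemma sinsum_ratio_plain_lower:
  assumes k: "k \<ge> 6" "2 * j + 1 \<le> k"
  shows "1 / (2 * real j + 1) - (2 * real j + 1) * (pi / k)\<^sup>2 / 8
    \<le> sinsum_ratio one_weight k j * (harm ((k - 1) div 2) + 11 / 20)"
proof -
  define L where "L = harm ((k - 1) div 2) + (11 / 20 :: real)"
  define R where "R = csum one_weight k 1"
  define h where "h = pi / k"
  define x where "x = half_node k j"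
  have h: "h > 0" using k by (simp add: h_def)
  have R: "R > 0" "R \<le> 2 / h * L" using csum_plain_pos[of k] csum_plain_upper[OF k(1)] k by (simp_all add: R_def L_def h_def)
  have x: "0 < x" "x \<le> pi / 2" using half_node_pos[of k j] half_node_le[OF k(2)] k by (simp_all add: x_def)
  have xh: "x = (2 * real j + 1) * h / 2" by (simp add: x_def half_node_def h_def)
  have c0: "cot x \<ge> 0" using cot_antimono[OF x(1,2)] by (simp add: cot_def)
  have "1 / (2 * real j + 1) - (2 * real j + 1) * h\<^sup>2 / 8 = h / 2 * (1 / x - x / 2)"
  proof -
    have gen: "1 / y - y * h\<^sup>2 / 8 = h / 2 * (1 / (y * h / 2) - (y * h / 2) / 2)" if "y > 0" for y
      using h that by (simp add: field_simps power2_eq_square)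
    show ?thesis unfolding xh by (rule gen) simp
  qed
  also have "\<dots> \<le> h / 2 * cot x" using cot_ge[OF x] h by (intro mult_left_mono) auto
  also have "\<dots> \<le> L / R * cot x"
  proof (rule mult_right_mono[OF _ c0])
    show "h / 2 \<le> L / R" using R h by (simp add: field_simps)
  qed
  also have "\<dots> = sinsum_ratio one_weight k j * L" using sinsum_ratio_plain[of j k] k by (simp add: x_def R_def)
  finally show ?thesis by (simp add: L_def h_def)
qed

text \<open>
  The coefficients are those of \<open>csum_ratio_small\<close>; \<open>\<Lambda>\<close> and \<open>q\<close> are numerical bounds that
  hold for a whole range of \<open>k\<close>.
\<close>

lemma sinsum_ratio_plain_combinations:
  assumes k: "k \<ge> 6" and L: "harm ((k - 1) div 2) + 11 / 20 \<le> \<Lambda>" and q: "(pi / k)\<^sup>2 \<le> q"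
  defines "c \<equiv> sinsum_ratio one_weight k"
  shows "1 - q / 8 \<le> c 0 * \<Lambda>"
    "40 / 3 - 3 * q \<le> (12 * c 0 + 4 * c 1) * \<Lambda>"
    "144 / 5 - 10 * q \<le> (24 * c 0 + 12 * c 1 + 4 * c 2) * \<Lambda>"
    "k \<ge> 7 \<Longrightarrow> 5097 / 100 - 25 * q \<le> (40 * c 0 + 24 * c 1 + 12 * c 2 + 4 * c 3) * \<Lambda>"
proof -
  have c: "1 / (2 * real j + 1) - (2 * real j + 1) * q / 8 \<le> c j * \<Lambda>" if j: "2 * j + 1 \<le> k" for j
  proof -
    have "1 / (2 * real j + 1) - (2 * real j + 1) * q / 8 \<le> 1 / (2 * real j + 1) - (2 * real j + 1) * (pi / k)\<^sup>2 / 8"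
      using q by (intro diff_left_mono divide_right_mono mult_left_mono) auto
    also have "\<dots> \<le> c j * (harm ((k - 1) div 2) + 11 / 20)" unfolding c_def by (rule sinsum_ratio_plain_lower[OF k j])
    also have "\<dots> \<le> c j * \<Lambda>" using L sinsum_ratio_plain_nonneg[of k j] k j unfolding c_def by (intro mult_left_mono) auto
    finally show ?thesis .
  qed
  have c0: "1 - q / 8 \<le> c 0 * \<Lambda>" and c1: "1 / 3 - 3 * q / 8 \<le> c 1 * \<Lambda>" and c2: "1 / 5 - 5 * q / 8 \<le> c 2 * \<Lambda>"
    using c[of 0] c[of 1] c[of 2] k by simp_all
  show "1 - q / 8 \<le> c 0 * \<Lambda>" by (rule c0)
  show "40 / 3 - 3 * q \<le> (12 * c 0 + 4 * c 1) * \<Lambda>" unfolding distrib_right mult.assoc using c0 c1 by linarith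
  show "144 / 5 - 10 * q \<le> (24 * c 0 + 12 * c 1 + 4 * c 2) * \<Lambda>" unfolding distrib_right mult.assoc using c0 c1 c2 by linarith
  assume "k \<ge> 7"
  hence "1 / 7 - 7 * q / 8 \<le> c 3 * \<Lambda>" using c[of 3] by simp
  thus "5097 / 100 - 25 * q \<le> (40 * c 0 + 24 * c 1 + 12 * c 2 + 4 * c 3) * \<Lambda>"
    unfolding distrib_right mult.assoc using c0 c1 c2 by linarith
qed

text \<open>
  Right ends of the ranges of \<open>k\<close> below; \<open>512\<close> serves all \<open>k \<le> 1000\<close>.  The large ones come from
  small ones by doubling.
\<close>

lemma harm_values:
  "harm 2 = (3 / 2 :: real)" "harm 3 = (11 / 6 :: real)" "harm 7 \<le> (2593 / 1000 :: real)"
  "harm 20 \<le> (363 / 100 :: real)" "harm 30 \<le> (402 / 100 :: real)" "harm 100 \<le> (5217 / 1000 :: real)" "harm 512 \<le> (6881 / 1000 :: real)"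
proof -
  have e: "harm (numeral n) = harm (pred_numeral n) + inverse (numeral n :: real)" for n
    using harm_Suc[of "pred_numeral n"] by (metis numeral_eq_Suc of_nat_numeral)
  have h1: "harm 1 = (1 :: real)" by (simp add: harm_def)
  show "harm 2 = (3 / 2 :: real)" "harm 3 = (11 / 6 :: real)" "harm 7 \<le> (2593 / 1000 :: real)"
    using h1 by (simp_all add: e)
  have "harm 10 \<le> (293 / 100 :: real)" "harm 15 \<le> (3319 / 1000 :: real)" "harm 16 \<le> (3381 / 1000 :: real)" "harm 25 \<le> (3816 / 1000 + 1 / 1000 :: real)"
    using h1 by (simp_all add: e)
  thus "harm 20 \<le> (363 / 100 :: real)" "harm 30 \<le> (402 / 100 :: real)" "harm 100 \<le> (5217 / 1000 :: real)" "harm 512 \<le> (6881 / 1000 :: real)"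
    using harm_double[of 10] harm_double[of 15] harm_double[of 25] harm_double[of 50]
      harm_double[of 16] harm_double[of 32] harm_double[of 64] harm_double[of 128] harm_double[of 256] by simp_all
qed

lemma harm_le_of: "m \<le> m0 \<Longrightarrow> harm m0 \<le> (b :: real) \<Longrightarrow> harm m \<le> b"
  using harm_mono[of m m0, where 'a = real] by simp

lemma step_sq_le:
  assumes "k \<ge> k0" "k0 > 0"
  shows "(pi / real k)\<^sup>2 \<le> 9.87 / (real k0)\<^sup>2"
proof -
  have "pi\<^sup>2 \<le> 3.1416\<^sup>2" using pi_approx by (intro power_mono) auto
  hence "pi\<^sup>2 \<le> 9.87" by (simp add: power2_eq_square)
  moreover have "(real k0)\<^sup>2 \<le> (real k)\<^sup>2" using assms by (intro power_mono) auto
  ultimately show ?thesis unfolding power_divide using assms by (intro frac_le) auto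
qed

lemma half_node_upper:
  assumes "k \<ge> k0" "k0 > 0"
  shows "half_node k j \<le> (2 * real j + 1) * (11 / 7) / real k0"
proof -
  have "pi \<le> 22 / 7" using pi_approx by simp
  hence "(2 * real j + 1) * pi \<le> (2 * real j + 1) * (22 / 7)" by (intro mult_left_mono) auto
  moreover have "real (2 * k0) \<le> real (2 * k)" using assms by simp
  ultimately have "half_node k j \<le> (2 * real j + 1) * (22 / 7) / (2 * real k0)"
    unfolding half_node_def using assms by (intro frac_le) auto
  moreover have "A * (22 / 7) / (2 * K) = A * (11 / 7) / K" if "K > 0" for A K :: real
    using that by (simp add: field_simps)
  from this[of "real k0"] have "(2 * real j + 1) * (22 / 7) / (2 * real k0) = (2 * real j + 1) * (11 / 7) / real k0"
    using assms by (simp only: of_nat_0_less_iff)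
  ultimately show ?thesis by (simp only:)
qed

lemma sinsum_ratio_alt: "sinsum_ratio (altsign k) k j = sinsum (altsign k) k j / altsum k"
  by (simp add: sinsum_ratio_def altsum_def)

text \<open>
  In these bounds \<open>k0\<close> is the left end of a range of \<open>k\<close>, and \<open>22/7\<close> replaces \<open>\<pi>\<close>.
\<close>

lemma sinsum_even_bound:
  assumes "even k" "k \<ge> k0" "k0 > 0" "2 * j + 1 < k"
    and X: "X = (2 * real j + 1) * (11 / 7) / real k0" "X\<^sup>2 < 2"
  shows "0 < sinsum (altsign k) k j" "sinsum (altsign k) k j \<le> X / (1 - X\<^sup>2 / 2)"
proof -
  have h: "0 < half_node k j" "half_node k j < pi / 2" "half_node k j \<le> X"
    using half_node_pos[of k j] half_node_less[of j k] half_node_upper[of k0 k j] assms by auto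
  have "0 < tan (half_node k j)" "tan (half_node k j) \<le> X / (1 - X\<^sup>2 / 2)"
    by (rule tan_gt_zero[OF h(1,2)], rule tan_le_of_le[OF less_imp_le[OF h(1)] h(3) X(2) h(2)])
  thus "0 < sinsum (altsign k) k j" "sinsum (altsign k) k j \<le> X / (1 - X\<^sup>2 / 2)"
    using sinsum_alt_even[of k j] assms by auto
qed

lemma sinsum_odd_bounds:
  assumes k: "k = 2 * m + 1" "k \<ge> k0" "k0 > 0" "j < m"
    and X: "X = (2 * real j + 1) * (11 / 14) / real k0" "t = X / (1 - X\<^sup>2 / 2)" "X\<^sup>2 < 2" "t < 1"
  shows "even (m + j) \<Longrightarrow> - 1 \<le> sinsum (altsign k) k j \<and> sinsum (altsign k) k j \<le> - ((1 - t) / (1 + t))"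
    "odd (m + j) \<Longrightarrow> 1 \<le> sinsum (altsign k) k j \<and> sinsum (altsign k) k j \<le> (1 + t) / (1 - t)"
proof -
  have gen: "2 * (A * (11 / 14) / K) = A * (11 / 7) / K" if "K > 0" for A K :: real
    using that by (simp add: field_simps)
  have X2: "2 * X = (2 * real j + 1) * (11 / 7) / real k0" unfolding X(1) using k(3) by (intro gen) simp
  have X3: "2 * X / 2 = X" by simp
  have h: "0 < half_node k j" "half_node k j < pi / 2"
    using half_node_pos[of k j] half_node_less[of j k] k by auto
  have hX: "half_node k j \<le> 2 * X" unfolding X2 using k(2,3) by (rule half_node_upper)
  have b: "tan (pi / 4 + half_node k j / 2) \<le> (1 + t) / (1 - t)" "(1 - t) / (1 + t) \<le> tan (pi / 4 - half_node k j / 2)"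
    "tan (pi / 4 - half_node k j / 2) \<le> 1" "1 \<le> tan (pi / 4 + half_node k j / 2)"
    using tan_quarter_bounds[of "half_node k j" "2 * X" t, unfolded X3, OF less_imp_le[OF h(1)] hX X(3) h(2) X(2,4)]
    by blast+
  show "even (m + j) \<Longrightarrow> - 1 \<le> sinsum (altsign k) k j \<and> sinsum (altsign k) k j \<le> - ((1 - t) / (1 + t))"
    "odd (m + j) \<Longrightarrow> 1 \<le> sinsum (altsign k) k j \<and> sinsum (altsign k) k j \<le> (1 + t) / (1 - t)"
    using sinsum_alt_odd[OF k(1), of j] b k(4) by simp_all
qed

text \<open>
  The comparison \<open>r + u/S < c\<close> is checked with bounds of \<open>u\<close>, \<open>S\<close> and \<open>c\<close>, so that the last
  assumption contains only numerals.
\<close>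

lemma weighted_bound:
  fixes S U u lo cc \<Lambda> v :: real
  assumes "u \<le> U" "0 < lo" "lo \<le> S" "0 \<le> U" "v \<le> cc * \<Lambda>" "0 < \<Lambda>" "r + U / lo < v / \<Lambda>"
  shows "r + u / S < cc"
proof -
  have "u / S \<le> U / lo" using assms by (intro frac_le) auto
  moreover have "v / \<Lambda> \<le> cc" using assms by (simp add: field_simps)
  ultimately show ?thesis using assms by linarith
qed

text \<open>
  What the induction along \<open>csum_gap_mono\<close> needs at its start.  The threshold
  \<open>(5 + max 1 t)/2\<close> is the slack in \<open>mode_form_zero_lower\<close>, with \<open>ctsum_ratio_alt_le\<close> bounding its
  last term.  For \<open>k < 10\<close> the index \<open>5\<close> lies beyond \<open>k/2\<close>.
\<close>

definition initial_gaps :: "nat \<Rightarrow> bool" where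
  "initial_gaps k \<longleftrightarrow> sinsum_ratio (altsign k) k 0 \<le> sinsum_ratio one_weight k 0 \<and>
     (5 + max 1 (ctsum_ratio (altsign k) k 1)) / 2 < csum_gap k 4 \<and>
     (k \<ge> 10 \<longrightarrow> (5 + max 1 (ctsum_ratio (altsign k) k 1)) / 2 < csum_gap k 5)"

text \<open>
  The gaps, written by third differences; \<open>r\<close> is an upper bound of the threshold.
\<close>

lemma initial_gapsI:
  fixes k :: nat
  defines "c \<equiv> sinsum_ratio one_weight k" and "u \<equiv> sinsum (altsign k) k" and "S \<equiv> altsum k"
  assumes k: "k \<ge> 8"
    and r: "r \<ge> 3" "r \<ge> 3 - u 0 / S"
    and 0: "0 + u 0 / S < c 0"
    and 4: "r + (24 * u 0 + 12 * u 1 + 4 * u 2) / S < 24 * c 0 + 12 * c 1 + 4 * c 2"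
    and 5: "k \<ge> 10 \<Longrightarrow> r + (40 * u 0 + 24 * u 1 + 12 * u 2 + 4 * u 3) / S < 40 * c 0 + 24 * c 1 + 12 * c 2 + 4 * c 3"
  shows "initial_gaps k"
proof -
  have nz: "csum one_weight k 1 \<noteq> 0" "csum (altsign k) k 1 \<noteq> 0"
    using csum_plain_pos[of k] csum_alt_pos[of k] k by auto
  have s: "sinsum_ratio (altsign k) k j = u j / S" for j by (simp add: sinsum_ratio_alt u_def S_def)
  have t: "ctsum_ratio (altsign k) k 1 = 1 - 2 * (u 0 / S)" using csum_ratio_small(5)[OF nz(2)] s by simp
  have m: "(5 + max 1 (ctsum_ratio (altsign k) k 1)) / 2 \<le> r" unfolding t using r by (simp add: max_def)
  have g4: "csum_gap k 4 = 24 * c 0 + 12 * c 1 + 4 * c 2 - (24 * u 0 + 12 * u 1 + 4 * u 2) / S"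
    unfolding csum_gap_def csum_ratio_small(3)[OF nz(1)] csum_ratio_small(3)[OF nz(2)] s c_def[symmetric] by (simp add: add_divide_distrib)
  have g5: "csum_gap k 5 = 40 * c 0 + 24 * c 1 + 12 * c 2 + 4 * c 3 - (40 * u 0 + 24 * u 1 + 12 * u 2 + 4 * u 3) / S"
    unfolding csum_gap_def csum_ratio_small(4)[OF nz(1)] csum_ratio_small(4)[OF nz(2)] s c_def[symmetric] by (simp add: add_divide_distrib)
  have "sinsum_ratio (altsign k) k 0 \<le> sinsum_ratio one_weight k 0" using 0 by (simp add: s c_def)
  moreover have "(5 + max 1 (ctsum_ratio (altsign k) k 1)) / 2 < csum_gap k 4" unfolding g4 using m 4 by linarith
  moreover have "(5 + max 1 (ctsum_ratio (altsign k) k 1)) / 2 < csum_gap k 5" if "k \<ge> 10" unfolding g5 using m 5[OF that] by linarith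
  ultimately show ?thesis unfolding initial_gaps_def by blast
qed

lemma initial_gaps_numeric:
  fixes k ka :: nat and \<Lambda> Ua Ub Uc lo r :: real
  defines "u \<equiv> sinsum (altsign k) k" and "S \<equiv> altsum k"
  assumes k: "k \<ge> 8" "k \<ge> ka" "ka > 0"
    and L: "harm ((k - 1) div 2) + 11 / 20 \<le> \<Lambda>" "0 < \<Lambda>"
    and lo: "0 < lo" "lo \<le> S"
    and U: "u 0 \<le> Ua" "24 * u 0 + 12 * u 1 + 4 * u 2 \<le> Ub" "k \<ge> 10 \<Longrightarrow> 40 * u 0 + 24 * u 1 + 12 * u 2 + 4 * u 3 \<le> Uc"
    and nn: "0 \<le> Ua" "0 \<le> Ub" "0 \<le> Uc"
    and r: "r \<ge> 3" "r \<ge> 3 - u 0 / S"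
    and num: "Ua / lo < (1 - 9.87 / (real ka)\<^sup>2 / 8) / \<Lambda>"
      "r + Ub / lo < (144 / 5 - 10 * (9.87 / (real ka)\<^sup>2)) / \<Lambda>"
      "k \<ge> 10 \<Longrightarrow> r + Uc / lo < (5097 / 100 - 25 * (9.87 / (real ka)\<^sup>2)) / \<Lambda>"
  shows "initial_gaps k"
proof (rule initial_gapsI[OF k(1) r(1)])
  have k6: "k \<ge> 6" using k by simp
  note c = sinsum_ratio_plain_combinations[OF k6 L(1) step_sq_le[OF k(2,3)]]
  show "3 - sinsum (altsign k) k 0 / altsum k \<le> r" using r by (simp add: u_def S_def)
  show "0 + sinsum (altsign k) k 0 / altsum k < sinsum_ratio one_weight k 0"
    by (rule weighted_bound[OF U(1)[unfolded u_def] lo[unfolded S_def] nn(1) c(1) L(2)]) (use num in simp)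
  show "r + (24 * sinsum (altsign k) k 0 + 12 * sinsum (altsign k) k 1 + 4 * sinsum (altsign k) k 2) / altsum k
    < 24 * sinsum_ratio one_weight k 0 + 12 * sinsum_ratio one_weight k 1 + 4 * sinsum_ratio one_weight k 2"
    by (rule weighted_bound[OF U(2)[unfolded u_def] lo[unfolded S_def] nn(2) c(3) L(2) num(2)])
  assume k10: "k \<ge> 10"
  hence k7: "k \<ge> 7" by simp
  show "r + (40 * sinsum (altsign k) k 0 + 24 * sinsum (altsign k) k 1 + 12 * sinsum (altsign k) k 2 + 4 * sinsum (altsign k) k 3) / altsum k
    < 40 * sinsum_ratio one_weight k 0 + 24 * sinsum_ratio one_weight k 1 + 12 * sinsum_ratio one_weight k 2 + 4 * sinsum_ratio one_weight k 3"
    by (rule weighted_bound[OF U(3)[unfolded u_def, OF k10] lo[unfolded S_def] nn(3) c(4)[OF k7] L(2) num(3)[OF k10]])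
qed

text \<open>
  The harmonic number in the bound of the normalizing sum grows with \<open>k\<close>, and the
  lower bound of \<open>altsum\<close> grows much faster.  So it is enough to combine the value of the former at the
  right end of a range with the value of the latter at its left end; the ranges are \<open>8\<close>, \<open>10-16\<close>,
  \<open>18-60\<close> and \<open>62-1000\<close>.
\<close>

lemma initial_gaps_even:
  assumes k: "even k" "8 \<le> k" "k \<le> 1000"
  shows "initial_gaps k"
proof -
  define m where "m = (k - 1) div 2"
  have u0: "0 < sinsum (altsign k) k 0"
    by (rule sinsum_even_bound[OF k(1), of 8 0 "11/56"]) (use k in \<open>auto simp: power2_eq_square\<close>)
  have r: "3 - sinsum (altsign k) k 0 / altsum k \<le> 3"
    using u0 csum_alt_pos[of k] k by (simp add: altsum_def)
  show ?thesis
  proof (cases "k = 8")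
    case True
    have lo: "286 / 100 \<le> altsum k" using altsum_8 True by simp
    have b: "sinsum (altsign k) k 0 \<le> 201 / 1000" "sinsum (altsign k) k 1 \<le> 714 / 1000" "sinsum (altsign k) k 2 \<le> 1898 / 1000"
      using sinsum_even_bound(2)[OF k(1), of 8 0 "11/56"] sinsum_even_bound(2)[OF k(1), of 8 1 "33/56"]
        sinsum_even_bound(2)[OF k(1), of 8 2 "55/56"] True by (simp_all add: power2_eq_square)
    show ?thesis
    proof (rule initial_gaps_numeric[where k = k and ka = 8 and \<Lambda> = "2384/1000" and Ua = "201/1000" and Ub = "2099/100" and Uc = 0 and lo = "286/100" and r = 3])
      show "harm ((k - 1) div 2) + 11 / 20 \<le> (2384 / 1000 :: real)" using True harm_values(2) by simp
    qed (use lo b r True in \<open>simp_all add: power2_eq_square\<close>)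
  next
    case False
    hence k10: "k \<ge> 10" using k by presburger
    have b: "sinsum (altsign k) k 0 \<le> 160 / 1000" "sinsum (altsign k) k 1 \<le> 531 / 1000" "sinsum (altsign k) k 2 \<le> 1137 / 1000"
       "sinsum (altsign k) k 3 \<le> 2786 / 1000"
      using sinsum_even_bound(2)[OF k(1), of 10 0 "11/70"] sinsum_even_bound(2)[OF k(1), of 10 1 "33/70"]
        sinsum_even_bound(2)[OF k(1), of 10 2 "55/70"] sinsum_even_bound(2)[OF k(1), of 10 3 "77/70"] k10 by (simp_all add: power2_eq_square)
    have lo: "38 / 100 * real k \<le> altsum k" using linear_le_csc_lower[OF k10] altsum_even[OF k(1)] k10 by simp
    note num = initial_gaps_numeric[where k = k and Ua = "160/1000" and Ub = "1477/100" and Uc = "4394/100" and r = 3]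
    have m: "(k - 1) div 2 = m" by (simp add: m_def)
    have "k \<noteq> 17" "k \<noteq> 61" using k(1) by auto
    then consider "k \<le> 16" | "18 \<le> k" "k \<le> 60" | "62 \<le> k" by linarith
    thus ?thesis
    proof cases
      case 1
      have "harm ((k - 1) div 2) \<le> (2593 / 1000 :: real)" by (rule harm_le_of[OF _ harm_values(3)]) (use 1 in simp)
      thus ?thesis using k10 b r lo by (intro num[where ka = 10 and \<Lambda> = "3143/1000" and lo = "38/10"]) (simp_all add: power2_eq_square)
    next
      case 2
      have "harm ((k - 1) div 2) \<le> (402 / 100 :: real)" by (rule harm_le_of[OF _ harm_values(5)]) (use 2 in simp)
      thus ?thesis using k10 b r lo 2 by (intro num[where ka = 18 and \<Lambda> = "457/100" and lo = "38/100*18"]) (simp_all add: power2_eq_square)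
    next
      case 3
      have "harm ((k - 1) div 2) \<le> (6881 / 1000 :: real)" by (rule harm_le_of[OF _ harm_values(7)]) (use k in simp)
      thus ?thesis using k10 b r lo 3 by (intro num[where ka = 62 and \<Lambda> = "7431/1000" and lo = "38/100*62"]) (simp_all add: power2_eq_square)
    qed
  qed
qed

lemma odd_small_bounds:
  assumes k: "k = 2 * m + 1" "odd m" "k \<ge> 11"
  shows "1 \<le> sinsum (altsign k) k 0" "sinsum (altsign k) k 0 \<le> 11543 / 10000"
    "sinsum (altsign k) k 1 \<le> - (6402 / 10000)"
    "1 \<le> sinsum (altsign k) k 2" "sinsum (altsign k) k 2 \<le> 22336 / 10000"
    "sinsum (altsign k) k 3 \<le> 0"
  using sinsum_odd_bounds(2)[OF k(1), of 11 0 "11/154" "2 * (11/154) / (2 - (11/154)\<^sup>2)"]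
    sinsum_odd_bounds(1)[OF k(1), of 11 1 "33/154" "2 * (33/154) / (2 - (33/154)\<^sup>2)"]
    sinsum_odd_bounds(2)[OF k(1), of 11 2 "55/154" "2 * (55/154) / (2 - (55/154)\<^sup>2)"]
    sinsum_odd_bounds(1)[OF k(1), of 11 3 "77/154" "2 * (77/154) / (2 - (77/154)\<^sup>2)"] k
  by (simp_all add: power2_eq_square)

lemma altsum_odd_linear:
  assumes k: "k = 2 * m + 1" "odd m" "k \<ge> 11"
  shows "38 / 100 * real k + 1 \<le> altsum k"
proof -
  have "38 / 100 * real k + 1 \<le> 4 / 3 * (k / pi - pi / k) + 1" by (rule add_right_mono[OF linear_le_csc_lower]) (use k in simp)
  also have "\<dots> \<le> altsum k" by (rule altsum_odd[OF k(1,2)]) (use k in simp)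
  finally show ?thesis .
qed

lemma initial_gaps_odd_odd:
  assumes k: "k = 2 * m + 1" "odd m" "11 \<le> k" "k \<le> 1000"
  shows "initial_gaps k"
proof -
  note b = odd_small_bounds[OF k(1,2,3)]
  have lo: "38 / 100 * real k + 1 \<le> altsum k" by (rule altsum_odd_linear[OF k(1,2,3)])
  have r: "3 - sinsum (altsign k) k 0 / altsum k \<le> 3" using b(1) csum_alt_pos[of k] k by (simp add: altsum_def)
  have m: "(k - 1) div 2 = m" using k by simp
  have k8: "8 \<le> k" using k by simp
  have U: "24 * sinsum (altsign k) k 0 + 12 * sinsum (altsign k) k 1 + 4 * sinsum (altsign k) k 2 \<le> 28956 / 1000"
    "40 * sinsum (altsign k) k 0 + 24 * sinsum (altsign k) k 1 + 12 * sinsum (altsign k) k 2 + 4 * sinsum (altsign k) k 3 \<le> 5762 / 100"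
    using b by simp_all
  note num = initial_gaps_numeric[where k = k and Ua = "11543/10000" and Ub = "28956/1000" and Uc = "5762/100" and r = 3]
  have "m \<noteq> 8" "m \<noteq> 20" "m \<noteq> 100" using k(2) by auto
  then consider "m \<le> 7" | "9 \<le> m" "m \<le> 20" | "21 \<le> m" "m \<le> 100" | "101 \<le> m" by linarith
  thus ?thesis
  proof cases
    case 1
    have "harm ((k - 1) div 2) \<le> (2593 / 1000 :: real)" by (rule harm_le_of[OF _ harm_values(3)]) (use 1 k(1) in simp)
    thus ?thesis using k8 k(3) b U r lo
      by (intro num[where ka = 11 and \<Lambda> = "3143/1000" and lo = "518/100"]) (simp_all add: power2_eq_square)
  next
    case 2
    have "harm ((k - 1) div 2) \<le> (363 / 100 :: real)" by (rule harm_le_of[OF _ harm_values(4)]) (use 2 k(1) in simp)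
    moreover have "19 \<le> k" using 2 k by simp
    ultimately show ?thesis using k8 b U r lo
      by (intro num[where ka = 19 and \<Lambda> = "418/100" and lo = "822/100"]) (simp_all add: power2_eq_square)
  next
    case 3
    have "harm ((k - 1) div 2) \<le> (5217 / 1000 :: real)" by (rule harm_le_of[OF _ harm_values(6)]) (use 3 k(1) in simp)
    moreover have "43 \<le> k" using 3 k by simp
    ultimately show ?thesis using k8 b U r lo
      by (intro num[where ka = 43 and \<Lambda> = "5767/1000" and lo = "1734/100"]) (simp_all add: power2_eq_square)
  next
    case 4
    have "harm ((k - 1) div 2) \<le> (6881 / 1000 :: real)" by (rule harm_le_of[OF _ harm_values(7)]) (use k in simp)
    moreover have "203 \<le> k" using 4 k by simp
    ultimately show ?thesis using k8 b U r lo
      by (intro num[where ka = 203 and \<Lambda> = "7431/1000" and lo = "78"]) (simp_all add: power2_eq_square)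
  qed
qed

text \<open>
  For even \<open>m\<close> the combinations of the alternating third differences are nonpositive or small, which
  makes up for the weak lower bound of \<open>altsum\<close>.
\<close>

lemma initial_gaps_odd_even:
  assumes k: "k = 2 * m + 1" "even m" "4 \<le> m" "k \<le> 1000"
  shows "initial_gaps k"
proof -
  have lo: "193 / 100 \<le> altsum k" by (rule altsum_odd_even[OF k(1,2,3)])
  have k9: "k \<ge> 9" using k by simp
  define u where "u = sinsum (altsign k) k"
  have b9: "- 1 \<le> u 0" "u 0 \<le> - (8388 / 10000)" "u 1 \<le> 17443 / 10000" "u 2 \<le> - (349 / 1000)"
    using sinsum_odd_bounds(1)[OF k(1), of 9 0 "11/126" "2 * (11/126) / (2 - (11/126)\<^sup>2)"]
      sinsum_odd_bounds(2)[OF k(1), of 9 1 "33/126" "2 * (33/126) / (2 - (33/126)\<^sup>2)"]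
      sinsum_odd_bounds(1)[OF k(1), of 9 2 "55/126" "2 * (55/126) / (2 - (55/126)\<^sup>2)"] k k9
    by (simp_all add: power2_eq_square u_def)
  \<comment> \<open>The index \<open>5\<close> matters from \<open>k = 10\<close> on, and \<open>k = 13\<close> is the next number of this form.\<close>
  have b13: "40 * u 0 + 24 * u 1 + 12 * u 2 + 4 * u 3 \<le> 42 / 10" if k13: "k \<ge> 10"
  proof -
    have "m \<noteq> 5" using k(2) by auto
    hence "m \<ge> 6" using k k13 by linarith
    hence "k \<ge> 13" using k by simp
    hence "u 0 \<le> - (8858 / 10000)" "u 1 \<le> 14521 / 10000" "u 2 \<le> - (5189 / 10000)" "u 3 \<le> 27361 / 10000"
      using sinsum_odd_bounds(1)[OF k(1), of 13 0 "11/182" "2 * (11/182) / (2 - (11/182)\<^sup>2)"]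
        sinsum_odd_bounds(2)[OF k(1), of 13 1 "33/182" "2 * (33/182) / (2 - (33/182)\<^sup>2)"]
        sinsum_odd_bounds(1)[OF k(1), of 13 2 "55/182" "2 * (55/182) / (2 - (55/182)\<^sup>2)"]
        sinsum_odd_bounds(2)[OF k(1), of 13 3 "77/182" "2 * (77/182) / (2 - (77/182)\<^sup>2)"] k \<open>m \<ge> 6\<close>
      by (simp_all add: power2_eq_square u_def)
    thus ?thesis by simp
  qed
  have "harm ((k - 1) div 2) \<le> (6881 / 1000 :: real)" by (rule harm_le_of[OF _ harm_values(7)]) (use k in simp)
  moreover have "(k - 1) div 2 = m" using k by simp
  moreover have "3 - u 0 / altsum k \<le> 352 / 100"
  proof -
    have "- u 0 / altsum k \<le> 1 / (193 / 100)" using b9 lo by (intro frac_le) auto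
    also have "\<dots> \<le> 52 / 100" by simp
    finally show ?thesis by simp
  qed
  ultimately show ?thesis using k9 b9 b13 lo unfolding u_def
    by (intro initial_gaps_numeric[where k = k and Ua = 0 and Ub = 0 and Uc = "42/10" and r = "352/100" and ka = 9 and \<Lambda> = "7431/1000" and lo = "193/100"])
      (simp_all add: power2_eq_square)
qed

lemma initial_gaps_up_to_1000:
  assumes "8 \<le> k" "k \<le> 1000"
  shows "initial_gaps k"
proof (cases "even k")
  case False
  then obtain m where m: "k = 2 * m + 1" by (elim oddE)
  show ?thesis
  proof (cases "even m")
    case True
    thus ?thesis using initial_gaps_odd_even[OF m] m assms by simp
  next
    case False
    have "m \<noteq> 4" using False by auto
    thus ?thesis using initial_gaps_odd_odd[OF m False] m assms by simp
  qed
qed (use initial_gaps_even assms in auto)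

section \<open>Relations between the Newtonian sums\<close>

lemma csum_gap_0_1:
  assumes "k \<ge> 4"
  shows "csum_gap k 0 = 0" "csum_gap k 1 = 0"
proof -
  have "csum one_weight k 1 \<noteq> 0" "csum (altsign k) k 1 \<noteq> 0"
    using csum_plain_pos[of k] csum_alt_pos[of k] assms by auto
  thus "csum_gap k 0 = 0" "csum_gap k 1 = 0" using csum_ratio_rec(1,2) by (simp_all add: csum_gap_def)
qed

text \<open>
  Induction in steps of two from the indices \<open>0, 1\<close> for the sign and from \<open>4, 5\<close> for the size.
\<close>

lemma csum_gap_lower:
  assumes k: "8 \<le> k" "k \<le> 1000" and n: "4 \<le> n" "2 * n \<le> k"
  shows "(5 + max 1 (ctsum_ratio (altsign k) k 1)) / 2 < csum_gap k n" "0 \<le> csum_gap k (n - 1)"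
proof -
  have b: "initial_gaps k" by (rule initial_gaps_up_to_1000[OF k])
  have S: "csum (altsign k) k 1 > 0" using csum_alt_pos k by simp
  have mono: "csum_gap k j \<le> csum_gap k (j + 2)" if "2 * (j + 2) \<le> k" for j
    by (rule csum_gap_mono) (use that k S b in \<open>auto simp: initial_gaps_def\<close>)
  have "0 \<le> csum_gap k j" if "2 * j \<le> k" for j
    using that
  proof (induction j rule: less_induct)
    case (less j)
    show ?case
    proof (cases "j < 2")
      case True
      hence "j = 0 \<or> j = 1" by auto
      thus ?thesis using csum_gap_0_1[of k] k by auto
    next
      case False
      have "csum_gap k (j - 2) \<le> csum_gap k (j - 2 + 2)" by (rule mono) (use less.prems False in auto)
      moreover have "0 \<le> csum_gap k (j - 2)" using less.IH[of "j - 2"] less.prems False by simp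
      moreover have "j - 2 + 2 = j" using False by simp
      ultimately show ?thesis by (simp only:)
    qed
  qed
  thus "0 \<le> csum_gap k (n - 1)" using n by simp
  show "(5 + max 1 (ctsum_ratio (altsign k) k 1)) / 2 < csum_gap k n"
    using n
  proof (induction n rule: less_induct)
    case (less j)
    show ?case
    proof (cases "j < 6")
      case True
      hence "j = 4 \<or> j = 5" using less.prems by auto
      thus ?thesis using b less.prems by (auto simp: initial_gaps_def)
    next
      case False
      have "csum_gap k (j - 2) \<le> csum_gap k (j - 2 + 2)" by (rule mono) (use less.prems False in auto)
      moreover have "(5 + max 1 (ctsum_ratio (altsign k) k 1)) / 2 < csum_gap k (j - 2)"
        using less.IH[of "j - 2"] less.prems False by simp
      moreover have "j - 2 + 2 = j" using False by simp
      ultimately show ?thesis by (simp only:)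
    qed
  qed
qed

lemma altsum_7: "387 / 100 \<le> altsum 7"
proof -
  have "altsum 7 = 2 * (csc_node 7 1 - csc_node 7 2 + csc_node 7 3)"
    using csum_alt_odd(2)[of 7 3] by (simp add: altsum_def eval_nat_numeral)
  moreover have "7 / (22 / 7) \<le> csc_node 7 1"
  proof -
    have "7 / (22 / 7) \<le> 7 / pi" by (rule frac_le) (use pi_approx in auto)
    thus ?thesis using csc_node_bounds(1)[of 1 7] by simp
  qed
  moreover have "1 \<le> csc_node 7 3" using csc_node_bounds(3)[of 3 7] by simp
  moreover have "csc_node 7 2 \<le> 1 / (776 / 1000)"
  proof -
    define x where "x = 2 * pi / 7"
    have x: "897 / 1000 \<le> x" "x \<le> 898 / 1000" using pi_approx by (simp_all add: x_def)
    hence "x ^ 3 \<le> (898 / 1000) ^ 3" by (intro power_mono) auto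
    hence "776 / 1000 \<le> x - x ^ 3 / 6" using x by (simp add: power3_eq_cube)
    also have "\<dots> \<le> sin x" using x by (intro sin_ge_cubic) auto
    finally have "1 / sin x \<le> 1 / (776 / 1000)" by (intro divide_left_mono) auto
    thus ?thesis by (simp add: csc_node_def x_def)
  qed
  ultimately show ?thesis by simp
qed

lemma altsum_even_lower:
  assumes "even k" "k \<ge> 6"
  shows "184 / 100 \<le> altsum k"
proof -
  have p: "pi \<le> 22 / 7" and k6: "6 \<le> real k" using pi_approx assms by simp_all
  have kk: "6 / (22 / 7) \<le> k / pi" by (rule frac_le) (use p k6 in auto)
  have kk': "pi / k \<le> (22 / 7) / 6" by (rule frac_le) (use p k6 in auto)
  have "4 / 3 * (6 / (22 / 7) - 22 / 7 / 6) \<le> 4 / 3 * (k / pi - pi / k)"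
    by (intro mult_left_mono diff_mono kk kk') simp
  thus ?thesis using altsum_even[OF assms] by simp
qed

text \<open>
  Because \<open>sin 3x cos x - 3 sin x cos 3x = 2 sin 2x (1 - cos 2x)\<close>.
\<close>

lemma tan_triple:
  assumes "0 < x" "3 * x < pi / 2"
  shows "3 * tan x < tan (3 * (x::real))"
proof -
  have c: "0 < cos x" "0 < cos (3 * x)" using assms by (auto intro!: cos_gt_zero)
  have s: "0 < sin (2 * x)" using assms by (intro sin_gt_zero) auto
  have c2: "cos (2 * x) < 1" using cos_monotone_0_pi[of 0 "2 * x"] assms by simp
  have e: "sin (3 * x) = sin (2 * x + x)" "cos (3 * x) = cos (2 * x + x)" by (simp_all add: algebra_simps)
  have "sin (3 * x) * cos x - 3 * (sin x * cos (3 * x)) = 2 * sin (2 * x) * (1 - cos (2 * x))"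
    unfolding e sin_add cos_add
    using sin_cos_squared_add[of x] sin_double[of x] cos_double[of x] by algebra
  also have "\<dots> > 0" using s c2 by simp
  finally have "3 * (sin x * cos (3 * x)) < sin (3 * x) * cos x" by simp
  thus ?thesis using c by (simp add: tan_def field_simps)
qed

text \<open>
  Numerical facts for the modes \<open>2\<close> and \<open>3\<close>, in which \<open>s j\<close> is the \<open>j\<close>-th normalized third
  difference of the alternating sums.  The inequation excludes \<open>l = -1\<close> in the mode \<open>2\<close>: there the relation reduces to
  \<open>3 (s 0) - s 1 = 4 (s 0)\<^sup>2\<close>, and the two sides are separated by the sign of the left one, except
  for \<open>k\<close> congruent to \<open>3\<close> modulo \<open>4\<close>, where \<open>s 1\<close> is negative and \<open>s 0 < 3/4\<close>.
\<close>

lemma sinsum_ratio_alt_bounds: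
  fixes k :: nat
  defines "s \<equiv> sinsum_ratio (altsign k) k"
  assumes k: "k \<ge> 4"
  shows "17 / 10 \<le> 3 - 4 * s 0" "- 26 / 100 \<le> s 1" "3 * s 0 - s 1 \<noteq> 4 * (s 0)\<^sup>2"
    "k \<ge> 6 \<Longrightarrow> 12 * s 0 + 4 * s 1 < 8" "k \<ge> 6 \<Longrightarrow> 11 * s 0 + 3 * s 1 - s 2 < 5"
    "k \<ge> 8 \<Longrightarrow> 11 * s 0 + 3 * s 1 - s 2 < 2"
proof -
  define u where "u = sinsum (altsign k) k"
  define S where "S = altsum k"
  have S: "S > 0" unfolding S_def altsum_def by (rule csum_alt_pos[OF k])
  have s: "s j = u j / S" for j by (simp add: s_def u_def S_def sinsum_ratio_alt)
  have goals: "(17 / 10 \<le> 3 - 4 * s 0) = (40 * u 0 \<le> 13 * S)" "(- 26 / 100 \<le> s 1) = (- 26 * S \<le> 100 * u 1)"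
    "(12 * s 0 + 4 * s 1 < 8) = (12 * u 0 + 4 * u 1 < 8 * S)"
    "(11 * s 0 + 3 * s 1 - s 2 < 5) = (11 * u 0 + 3 * u 1 - u 2 < 5 * S)"
    "(11 * s 0 + 3 * s 1 - s 2 < 2) = (11 * u 0 + 3 * u 1 - u 2 < 2 * S)"
  proof -
    have "11 * s 0 + 3 * s 1 - s 2 = (11 * u 0 + 3 * u 1 - u 2) / S"
      by (simp add: s diff_divide_distrib add_divide_distrib)
    thus "(11 * s 0 + 3 * s 1 - s 2 < 5) = (11 * u 0 + 3 * u 1 - u 2 < 5 * S)"
      "(11 * s 0 + 3 * s 1 - s 2 < 2) = (11 * u 0 + 3 * u 1 - u 2 < 2 * S)"
      using S by (simp_all add: pos_divide_less_eq)
  qed (use S in \<open>simp_all add: s field_simps\<close>)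
  have "40 * u 0 \<le> 13 * S \<and> - 26 * S \<le> 100 * u 1 \<and> 3 * s 0 - s 1 \<noteq> 4 * (s 0)\<^sup>2 \<and>
     (k \<ge> 6 \<longrightarrow> 12 * u 0 + 4 * u 1 < 8 * S \<and> 11 * u 0 + 3 * u 1 - u 2 < 5 * S) \<and>
     (k \<ge> 8 \<longrightarrow> 11 * u 0 + 3 * u 1 - u 2 < 2 * S)"
  proof (cases "even k")
    case True
    have u: "u j = tan (half_node k j)" if "2 * j + 1 < k" for j
      unfolding u_def by (rule sinsum_alt_even[OF True that])
    have hn: "half_node k 1 = 3 * half_node k 0" by (simp add: half_node_def)
    have pos: "0 < u 0" "0 < u 1"
      using u[of 0] u[of 1] k half_node_pos[of k] half_node_less[of _ k] by (auto intro!: tan_gt_zero)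
    have "3 * u 0 < u 1"
      using u[of 0] u[of 1] k tan_triple[of "half_node k 0"] half_node_pos[of k 0] half_node_less[of 1 k] hn by simp
    hence "3 * s 0 - s 1 < 0" unfolding s using S by (simp add: field_simps)
    hence ne: "3 * s 0 - s 1 \<noteq> 4 * (s 0)\<^sup>2" using zero_le_power2[of "s 0"] by linarith
    show ?thesis
    proof (cases "k = 4")
      case True
      have "S = 2 * csc_node 4 1 - csc_node 4 2"
        using csum_alt_even[of 4 2] by (simp add: S_def altsum_def True alt_trapezoid_def eval_nat_numeral)
      moreover have "csc_node 4 2 = 1" by (simp add: csc_node_def)
      moreover have "14 / 11 \<le> csc_node 4 1"
      proof -
        have "4 / (22 / 7) \<le> 4 / pi" by (rule frac_le) (use pi_approx in auto)
        thus ?thesis using csc_node_bounds(1)[of 1 4] by simp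
      qed
      ultimately have S4: "S \<ge> 154 / 100" by simp
      have "u 0 \<le> 43 / 100"
        using sinsum_even_bound(2)[OF \<open>even k\<close>, of 4 0 "11/28"] True by (simp add: power2_eq_square u_def)
      thus ?thesis using S4 ne True pos by simp
    next
      case False
      have "k \<noteq> 5" using \<open>even k\<close> by auto
      hence k6: "k \<ge> 6" using k False by linarith
      have S6: "S \<ge> 184 / 100" unfolding S_def by (rule altsum_even_lower[OF \<open>even k\<close> k6])
      have b6: "u 0 \<le> 272 / 1000" "u 1 \<le> 1137 / 1000" "0 < u 2"
        using sinsum_even_bound(2)[OF \<open>even k\<close>, of 6 0 "11/42"] sinsum_even_bound(2)[OF \<open>even k\<close>, of 6 1 "33/42"]
          sinsum_even_bound(1)[OF \<open>even k\<close>, of 6 2 "55/42"] k6 by (simp_all add: power2_eq_square u_def)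
      have "11 * u 0 + 3 * u 1 - u 2 < 2 * S" if k8: "k \<ge> 8"
      proof (cases "k = 8")
        case True
        have "286 / 100 \<le> S" using altsum_8 True by (simp add: S_def)
        moreover have "u 0 \<le> 201 / 1000" "u 1 \<le> 714 / 1000"
          using sinsum_even_bound(2)[OF \<open>even k\<close>, of 8 0 "11/56"] sinsum_even_bound(2)[OF \<open>even k\<close>, of 8 1 "33/56"]
            True by (simp_all add: power2_eq_square u_def)
        ultimately show ?thesis using b6(3) by simp
      next
        case False
        have "k \<noteq> 9" using \<open>even k\<close> by auto
        hence k10: "k \<ge> 10" using k8 False by linarith
        have "38 / 100 * real k \<le> S" unfolding S_def using linear_le_csc_lower[OF k10] altsum_even[OF \<open>even k\<close>] k6 by simp
        thus ?thesis using b6 k10 by simp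
      qed
      thus ?thesis using S6 ne b6 pos by simp
    qed
  next
    case False
    then obtain m where m: "k = 2 * m + 1" by (elim oddE)
    have m2: "m \<ge> 2" using m k by simp
    show ?thesis
    proof (cases "even m")
      case True
      have x: "0 < half_node k 0" "half_node k 0 < pi / 2" "0 < half_node k 1" "half_node k 1 < pi / 2"
        using half_node_pos[of k] half_node_less[of 0 k] half_node_less[of 1 k] k m m2 by auto
      have u0: "u 0 < 0" using sinsum_alt_odd[OF m, of 0] True x tan_gt_zero[of "pi / 4 - half_node k 0 / 2"] by (simp add: u_def)
      have u1: "0 < u 1" using sinsum_alt_odd[OF m, of 1] True x m2 tan_gt_zero[of "pi / 4 + half_node k 1 / 2"] by (simp add: u_def)
      have "3 * u 0 < u 1" using u0 u1 by simp
      hence "3 * s 0 - s 1 < 0" unfolding s using S by (simp add: field_simps)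
      hence ne: "3 * s 0 - s 1 \<noteq> 4 * (s 0)\<^sup>2" using zero_le_power2[of "s 0"] by linarith
      have "12 * u 0 + 4 * u 1 < 8 * S \<and> 11 * u 0 + 3 * u 1 - u 2 < 2 * S" if k6: "k \<ge> 6"
      proof -
        have "m \<noteq> 3" using True by auto
        hence m4: "m \<ge> 4" using m k6 by linarith
        have k9: "k \<ge> 9" using m m4 by simp
        have "u 0 \<le> - (8388 / 10000)" "u 1 \<le> 17443 / 10000" "- 1 \<le> u 2"
          using sinsum_odd_bounds(1)[OF m(1), of 9 0 "11/126" "2 * (11/126) / (2 - (11/126)\<^sup>2)"]
            sinsum_odd_bounds(2)[OF m(1), of 9 1 "33/126" "2 * (33/126) / (2 - (33/126)\<^sup>2)"]
            sinsum_odd_bounds(1)[OF m(1), of 9 2 "55/126" "2 * (55/126) / (2 - (55/126)\<^sup>2)"] True k9 m4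
          by (simp_all add: power2_eq_square u_def)
        moreover have "193 / 100 \<le> S" unfolding S_def by (rule altsum_odd_even[OF m True m4])
        ultimately show ?thesis by simp
      qed
      thus ?thesis using ne u0 u1 S by auto
    next
      case False
      have "m \<noteq> 2" using False by auto
      hence m3: "m \<ge> 3" using m2 by linarith
      have k7: "k \<ge> 7" using m m3 by simp
      have b: "0 < u 0" "u 0 \<le> 12548 / 10000" "- 1 \<le> u 1" "u 1 < 0" "1 \<le> u 2"
      proof -
        show "0 < u 0" "u 0 \<le> 12548 / 10000" "- 1 \<le> u 1" "u 1 < 0"
          using sinsum_odd_bounds(2)[OF m(1), of 7 0 "11/98" "2 * (11/98) / (2 - (11/98)\<^sup>2)"]
            sinsum_odd_bounds(1)[OF m(1), of 7 1 "33/98" "2 * (33/98) / (2 - (33/98)\<^sup>2)"] False k7 m3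
          by (simp_all add: power2_eq_square u_def)
        show "1 \<le> u 2"
          using sinsum_odd_bounds(2)[OF m(1), of 7 2 "55/98" "2 * (55/98) / (2 - (55/98)\<^sup>2)"] False k7 m3
          by (simp add: power2_eq_square u_def)
      qed
      have S7: "387 / 100 \<le> S \<and> (k \<ge> 8 \<longrightarrow> 518 / 100 \<le> S \<and> u 0 \<le> 11543 / 10000 \<and> u 1 \<le> - (6402 / 10000))"
      proof (cases "m = 3")
        case True
        thus ?thesis using altsum_7 m by (simp add: S_def)
      next
        case ne: False
        have "m \<noteq> 4" using False by auto
        hence k11: "k \<ge> 11" using m m3 ne by linarith
        have "38 / 100 * real k + 1 \<le> S" unfolding S_def by (rule altsum_odd_linear[OF m False k11])
        thus ?thesis using odd_small_bounds[OF m False k11] k11 by (simp add: u_def)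
      qed
      have s0: "0 < s 0" "s 0 < 3 / 4" using b S7 S by (simp_all add: s field_simps)
      have s1: "s 1 < 0" using b S by (simp add: s divide_neg_pos)
      have "s 0 * (4 * s 0) < s 0 * 3" using s0 by (intro mult_strict_left_mono) auto
      hence "4 * (s 0)\<^sup>2 < 3 * s 0 - s 1" using s1 by (simp add: power2_eq_square)
      thus ?thesis using b S7 by auto
    qed
  qed
  thus "17 / 10 \<le> 3 - 4 * s 0" "- 26 / 100 \<le> s 1" "3 * s 0 - s 1 \<noteq> 4 * (s 0)\<^sup>2"
    "k \<ge> 6 \<Longrightarrow> 12 * s 0 + 4 * s 1 < 8" "k \<ge> 6 \<Longrightarrow> 11 * s 0 + 3 * s 1 - s 2 < 5"
    "k \<ge> 8 \<Longrightarrow> 11 * s 0 + 3 * s 1 - s 2 < 2" unfolding goals by blast+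
qed

lemma csum_ratio_plain_3_lt_4:
  assumes "k = 6 \<or> k = 7"
  shows "csum_ratio one_weight k 3 < 4"
proof -
  have nz: "csum one_weight k 1 \<noteq> 0" using csum_plain_pos[of k] assms by auto
  define c where "c = 12 * sinsum_ratio one_weight k 0 + 4 * sinsum_ratio one_weight k 1"
  have "5 < c" using assms
  proof
    assume k: "k = 6"
    have "40 / 3 - 3 * (9.87 / (real 6)\<^sup>2) \<le> c * (41 / 20)"
      unfolding c_def by (rule sinsum_ratio_plain_combinations(2)) (use k harm_values(1) step_sq_le[of 6 k] in simp_all)
    thus ?thesis by simp
  next
    assume k: "k = 7"
    have "40 / 3 - 3 * (9.87 / (real 7)\<^sup>2) \<le> c * (2384 / 1000)"
      unfolding c_def by (rule sinsum_ratio_plain_combinations(2)) (use k harm_values(2) step_sq_le[of 7 k] in simp_all)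
    thus ?thesis by simp
  qed
  thus ?thesis unfolding csum_ratio_small(2)[OF nz] c_def by simp
qed

lemma int_square_less_4: "(of_int l)\<^sup>2 < (4::real) \<Longrightarrow> l = - 1 \<or> l = 0 \<or> l = 1"
proof -
  assume "(of_int l)\<^sup>2 < (4::real)"
  hence "of_int (l\<^sup>2) < (of_int 4 :: real)" by simp
  hence "l\<^sup>2 < 2\<^sup>2" unfolding of_int_less_iff by simp
  hence "\<bar>l\<bar> < 2" by (metis abs_numeral abs_square_less_1 power2_less_imp_less abs_ge_zero power2_abs zero_le_numeral)
  thus ?thesis by auto
qed

text \<open>
  The original relation bounds \<open>l\<^sup>2\<close> by \<open>R\<^sub>n/R\<^sub>1\<close>, the conjugate relation bounds it from below by
  almost \<open>S\<^sub>n/S\<^sub>1\<close>.  For \<open>n \<ge> 4\<close> the bounds contradict each other.  For \<open>n = 3\<close> the upper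
  bound is less than \<open>9\<close>, so \<open>l\<^sup>2 \<le> 4\<close> by integrality, and this is too small (for \<open>k = 6, 7\<close> even
  \<open>l\<^sup>2 \<le> 1\<close>).  For \<open>n = 2\<close> only \<open>l = -1, 0, 1\<close> remain; \<open>l = 0, 1\<close> are excluded by size and
  \<open>l = -1\<close> by \<open>sinsum_ratio_alt_bounds\<close>.
\<close>

theorem mode_form_plain_nonzero:
  fixes l :: int
  assumes k: "4 \<le> k" "k \<le> 1000" and n: "2 \<le> n" "2 * n \<le> k"
  shows "mode_form (of_int l) (csum one_weight k 1) (csum one_weight k (n - 1)) (csum one_weight k n) (csum one_weight k (n + 1)) \<noteq> 0"
proof
  assume eq: "mode_form (of_int l) (csum one_weight k 1) (csum one_weight k (n - 1)) (csum one_weight k n) (csum one_weight k (n + 1)) = 0"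
  have nz: "csum one_weight k 1 \<noteq> 0" "csum (altsign k) k 1 \<noteq> 0"
    using csum_plain_pos[of k] csum_alt_pos[of k] k by auto
  define y :: real where "y = (of_int l)\<^sup>2"
  define r s t where "r = csum_ratio one_weight k" and "s = csum_ratio (altsign k) k" and "t = ctsum_ratio (altsign k) k"
  have eqr: "mode_form (of_int l) 1 (r (n - 1)) (r n) (r (n + 1)) = 0"
    using eq mode_form_csum_ratio[OF nz(1)] by (simp add: r_def)
  have eqs: "mode_form (of_int l) 1 (s (n - 1)) (s n) (s (n + 1)) = 0"
    using csum_galois[OF _ eq] mode_form_csum_ratio[OF nz(2)] k by (simp add: s_def)
  have n1: "Suc (n - 1) = n" using n by simp
  have r1: "1 \<le> r n" unfolding r_def by (rule csum_ratio_plain_ge_1) (use k n in auto)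
  have "\<bar>y - 1\<bar> \<le> \<bar>r n - 1\<bar>" unfolding y_def
  proof (rule mode_form_zero_upper[OF _ _ _ eqr])
    show "(r n - 1)\<^sup>2 \<le> r (n - 1) * r (n + 1)" using csum_ratio_cauchy[of k "n - 1"] n1 k by (simp add: r_def)
    show "0 \<le> r (n - 1)" "0 \<le> r (n + 1)" using csum_ratio_plain_nonneg[of k] k by (simp_all add: r_def)
  qed
  hence y: "y \<le> r n" using r1 by simp
  have av: "s (n - 1) + s (n + 1) = 2 * s n + 2 * t n"
    using csum_ratio_rec(4)[OF nz(2), of "n - 1"] n1 by (simp add: s_def t_def)
  have c: "sinsum_ratio one_weight k 0 > 0"
  proof -
    have "0 < half_node k 0" "half_node k 0 < pi / 2" using half_node_pos[of k 0] half_node_less[of 0 k] k by auto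
    thus ?thesis using csum_plain_pos[of k] k by (simp add: sinsum_ratio_plain cot_gt_zero)
  qed
  note q = sinsum_ratio_alt_bounds[OF k(1)]
  consider "n = 2" | "n = 3" | "n \<ge> 4" using n by linarith
  thus False
  proof cases
    case 1
    have "r 2 < 4" using c csum_ratio_small(1)[OF nz(1)] by (simp add: r_def)
    hence "y < 4" using y 1 by simp
    hence l: "l = - 1 \<or> l = 0 \<or> l = 1" unfolding y_def by (rule int_square_less_4)
    define a b where "a = sinsum_ratio (altsign k) k 0" and "b = sinsum_ratio (altsign k) k 1"
    define D where "D = 3 - 4 * a"
    have D: "17 / 10 \<le> D" and b: "- 26 / 100 \<le> b" and ab: "3 * a - b \<noteq> 4 * a\<^sup>2"
      using q(1,2,3) by (simp_all add: D_def a_def b_def)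
    have s: "s 1 = 1" "s 2 = D + 1" "s 3 = 3 * D - 4 * b"
      using csum_ratio_small(1,2)[OF nz(2)] csum_ratio_rec(2)[OF nz(2)] by (simp_all add: s_def D_def a_def b_def)
    have eq2: "(2 * (of_int l + 1)\<^sup>2 + (3 * D - 4 * b)) * (2 * (of_int l - 1)\<^sup>2 + 1) - 9 * D\<^sup>2 = 0"
      using eqs s 1 by (simp add: mode_form_def)
    have DD: "17 / 10 * D \<le> D\<^sup>2" unfolding power2_eq_square using D by (intro mult_right_mono) auto
    from l show False
    proof (elim disjE)
      assume "l = - 1"
      hence "D\<^sup>2 = 3 * D - 4 * b" using eq2 by simp
      hence "3 * a - b = 4 * a\<^sup>2" by (simp add: D_def power2_eq_square algebra_simps)
      thus False using ab by simp
    next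
      assume "l = 0"
      thus False using eq2 D DD b by simp
    next
      assume "l = 1"
      thus False using eq2 D DD b by simp
    qed
  next
    case 2
    hence k6: "k \<ge> 6" using n by simp
    have low: "s 3 \<le> y + 5 / 2 + t 3 / 2" unfolding y_def
    proof (rule mode_form_zero_lower)
      show "mode_form (of_int l) 1 (s 2) (s 3) (s 4) = 0" using eqs 2 by simp
      show "0 \<le> s 2" using csum_ratio_small(1)[OF nz(2)] q(1) by (simp add: s_def)
      show "1 < s 3" using csum_ratio_small(2)[OF nz(2)] q(4)[OF k6] by (simp add: s_def)
      show "s 2 + s 4 = 2 * s 3 + 2 * t 3" using av 2 by simp
    qed
    define Q where "Q = 11 * sinsum_ratio (altsign k) k 0 + 3 * sinsum_ratio (altsign k) k 1 - sinsum_ratio (altsign k) k 2"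
    have low': "6 - Q \<le> y" using low csum_ratio_small(2,6)[OF nz(2)] unfolding s_def t_def Q_def by linarith
    have "r 3 < 9" using c csum_ratio_small(2)[OF nz(1)] sinsum_ratio_plain_nonneg[of k 1] k6 by (simp add: r_def)
    have sq: "y \<le> 4" if "y < 9"
    proof -
      have "of_int (l\<^sup>2) < (of_int 9 :: real)" using that by (simp add: y_def)
      hence "l\<^sup>2 < 3\<^sup>2" unfolding of_int_less_iff by simp
      hence "\<bar>l\<bar> < 3" by (metis abs_ge_zero power2_abs power2_less_imp_less zero_le_numeral)
      hence "\<bar>of_int l\<bar> \<le> (2::real)" by linarith
      hence "\<bar>of_int l :: real\<bar>\<^sup>2 \<le> 2\<^sup>2" by (intro power_mono) auto
      thus ?thesis by (simp add: y_def)
    qed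
    show False
    proof (cases "k \<ge> 8")
      case True
      have "Q < 2" unfolding Q_def by (rule q(6)[OF True])
      thus False using low' sq y \<open>r 3 < 9\<close> 2 by simp
    next
      case False
      hence "k = 6 \<or> k = 7" using k6 by auto
      hence "y < 4" using csum_ratio_plain_3_lt_4[of k] y 2 by (simp add: r_def)
      hence "l = - 1 \<or> l = 0 \<or> l = 1" unfolding y_def by (rule int_square_less_4)
      hence "y \<le> 1" unfolding y_def by auto
      moreover have "Q < 5" unfolding Q_def by (rule q(5)[OF k6])
      ultimately show False using low' by simp
    qed
  next
    case 3
    have k8: "k \<ge> 8" using 3 n by simp
    note g = csum_gap_lower[OF k8 k(2) 3 n(2)]
    have sn: "s n = r n + csum_gap k n" "s (n - 1) = r (n - 1) + csum_gap k (n - 1)" by (simp_all add: s_def r_def csum_gap_def)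
    have "s n \<le> y + 5 / 2 + t n / 2" unfolding y_def
    proof (rule mode_form_zero_lower[OF eqs _ _ av])
      show "0 \<le> s (n - 1)" using sn(2) g(2) csum_ratio_plain_nonneg[of k "n - 1"] k by (simp add: r_def)
      show "1 < s n" using sn(1) g(1) r1 by simp
    qed
    moreover have "t n \<le> max 1 (t 1)" unfolding t_def
      by (rule ctsum_ratio_alt_le) (use csum_alt_pos k n in auto)
    ultimately show False using sn(1) g(1) y by (simp add: t_def)
  qed
qed

section \<open>The Hessian of the amended potential\<close>

definition collision_free :: "nat \<Rightarrow> real config \<Rightarrow> bool" where
  "collision_free k u \<longleftrightarrow> (\<forall>i\<in>{1..k}. \<forall>j\<in>{1..k}. i \<noteq> j \<longrightarrow> u i \<noteq> u j)"

text \<open>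
  The gradient of \<open>phi \<alpha> (norm d)\<close>.  At \<open>d = 0\<close> it is \<open>0\<close>, as is \<open>phi \<alpha> 0\<close>, because
  \<open>0 powr x = 0\<close>; so sums over pairs may include the diagonal.
\<close>

definition pair_force :: "real \<Rightarrow> real^2 \<Rightarrow> real^2" where
  "pair_force \<alpha> d = - ((norm d powr (- \<alpha> - 1)) *\<^sub>R d)"

text \<open>
  The derivative of \<open>pair_force \<alpha>\<close> at \<open>d\<close> in the direction \<open>w\<close>.
\<close>

definition pair_hess :: "real \<Rightarrow> real^2 \<Rightarrow> real^2 \<Rightarrow> real^2" where
  "pair_hess \<alpha> d w = ((\<alpha> + 1) * norm d powr (- \<alpha> - 3) * (d \<bullet> w)) *\<^sub>R d - (norm d powr (- \<alpha> - 1)) *\<^sub>R w"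

text \<open>
  The line along which \<open>partial\<close> differentiates.
\<close>

definition shifted :: "real config \<Rightarrow> nat \<Rightarrow> real^2 \<Rightarrow> real \<Rightarrow> real config" where
  "shifted u i e t = u(i := u i + t *\<^sub>R e)"

lemma shifted_eq: "shifted u i e t j = u j + t *\<^sub>R (if j = i then e else 0)"
  by (simp add: shifted_def)

lemma pair_force_minus: "pair_force \<alpha> (- d) = - pair_force \<alpha> d"
  by (simp add: pair_force_def)

lemma norm_powr_inner: "norm (d::real^2) powr s = (d \<bullet> d) powr (s / 2)"
proof -
  have "norm d = (d \<bullet> d) powr (1/2)" by (simp add: norm_eq_sqrt_inner powr_half_sqrt)
  thus ?thesis by (simp add: powr_powr)
qed

lemma norm_powr_deriv:
  fixes d w :: "real^2"
  assumes "d \<noteq> 0"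
  shows "((\<lambda>t. norm (d + t *\<^sub>R w) powr s) has_real_derivative s * norm d powr (s - 2) * (d \<bullet> w)) (at 0)"
proof -
  have p: "d \<bullet> d > 0" using assms by simp
  have "((\<lambda>t. ((d + t *\<^sub>R w) \<bullet> (d + t *\<^sub>R w)) powr (s / 2)) has_real_derivative
      (s / 2) * (d \<bullet> d) powr (s / 2 - 1) * (2 * (d \<bullet> w))) (at 0)"
  proof -
    have 1: "((\<lambda>t. (d + t *\<^sub>R w) \<bullet> (d + t *\<^sub>R w)) has_real_derivative 2 * (d \<bullet> w)) (at 0)"
      by (auto intro!: derivative_eq_intros simp: has_field_derivative_def inner_commute algebra_simps fun_eq_iff)
    show ?thesis
      by (rule DERIV_chain2[where f = "\<lambda>z. z powr (s / 2)", OF _ 1]) (use has_real_derivative_powr[OF p, of "s / 2"] in simp)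
  qed
  moreover have "(d \<bullet> d) powr (s / 2 - 1) = norm d powr (s - 2)"
    by (simp add: norm_powr_inner diff_divide_distrib)
  ultimately show ?thesis unfolding norm_powr_inner[of _ s] by (simp add: mult.assoc)
qed

text \<open>
  The alternative \<open>w = 0\<close> is the diagonal term, where the function is constant.
\<close>

lemma phi_deriv:
  fixes d w :: "real^2"
  assumes "d \<noteq> 0 \<or> w = 0" and a: "\<alpha> \<noteq> 1"
  shows "((\<lambda>t. phi \<alpha> (norm (d + t *\<^sub>R w))) has_real_derivative pair_force \<alpha> d \<bullet> w) (at 0)"
proof (cases "d = 0")
  case True
  thus ?thesis using assms by simp
next
  case False
  have "((\<lambda>t. norm (d + t *\<^sub>R w) powr (1 - \<alpha>) / (\<alpha> - 1)) has_real_derivative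
     ((1 - \<alpha>) * norm d powr ((1 - \<alpha>) - 2) * (d \<bullet> w)) / (\<alpha> - 1)) (at 0)"
    by (intro DERIV_cdivide norm_powr_deriv False)
  moreover have "((1 - \<alpha>) * norm d powr ((1 - \<alpha>) - 2) * (d \<bullet> w)) / (\<alpha> - 1) = pair_force \<alpha> d \<bullet> w"
  proof -
    have "1 - \<alpha> - 2 = - \<alpha> - 1" by simp
    hence e: "norm d powr (1 - \<alpha> - 2) = norm d powr (- \<alpha> - 1)" by (rule arg_cong)
    have "((1 - \<alpha>) * norm d powr ((1 - \<alpha>) - 2) * (d \<bullet> w)) / (\<alpha> - 1)
       = (1 - \<alpha>) / (\<alpha> - 1) * (norm d powr (- \<alpha> - 1) * (d \<bullet> w))" unfolding e by (simp only: times_divide_eq_left mult.assoc)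
    also have "(1 - \<alpha>) / (\<alpha> - 1) = - 1" using a by (simp add: field_simps)
    finally show ?thesis by (simp add: pair_force_def)
  qed
  ultimately show ?thesis unfolding phi_def by simp
qed

lemma pair_force_deriv:
  fixes d w :: "real^2"
  assumes "d \<noteq> 0 \<or> w = 0"
  shows "((\<lambda>t. pair_force \<alpha> (d + t *\<^sub>R w) $ q) has_real_derivative pair_hess \<alpha> d w $ q) (at 0)"
proof (cases "d = 0")
  case True
  thus ?thesis using assms by (simp add: pair_hess_def)
next
  case False
  have "((\<lambda>t. (norm (d + t *\<^sub>R w) powr (- \<alpha> - 1)) * (d $ q + t * w $ q)) has_real_derivative
     ((- \<alpha> - 1) * norm d powr ((- \<alpha> - 1) - 2) * (d \<bullet> w)) * (d $ q) + norm d powr (- \<alpha> - 1) * w $ q) (at 0)"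
    by (rule DERIV_mult'[OF norm_powr_deriv[OF False, of w "- \<alpha> - 1"], THEN DERIV_cong])
       (auto intro!: derivative_eq_intros)
  from DERIV_minus[OF this] show ?thesis
    by (simp add: pair_force_def pair_hess_def algebra_simps)
qed

text \<open>
  The sum over all ordered pairs is easier to differentiate than the one over \<open>i < j\<close>.
\<close>

lemma V_symmetric: "V \<alpha> k u = (1/2) * (\<Sum>j=1..k. (norm (u j))\<^sup>2) + (1/2) * (\<Sum>i=1..k. \<Sum>j=1..k. phi \<alpha> (norm (u j - u i)))"
proof -
  define f where "f i j = phi \<alpha> (norm (u j - u i))" for i j
  have sym: "f i j = f j i" for i j by (simp add: f_def norm_minus_commute)
  have diag: "f i i = 0" for i by (simp add: f_def phi_def)
  have "(\<Sum>i=1..k. \<Sum>j=1..k. f i j) = 2 * (\<Sum>i=1..k. \<Sum>j\<in>{i<..k}. f i j)"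
  proof (induction k)
    case (Suc k)
    have "(\<Sum>j\<in>{i<..Suc k}. f i j) = (\<Sum>j\<in>{i<..k}. f i j) + f i (Suc k)" if "i \<in> {1..k}" for i
    proof -
      have "{i<..Suc k} = insert (Suc k) {i<..k}" using that by auto
      thus ?thesis by simp
    qed
    hence "(\<Sum>i=1..Suc k. \<Sum>j\<in>{i<..Suc k}. f i j) = (\<Sum>i=1..k. \<Sum>j\<in>{i<..k}. f i j) + (\<Sum>i=1..k. f i (Suc k))"
      by (simp add: sum.distrib)
    moreover have "(\<Sum>i=1..Suc k. \<Sum>j=1..Suc k. f i j) = (\<Sum>i=1..k. \<Sum>j=1..k. f i j) + 2 * (\<Sum>i=1..k. f i (Suc k))"
      using sym[of _ "Suc k"] by (simp add: sum.distrib diag)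
    ultimately show ?case using Suc.IH by simp
  qed simp
  thus ?thesis unfolding V_def f_def by simp
qed

lemma V_deriv:
  assumes cf: "collision_free k u" and i: "i \<in> {1..k}" and a: "\<alpha> \<noteq> 1"
  shows "((\<lambda>t. V \<alpha> k (shifted u i e t)) has_real_derivative (u i + (\<Sum>l=1..k. pair_force \<alpha> (u i - u l))) \<bullet> e) (at 0)"
proof -
  define \<delta> where "\<delta> j = (if j = i then e else 0)" for j
  have n: "((\<lambda>t. (norm (u j + t *\<^sub>R \<delta> j))\<^sup>2) has_real_derivative 2 * (u j \<bullet> \<delta> j)) (at 0)" for j
    unfolding power2_norm_eq_inner
    by (auto intro!: derivative_eq_intros simp: has_field_derivative_def inner_commute algebra_simps fun_eq_iff)
  have p: "((\<lambda>t. phi \<alpha> (norm ((u j + t *\<^sub>R \<delta> j) - (u l + t *\<^sub>R \<delta> l)))) has_real_derivative pair_force \<alpha> (u j - u l) \<bullet> (\<delta> j - \<delta> l)) (at 0)"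
    if "l \<in> {1..k}" "j \<in> {1..k}" for j l
  proof -
    have "u j - u l \<noteq> 0 \<or> \<delta> j - \<delta> l = 0" using cf that by (cases "j = l") (auto simp: collision_free_def)
    from phi_deriv[OF this a] show ?thesis by (simp add: algebra_simps)
  qed
  have "((\<lambda>t. V \<alpha> k (shifted u i e t)) has_real_derivative
     (1/2) * (\<Sum>j=1..k. 2 * (u j \<bullet> \<delta> j)) + (1/2) * (\<Sum>l=1..k. \<Sum>j=1..k. pair_force \<alpha> (u j - u l) \<bullet> (\<delta> j - \<delta> l))) (at 0)"
    unfolding V_symmetric shifted_eq \<delta>_def[symmetric]
    by (intro DERIV_add DERIV_cmult DERIV_sum n p)
  moreover have "(\<Sum>l=1..k. \<Sum>j=1..k. pair_force \<alpha> (u j - u l) \<bullet> (\<delta> j - \<delta> l)) = 2 * (\<Sum>j=1..k. \<Sum>l=1..k. pair_force \<alpha> (u j - u l) \<bullet> \<delta> j)"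
  proof -
    have "(\<Sum>l=1..k. \<Sum>j=1..k. pair_force \<alpha> (u j - u l) \<bullet> (\<delta> j - \<delta> l))
       = (\<Sum>l=1..k. \<Sum>j=1..k. pair_force \<alpha> (u j - u l) \<bullet> \<delta> j) - (\<Sum>l=1..k. \<Sum>j=1..k. pair_force \<alpha> (u j - u l) \<bullet> \<delta> l)"
      by (simp add: inner_diff_right sum_subtractf)
    also have "(\<Sum>l=1..k. \<Sum>j=1..k. pair_force \<alpha> (u j - u l) \<bullet> \<delta> l) = - (\<Sum>l=1..k. \<Sum>j=1..k. pair_force \<alpha> (u l - u j) \<bullet> \<delta> l)"
    proof -
      have "pair_force \<alpha> (u j - u l) \<bullet> \<delta> l = - (pair_force \<alpha> (u l - u j) \<bullet> \<delta> l)" for j l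
        using pair_force_minus[of \<alpha> "u l - u j"] by (simp only: minus_diff_eq inner_minus_left)
      thus ?thesis by (simp only: sum_negf)
    qed
    also have "(\<Sum>l=1..k. \<Sum>j=1..k. pair_force \<alpha> (u j - u l) \<bullet> \<delta> j) = (\<Sum>j=1..k. \<Sum>l=1..k. pair_force \<alpha> (u j - u l) \<bullet> \<delta> j)"
      by (rule sum.swap)
    finally show ?thesis by simp
  qed
  moreover have "(\<Sum>j=1..k. 2 * (u j \<bullet> \<delta> j)) = 2 * (u i \<bullet> e)"
    using i by (simp add: \<delta>_def if_distrib[of "\<lambda>x. 2 * (_ \<bullet> x)"] cong: if_cong)
  moreover have "(\<Sum>j=1..k. \<Sum>l=1..k. pair_force \<alpha> (u j - u l) \<bullet> \<delta> j) = (\<Sum>l=1..k. pair_force \<alpha> (u i - u l)) \<bullet> e"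
  proof -
    have "(\<Sum>l=1..k. pair_force \<alpha> (u j - u l) \<bullet> \<delta> j) = (if j = i then (\<Sum>l=1..k. pair_force \<alpha> (u i - u l)) \<bullet> e else 0)" for j
      by (simp add: \<delta>_def inner_sum_left)
    thus ?thesis using i by simp
  qed
  ultimately show ?thesis by (simp add: inner_add_left)
qed

lemma partial_V:
  assumes "collision_free k u" "i \<in> {1..k}" "\<alpha> \<noteq> 1"
  shows "partial i q (V \<alpha> k) u = u i $ q + (\<Sum>l=1..k. pair_force \<alpha> (u i - u l) $ q)"
  using DERIV_imp_deriv[OF V_deriv[OF assms, of "axis q 1"]]
  by (simp add: partial_def shifted_def inner_axis sum_component)

lemma eventually_collision_free:
  assumes "collision_free k u"
  shows "\<forall>\<^sub>F t in nhds 0. collision_free k (shifted u j e t)"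
proof -
  have "\<forall>\<^sub>F t in nhds 0. shifted u j e t i \<noteq> shifted u j e t l" if "i \<in> {1..k}" "l \<in> {1..k}" "i \<noteq> l" for i l
  proof -
    have "((\<lambda>t. shifted u j e t i - shifted u j e t l) \<longlongrightarrow> shifted u j e 0 i - shifted u j e 0 l) (nhds 0)"
      unfolding shifted_eq by (rule continuous_on_tendsto_compose[where s=UNIV, OF _ filterlim_ident]) (auto intro!: continuous_intros)
    moreover have "shifted u j e 0 i - shifted u j e 0 l \<noteq> 0" using assms that by (simp add: shifted_eq collision_free_def)
    ultimately have "\<forall>\<^sub>F t in nhds 0. shifted u j e t i - shifted u j e t l \<noteq> 0" by (rule tendsto_imp_eventually_ne)
    thus ?thesis by eventually_elim simp
  qed
  hence "\<forall>\<^sub>F t in nhds 0. \<forall>i\<in>{1..k}. \<forall>l\<in>{1..k}. i \<noteq> l \<longrightarrow> shifted u j e t i \<noteq> shifted u j e t l"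
    by (intro eventually_ball_finite ballI) (auto simp: eventually_conj_iff)
  thus ?thesis by (simp add: collision_free_def)
qed

text \<open>
  The formula for the first partial derivatives holds at all collision-free configurations, hence in a
  neighborhood, and may be differentiated again.
\<close>

lemma second_partial_V:
  assumes cf: "collision_free k u" and i: "i \<in> {1..k}" and a: "\<alpha> \<noteq> 1"
  shows "partial j p (partial i q (V \<alpha> k)) u = (if i = j then axis p 1 else 0) $ q +
     (\<Sum>l=1..k. pair_hess \<alpha> (u i - u l) ((if i = j then axis p 1 else 0) - (if l = j then axis p 1 else 0)) $ q)"
proof -
  define \<delta> :: "nat \<Rightarrow> real^2" where "\<delta> l = (if l = j then axis p 1 else 0)" for l
  have s: "shifted u j (axis p 1) t l = u l + t *\<^sub>R \<delta> l" for l t by (simp add: shifted_eq \<delta>_def)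
  have d: "((\<lambda>t. pair_force \<alpha> ((u i + t *\<^sub>R \<delta> i) - (u l + t *\<^sub>R \<delta> l)) $ q) has_real_derivative pair_hess \<alpha> (u i - u l) (\<delta> i - \<delta> l) $ q) (at 0)"
    if "l \<in> {1..k}" for l
  proof -
    have "u i - u l \<noteq> 0 \<or> \<delta> i - \<delta> l = 0" using cf that i by (cases "i = l") (auto simp: collision_free_def)
    from pair_force_deriv[OF this] show ?thesis by (simp add: algebra_simps)
  qed
  have "partial j p (partial i q (V \<alpha> k)) u = deriv (\<lambda>t. partial i q (V \<alpha> k) (shifted u j (axis p 1) t)) 0"
    by (simp add: partial_def[of j] shifted_def)
  also have "\<dots> = deriv (\<lambda>t. (u i + t *\<^sub>R \<delta> i) $ q + (\<Sum>l=1..k. pair_force \<alpha> ((u i + t *\<^sub>R \<delta> i) - (u l + t *\<^sub>R \<delta> l)) $ q)) 0"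
    by (rule deriv_cong_ev[OF eventually_mono[OF eventually_collision_free[OF cf, of j "axis p 1"]] refl])
       (simp add: partial_V[OF _ i a] s)
  also have "\<dots> = \<delta> i $ q + (\<Sum>l=1..k. pair_hess \<alpha> (u i - u l) (\<delta> i - \<delta> l) $ q)"
  proof (rule DERIV_imp_deriv, intro DERIV_add DERIV_sum d)
    show "((\<lambda>t. (u i + t *\<^sub>R \<delta> i) $ q) has_real_derivative \<delta> i $ q) (at 0)"
      by (auto intro!: derivative_eq_intros)
  qed
  finally show ?thesis by (simp add: \<delta>_def)
qed

text \<open>
  Translation invariance of the pair interaction: only differences of displacements occur in it.
\<close>

lemma hessV_eq:
  assumes cf: "collision_free k u" and j: "j \<in> {1..k}" and a: "\<alpha> \<noteq> 1"
  shows "hessV \<alpha> k u w j $ p = w j $ p + (\<Sum>l=1..k. \<Sum>q\<in>UNIV. of_real (pair_hess \<alpha> (u j - u l) (axis p 1) $ q) * (w j $ q - w l $ q))"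
proof -
  define A where "A i l q = pair_hess \<alpha> (u i - u l) (axis p 1) $ q" for i l q
  have Asym: "A i l q = A l i q" for i l q
  proof -
    have "pair_hess \<alpha> (- d) e = pair_hess \<alpha> d e" for d e by (simp add: pair_hess_def)
    from this[of "u i - u l"] show ?thesis by (simp add: A_def)
  qed
  have A: "pair_hess \<alpha> (u i - u l) ((if i = j then axis p 1 else 0) - (if l = j then axis p 1 else 0)) $ q
     = (if i = j then A i l q else 0) - (if l = j then A i l q else 0)" for i l q
    by (simp add: A_def pair_hess_def algebra_simps inner_diff_right)
  have "hessV \<alpha> k u w j $ p = (\<Sum>i=1..k. \<Sum>q\<in>UNIV. of_real (partial j p (partial i q (V \<alpha> k)) u) * w i $ q)"
    using j by (simp add: hessV_def)
  also have "\<dots> = (\<Sum>i=1..k. \<Sum>q\<in>UNIV. (if i = j then (if p = q then w i $ q else 0) else 0) +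
      ((if i = j then (\<Sum>l=1..k. of_real (A i l q) * w i $ q) else 0) - of_real (A i j q) * w i $ q))"
  proof (intro sum.cong refl)
    fix i q assume i: "i \<in> {1..k}"
    have "(\<Sum>l=1..k. (if i = j then A i l q else 0) - (if l = j then A i l q else 0)) = (if i = j then (\<Sum>l=1..k. A i l q) else 0) - A i j q"
      using j by (simp add: sum_subtractf)
    hence "partial j p (partial i q (V \<alpha> k)) u = (if i = j then axis p 1 else 0) $ q + ((if i = j then (\<Sum>l=1..k. A i l q) else 0) - A i j q)"
      unfolding second_partial_V[OF cf i a] A by simp
    hence "complex_of_real (partial j p (partial i q (V \<alpha> k)) u) = (if i = j \<and> p = q then 1 else 0)
        + ((if i = j then (\<Sum>l=1..k. of_real (A i l q)) else 0) - of_real (A i j q))" by (simp add: axis_def)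
    thus "of_real (partial j p (partial i q (V \<alpha> k)) u) * w i $ q = (if i = j then (if p = q then w i $ q else 0) else 0) +
      ((if i = j then (\<Sum>l=1..k. of_real (A i l q) * w i $ q) else 0) - of_real (A i j q) * w i $ q)"
      by (simp add: left_diff_distrib distrib_right sum_distrib_right)
  qed
  also have "\<dots> = w j $ p + (\<Sum>q\<in>UNIV. \<Sum>l=1..k. of_real (A j l q) * w j $ q) - (\<Sum>i=1..k. \<Sum>q\<in>UNIV. of_real (A i j q) * w i $ q)"
  proof -
    have "(\<Sum>i=1..k. \<Sum>q\<in>UNIV. if i = j then (if p = q then w i $ q else 0) else 0) = w j $ p"
      using j by (subst sum.swap) (simp add: sum.delta)
    moreover have "(\<Sum>i=1..k. \<Sum>q\<in>UNIV. if i = j then (\<Sum>l=1..k. of_real (A i l q) * w i $ q) else 0)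
        = (\<Sum>q\<in>UNIV. \<Sum>l=1..k. of_real (A j l q) * w j $ q)"
      using j by (subst sum.swap) (simp add: sum.delta)
    ultimately show ?thesis by (simp add: sum.distrib sum_subtractf)
  qed
  also have "(\<Sum>q\<in>UNIV. \<Sum>l=1..k. of_real (A j l q) * w j $ q) = (\<Sum>l=1..k. \<Sum>q\<in>UNIV. of_real (A j l q) * w j $ q)"
    by (rule sum.swap)
  finally show ?thesis using Asym[of _ j] by (simp add: A_def[symmetric] sum_subtractf right_diff_distrib)
qed

section \<open>The polygon\<close>

text \<open>
  The matrices \<open>a + b J\<close> multiply like complex numbers, so the power series splits into those of cosine
  and sine.
\<close>

lemma mat_exp_rotation:
  "mat_exp (x *\<^sub>R Jmat) *v axis 1 1 = vector [cos x, sin x]"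
proof -
  define A :: "real^2^2" where "A = x *\<^sub>R Jmat"
  define p :: "nat \<Rightarrow> real^2^2" where "p n = ((\<lambda>B. A ** B) ^^ n) (mat 1)" for n
  define M :: "real \<Rightarrow> real \<Rightarrow> real^2^2" where "M a b = vector [vector [a, - b], vector [b, a]]" for a b
  have A: "A = M 0 x"
    by (simp add: A_def M_def Jmat_def vec_eq_iff forall_2 vector_2)
  have M: "M a b ** M c d = M (a * c - b * d) (a * d + b * c)" for a b c d
    by (simp add: M_def matrix_matrix_mult_def vec_eq_iff forall_2 vector_2 sum_2 algebra_simps)
  have mat1: "mat 1 = M 1 0"
    by (simp add: M_def mat_def vec_eq_iff forall_2 vector_2)
  have p: "p n /\<^sub>R fact n = M (cos_coeff n * x ^ n) (sin_coeff n * x ^ n)" for n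
  proof (induction n)
    case 0
    thus ?case by (simp add: p_def mat1)
  next
    case (Suc n)
    have sc: "r *\<^sub>R M a b = M (r * a) (r * b)" for r a b
      by (simp add: M_def vec_eq_iff forall_2 vector_2)
    have "p n = fact n *\<^sub>R (p n /\<^sub>R fact n)" by simp
    also have "\<dots> = M (fact n * (cos_coeff n * x ^ n)) (fact n * (sin_coeff n * x ^ n))"
      unfolding Suc.IH sc ..
    finally have pn: "p n = \<dots>" .
    have "p (Suc n) = A ** p n" by (simp add: p_def)
    also have "\<dots> = M (fact n * (- sin_coeff n * x ^ Suc n)) (fact n * (cos_coeff n * x ^ Suc n))"
      unfolding pn A M by (simp add: mult_ac)
    finally have "p (Suc n) = M (fact n * (- sin_coeff n * x ^ Suc n)) (fact n * (cos_coeff n * x ^ Suc n))" .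
    moreover have "inverse (fact (Suc n)) * (fact n * y) = y / Suc n" for y :: real
      by (simp add: divide_simps)
    ultimately show ?case by (simp only: sc) (simp add: cos_coeff_Suc sin_coeff_Suc)
  qed
  have "(\<lambda>n. M (cos_coeff n * x ^ n) (sin_coeff n * x ^ n)) sums M (cos x) (sin x)"
    unfolding sums_def
  proof (intro vec_tendstoI)
    fix i j
    have s: "(\<Sum>n<N. M (cos_coeff n * x ^ n) (sin_coeff n * x ^ n)) = M (\<Sum>n<N. cos_coeff n * x ^ n) (\<Sum>n<N. sin_coeff n * x ^ n)" for N
      by (simp add: M_def vec_eq_iff forall_2 vector_2 sum_component sum_negf)
    have c: "(\<lambda>N. \<Sum>n<N. cos_coeff n * x ^ n) \<longlonglongrightarrow> cos x" "(\<lambda>N. \<Sum>n<N. sin_coeff n * x ^ n) \<longlonglongrightarrow> sin x"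
      using cos_converges[of x] sin_converges[of x] by (simp_all add: sums_def)
    show "(\<lambda>N. (\<Sum>n<N. M (cos_coeff n * x ^ n) (sin_coeff n * x ^ n)) $ i $ j) \<longlonglongrightarrow> M (cos x) (sin x) $ i $ j"
      unfolding s using exhaust_2[of i] exhaust_2[of j]
      by (auto simp: M_def vector_2 intro: c tendsto_minus[OF c(2)])
  qed
  hence "mat_exp A = M (cos x) (sin x)"
    unfolding mat_exp_def p_def[symmetric] p by (rule sums_unique[symmetric])
  thus ?thesis unfolding A_def
    by (simp add: M_def matrix_vector_mult_def vec_eq_iff forall_2 vector_2 sum_2 axis_def)
qed

definition radius :: "real \<Rightarrow> nat \<Rightarrow> real" where
  "radius \<alpha> k = s1 \<alpha> k powr (1 / (\<alpha> + 1))"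

lemma s1_pos:
  assumes "k \<ge> 2"
  shows "s1 \<alpha> k > 0"
proof -
  have "sin (real j * (2 * pi / real k) / 2) > 0" if "j \<in> {1..k-1}" for j
  proof (rule sin_gt_zero)
    show "0 < real j * (2 * pi / real k) / 2" using that assms by simp
    have "real j < real k" using that by auto
    thus "real j * (2 * pi / real k) / 2 < pi" using assms by (simp add: field_simps)
  qed
  hence "(\<Sum>j=1..k-1. 1 / sin (real j * (2 * pi / real k) / 2) powr (\<alpha> - 1)) > 0"
    using assms by (intro sum_pos) (auto intro!: divide_pos_pos simp: less_imp_neq[symmetric])
  thus ?thesis by (simp add: s1_def)
qed

lemma radius_pos: "k \<ge> 2 \<Longrightarrow> radius \<alpha> k > 0"
  using s1_pos[of k \<alpha>] by (simp add: radius_def)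

lemma radius_powr: "k \<ge> 2 \<Longrightarrow> \<alpha> + 1 \<noteq> 0 \<Longrightarrow> radius \<alpha> k powr (- (\<alpha> + 1)) = 1 / s1 \<alpha> k"
proof -
  assume k: "k \<ge> 2" and "\<alpha> + 1 \<noteq> 0"
  hence e: "1 / (\<alpha> + 1) * (- (\<alpha> + 1)) = - 1" by (simp add: divide_simps)
  show ?thesis unfolding radius_def powr_powr e using s1_pos[OF k, of \<alpha>] by (simp add: powr_minus_divide)
qed

lemma polygon_eq:
  "j \<in> {1..k} \<Longrightarrow> polygon \<alpha> k j = radius \<alpha> k *\<^sub>R vector [cos (real j * (2 * pi / real k)), sin (real j * (2 * pi / real k))]"
  by (simp add: polygon_def mat_exp_rotation radius_def)

abbreviation point :: "real^2 \<Rightarrow> complex" where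
  "point d \<equiv> Complex (d $ 1) (d $ 2)"

section \<open>Complex coordinates and Fourier coefficients\<close>

text \<open>
  The eigencoordinates of \<open>J\<close>; the second one is not the conjugate of the first, since \<open>w\<close> is a
  complex vector.
\<close>

definition xco :: "complex^2 \<Rightarrow> complex" where "xco w = w $ 1 + \<i> * w $ 2"
definition yco :: "complex^2 \<Rightarrow> complex" where "yco w = w $ 1 - \<i> * w $ 2"

lemma co_eq_iff: "v = w \<longleftrightarrow> xco v = xco w \<and> yco v = yco w"
proof
  assume a: "xco v = xco w \<and> yco v = yco w"
  have "2 * v $ 1 = xco v + yco v" "2 * w $ 1 = xco w + yco w" "2 * \<i> * v $ 2 = xco v - yco v" "2 * \<i> * w $ 2 = xco w - yco w"
    by (simp_all add: xco_def yco_def)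
  hence "2 * v $ 1 = 2 * w $ 1" "2 * \<i> * v $ 2 = 2 * \<i> * w $ 2" using a by simp_all
  thus "v = w" by (simp add: vec_eq_iff forall_2)
qed simp

text \<open>
  Powers of \<open>exp(2\<pi>\<i>/k)\<close>, with integer exponents for the negative frequencies.
\<close>

definition rootk :: "nat \<Rightarrow> int \<Rightarrow> complex" where
  "rootk k m = cis (of_int m * (2 * pi / real k))"

lemma rootk_add: "rootk k (a + b) = rootk k a * rootk k b"
  by (simp add: rootk_def cis_mult) (simp add: ring_distribs add_divide_distrib)

lemma rootk_0 [simp]: "rootk k 0 = 1"
  by (simp add: rootk_def)

lemma rootk_k: "k > 0 \<Longrightarrow> rootk k (int k * m) = 1"
proof -
  assume "k > 0"
  hence "of_int (int k * m) * (2 * pi / real k) = 2 * pi * of_int m" by simp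
  thus ?thesis by (simp only: rootk_def cis_multiple_2pi Ints_of_int)
qed

lemma rootk_uminus: "rootk k (- m) = cnj (rootk k m)"
  by (simp add: rootk_def cis_cnj)

lemma rootk_power: "rootk k (m * int t) = rootk k m ^ t"
proof -
  have "of_int (m * int t) * (2 * pi / real k) = real t * (of_int m * (2 * pi / real k))" by simp
  thus ?thesis by (simp only: rootk_def Complex.DeMoivre)
qed

lemma rootk_eq_1_iff:
  assumes "k > 0"
  shows "rootk k m = 1 \<longleftrightarrow> int k dvd m"
proof
  assume "rootk k m = 1"
  hence "cos (of_int m * (2 * pi / real k)) = 1" by (metis rootk_def cis.simps(1) one_complex.sel(1))
  then obtain n where "of_int m * (2 * pi / real k) = of_int n * 2 * pi" using cos_one_2pi_int by blast
  hence "of_int m = of_int n * real k" using assms by (simp add: field_simps)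
  hence "of_int m = (of_int (n * int k) :: real)" by simp
  hence "m = n * int k" by (simp only: of_int_eq_iff)
  thus "int k dvd m" by simp
next
  assume "int k dvd m"
  thus "rootk k m = 1" using rootk_k[OF assms] by (elim dvdE) simp
qed

lemma sum_rootk:
  assumes "k > 0"
  shows "(\<Sum>t<k. rootk k (m * int t)) = (if int k dvd m then of_nat k else 0)"
proof (cases "int k dvd m")
  case True
  hence "rootk k m = 1" using rootk_eq_1_iff[OF assms] by simp
  thus ?thesis using True by (simp add: rootk_power)
next
  case False
  hence ne: "rootk k m \<noteq> 1" using rootk_eq_1_iff[OF assms] by simp
  have "rootk k m ^ k = 1" using rootk_k[OF assms, of m] by (simp add: rootk_power[symmetric] mult.commute)
  thus ?thesis using False ne by (simp add: rootk_power geometric_sum)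
qed

text \<open>
  Advancing \<open>j\<close> by one exchanges one summand for another one that differs by a full period.
\<close>

lemma sum_periodic_shift:
  fixes f :: "int \<Rightarrow> 'a :: ab_group_add"
  assumes per: "\<And>x. f (x + int k) = f x"
  shows "(\<Sum>l=1..k. f (int j - int l)) = (\<Sum>d<k. f (int d))"
proof (induction j)
  case 0
  have "(\<Sum>l=1..k. f (int 0 - int l)) = (\<Sum>l=1..k. f (int (k - l)))"
  proof (intro sum.cong refl)
    fix l assume "l \<in> {1..k}"
    hence "int (k - l) = - int l + int k" by (simp add: of_nat_diff)
    thus "f (int 0 - int l) = f (int (k - l))" using per[of "- int l"] by simp
  qed
  also have "\<dots> = (\<Sum>d<k. f (int d))"
    by (rule sum.reindex_bij_witness[of _ "\<lambda>d. k - d" "\<lambda>l. k - l"]) auto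
  finally show ?case .
next
  case (Suc j)
  have "(\<Sum>l=1..k. f (int (Suc j) - int l)) = (\<Sum>l<k. f (int j - int l))"
    by (rule sum.reindex_bij_witness[of _ Suc "\<lambda>l. l - 1"]) (auto simp: algebra_simps)
  also have "\<dots> + f (int j - int k) = (\<Sum>l<Suc k. f (int j - int l))" by simp
  also have "\<dots> = f (int j - 0) + (\<Sum>l<k. f (int j - int (Suc l)))"
    unfolding sum.lessThan_Suc_shift by simp
  also have "(\<Sum>l<k. f (int j - int (Suc l))) = (\<Sum>l=1..k. f (int j - int l))"
    by (rule sum.reindex_bij_witness[of _ "\<lambda>l. l - 1" Suc]) auto
  finally have "(\<Sum>l=1..k. f (int (Suc j) - int l)) + f (int j - int k) = f (int j) + (\<Sum>l=1..k. f (int j - int l))" by simp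
  moreover have "f (int j - int k) = f (int j)" using per[of "int j - int k"] by simp
  ultimately have "(\<Sum>l=1..k. f (int (Suc j) - int l)) = (\<Sum>l=1..k. f (int j - int l))"
    by (simp add: add.commute)
  thus ?case using Suc.IH by simp
qed

lemma sum_rootk_1k:
  assumes "k > 0"
  shows "(\<Sum>t=1..k. rootk k (m * int t)) = (if int k dvd m then of_nat k else 0)"
proof -
  have per: "rootk k (- m * (x + int k)) = rootk k (- m * x)" for x
    using rootk_add[of k "- m * x" "int k * (- m)"] rootk_k[OF assms, of "- m"] by (simp add: algebra_simps)
  have "(\<Sum>t=1..k. rootk k (- m * (int 0 - int t))) = (\<Sum>t<k. rootk k (- m * int t))"
    by (rule sum_periodic_shift[of "\<lambda>x. rootk k (- m * x)", OF per])
  thus ?thesis using sum_rootk[OF assms, of "- m"] by simp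
qed

text \<open>
  The shifts by \<open>1\<close> and, in \<open>yhat\<close>, by \<open>-1\<close> compensate the rotation of the coordinate frame along
  the polygon; with them the Hessian couples only \<open>xhat k w n\<close> and \<open>yhat k w n\<close> of the same \<open>n\<close>.
\<close>

definition xhat :: "nat \<Rightarrow> complex config \<Rightarrow> int \<Rightarrow> complex" where
  "xhat k w n = (\<Sum>j=1..k. rootk k (- (n + 1) * int j) * xco (w j)) / of_nat k"

definition yhat :: "nat \<Rightarrow> complex config \<Rightarrow> int \<Rightarrow> complex" where
  "yhat k w n = (\<Sum>j=1..k. rootk k (- (n - 1) * int j) * yco (w j)) / of_nat k"

text \<open>
  Fourier inversion: the character sum over \<open>n\<close> singles out \<open>f l\<close>.
\<close>

lemma fourier_unique:
  fixes f :: "nat \<Rightarrow> complex"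
  assumes k: "k > 0" and z: "\<And>n. n < k \<Longrightarrow> (\<Sum>j=1..k. rootk k (- (int n + c) * int j) * f j) = 0" and l: "l \<in> {1..k}"
  shows "f l = 0"
proof -
  have "0 = (\<Sum>n<k. rootk k ((int n + c) * int l) * (\<Sum>j=1..k. rootk k (- (int n + c) * int j) * f j))"
    using z by simp
  also have "\<dots> = (\<Sum>n<k. \<Sum>j=1..k. rootk k (c * (int l - int j)) * f j * rootk k ((int l - int j) * int n))"
    unfolding sum_distrib_left
  proof (intro sum.cong refl)
    fix n j
    have F: "rootk k ((int n + c) * int l) * rootk k (- (int n + c) * int j) = rootk k (c * (int l - int j)) * rootk k ((int l - int j) * int n)"
      unfolding rootk_add[symmetric] by (rule arg_cong[of _ _ "rootk k"]) (simp add: algebra_simps)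
    have "rootk k ((int n + c) * int l) * (rootk k (- (int n + c) * int j) * f j) = rootk k (c * (int l - int j)) * f j * rootk k ((int l - int j) * int n)"
      (is "?a * (?b * ?f) = ?c * ?f * ?d")
    proof -
      have "?a * (?b * ?f) = (?a * ?b) * ?f" by (simp only: mult.assoc)
      also have "\<dots> = (?c * ?d) * ?f" by (simp only: F)
      finally show ?thesis by (simp only: mult_ac)
    qed
    thus "rootk k ((int n + c) * int l) * (rootk k (- (int n + c) * int j) * f j) = rootk k (c * (int l - int j)) * f j * rootk k ((int l - int j) * int n)" .
  qed
  also have "\<dots> = (\<Sum>j=1..k. \<Sum>n<k. rootk k (c * (int l - int j)) * f j * rootk k ((int l - int j) * int n))"
    by (rule sum.swap)
  also have "\<dots> = (\<Sum>j=1..k. rootk k (c * (int l - int j)) * f j * (if j = l then of_nat k else 0))"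
  proof (intro sum.cong refl)
    fix j assume j: "j \<in> {1..k}"
    have "int k dvd (int l - int j) \<longleftrightarrow> j = l"
    proof
      assume "int k dvd (int l - int j)"
      moreover have "\<bar>int l - int j\<bar> < int k" using j l by auto
      ultimately have "int l - int j = 0" by (metis abs_of_nat dvd_imp_le_int linorder_not_less)
      thus "j = l" by simp
    qed simp
    thus "(\<Sum>n<k. rootk k (c * (int l - int j)) * f j * rootk k ((int l - int j) * int n)) = rootk k (c * (int l - int j)) * f j * (if j = l then of_nat k else 0)"
      using sum_rootk[OF k, of "int l - int j"] by (simp add: sum_distrib_left[symmetric])
  qed
  also have "\<dots> = of_nat k * f l" using l by (simp add: if_distrib cong: if_cong)
  finally show ?thesis using k by simp
qed

lemma fourier_exists:
  fixes g :: "nat \<Rightarrow> complex"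
  assumes k: "k > 0"
  shows "\<exists>f. \<forall>n<k. (\<Sum>j=1..k. rootk k (- (int n + c) * int j) * f j) / of_nat k = g n"
proof -
  define f where "f j = (\<Sum>m<k. g m * rootk k ((int m + c) * int j))" for j :: nat
  have "(\<Sum>j=1..k. rootk k (- (int n + c) * int j) * f j) / of_nat k = g n" if n: "n < k" for n
  proof -
    have "(\<Sum>j=1..k. rootk k (- (int n + c) * int j) * f j) = (\<Sum>j=1..k. \<Sum>m<k. g m * rootk k ((int m - int n) * int j))"
      unfolding f_def sum_distrib_left
    proof (intro sum.cong refl)
      fix j m
      have "rootk k (- (int n + c) * int j) * rootk k ((int m + c) * int j) = rootk k ((int m - int n) * int j)"
        unfolding rootk_add[symmetric] by (rule arg_cong[of _ _ "rootk k"]) (simp add: algebra_simps)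
      thus "rootk k (- (int n + c) * int j) * (g m * rootk k ((int m + c) * int j)) = g m * rootk k ((int m - int n) * int j)"
        by (simp only: mult.left_commute)
    qed
    also have "\<dots> = (\<Sum>m<k. g m * (\<Sum>j=1..k. rootk k ((int m - int n) * int j)))"
      by (subst sum.swap) (simp add: sum_distrib_left)
    also have "\<dots> = (\<Sum>m<k. g m * (if m = n then of_nat k else 0))"
    proof (intro sum.cong refl)
      fix m assume m: "m \<in> {..<k}"
      have "int k dvd (int m - int n) \<longleftrightarrow> m = n"
      proof
        assume "int k dvd (int m - int n)"
        moreover have "\<bar>int m - int n\<bar> < int k" using m n by auto
        ultimately have "int m - int n = 0" by (metis abs_of_nat dvd_imp_le_int linorder_not_less)
        thus "m = n" by simp
      qed simp
      thus "g m * (\<Sum>j=1..k. rootk k ((int m - int n) * int j)) = g m * (if m = n then of_nat k else 0)"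
        using sum_rootk_1k[OF k, of "int m - int n"] by simp
    qed
    also have "\<dots> = of_nat k * g n" using n by (simp add: if_distrib cong: if_cong)
    finally show ?thesis using k by simp
  qed
  thus ?thesis by blast
qed

lemma config_eq_of_hat:
  assumes k: "k > 0" and h: "\<And>n. n < k \<Longrightarrow> xhat k v (int n) = xhat k w (int n) \<and> yhat k v (int n) = yhat k w (int n)"
    and z: "\<And>j. j \<notin> {1..k} \<Longrightarrow> v j = w j"
  shows "v = w"
proof
  fix j
  show "v j = w j"
  proof (cases "j \<in> {1..k}")
    case True
    have "xco (v j) - xco (w j) = 0"
    proof (rule fourier_unique[OF k _ True, of 1])
      fix n assume "n < k"
      hence "xhat k v (int n) = xhat k w (int n)" using h by blast
      thus "(\<Sum>j=1..k. rootk k (- (int n + 1) * int j) * (xco (v j) - xco (w j))) = 0"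
        using k unfolding xhat_def right_diff_distrib sum_subtractf by simp
    qed
    moreover have "yco (v j) - yco (w j) = 0"
    proof (rule fourier_unique[OF k _ True, of "- 1"])
      fix n assume "n < k"
      hence "yhat k v (int n) = yhat k w (int n)" using h by blast
      thus "(\<Sum>j=1..k. rootk k (- (int n + - 1) * int j) * (yco (v j) - yco (w j))) = 0"
        using k unfolding yhat_def right_diff_distrib sum_subtractf by simp
    qed
    ultimately show ?thesis by (simp add: co_eq_iff)
  qed (rule z)
qed

lemma config_of_hat:
  assumes k: "k > 0"
  obtains w where "\<And>n. n < k \<Longrightarrow> xhat k w (int n) = g n" "\<And>n. n < k \<Longrightarrow> yhat k w (int n) = h n" "\<And>j. j \<notin> {1..k} \<Longrightarrow> w j = 0"
proof -
  obtain x where x: "\<And>n. n < k \<Longrightarrow> (\<Sum>j=1..k. rootk k (- (int n + 1) * int j) * x j) / of_nat k = g n"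
    using fourier_exists[OF k, of 1 g] by blast
  obtain y where y: "\<And>n. n < k \<Longrightarrow> (\<Sum>j=1..k. rootk k (- (int n + - 1) * int j) * y j) / of_nat k = h n"
    using fourier_exists[OF k, of "- 1" h] by blast
  define w :: "complex config" where "w j = (if j \<in> {1..k} then vector [(x j + y j) / 2, (x j - y j) / (2 * \<i>)] else 0)" for j
  have "xco (w j) = x j" "yco (w j) = y j" if "j \<in> {1..k}" for j
    using that by (simp_all add: w_def xco_def yco_def vector_2 field_simps)
  hence "xhat k w n = (\<Sum>j=1..k. rootk k (- (n + 1) * int j) * x j) / of_nat k"
    "yhat k w n = (\<Sum>j=1..k. rootk k (- (n + - 1) * int j) * y j) / of_nat k" for n
    by (simp_all add: xhat_def yhat_def)
  thus thesis using x y by (intro that[of w]) (simp_all only: w_def if_False)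
qed

section \<open>The Hessian in Fourier coefficients\<close>

text \<open>
  The value of \<open>r powr (- \<alpha> - 1)\<close> at the distance \<open>r\<close> of two vertices whose indices differ by \<open>d\<close>.  The
  convention \<open>0 powr x = 0\<close> makes it vanish at \<open>d = 0\<close>.
\<close>

definition weight :: "real \<Rightarrow> nat \<Rightarrow> int \<Rightarrow> real" where
  "weight \<alpha> k d = (2 * \<bar>sin (of_int d * pi / real k)\<bar>) powr (- (\<alpha> + 1)) / s1 \<alpha> k"

definition wsum :: "real \<Rightarrow> nat \<Rightarrow> int \<Rightarrow> real" where
  "wsum \<alpha> k m = (\<Sum>d<k. weight \<alpha> k (int d) * cos (of_int m * of_int (int d) * (2 * pi / real k)))"

text \<open>
  Equal to \<open>\<Sum>\<^sub>d weight \<alpha> k d (1 - cos (2\<pi>m d/k))\<close>.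
\<close>

definition stiffness :: "real \<Rightarrow> nat \<Rightarrow> int \<Rightarrow> real" where
  "stiffness \<alpha> k m = wsum \<alpha> k 0 - wsum \<alpha> k m"

lemma weight_periodic: "k > 0 \<Longrightarrow> weight \<alpha> k (d + int k) = weight \<alpha> k d"
  by (simp add: weight_def add_divide_distrib distrib_right)

lemma weight_minus: "weight \<alpha> k (- d) = weight \<alpha> k d"
  by (simp add: weight_def)

lemma wsum_minus: "wsum \<alpha> k (- m) = wsum \<alpha> k m"
  by (simp add: wsum_def)

text \<open>
  The weights are even, so the sum equals its conjugate.
\<close>

lemma weight_transform:
  assumes k: "k > 0"
  shows "(\<Sum>d<k. of_real (weight \<alpha> k (int d)) * rootk k (m * int d)) = of_real (wsum \<alpha> k m)"
proof -
  define f where "f x = of_real (weight \<alpha> k x) * rootk k (m * x)" for x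
  have per: "f (x + int k) = f x" for x
    using rootk_add[of k "m * x" "int k * m"] rootk_k[OF k, of m]
    by (simp add: f_def weight_periodic[OF k] algebra_simps)
  have per': "f (- (x + int k)) = f (- x)" for x
    using per[of "- x - int k"] by simp
  have "\<And>N. (\<Sum>l=1..N. f (int l)) + f 0 = (\<Sum>d<N. f (int d)) + f (int N)"
    subgoal for N by (induction N) (simp_all add: algebra_simps)
    done
  from this[of k] have "(\<Sum>l=1..k. f (int l)) + f 0 = (\<Sum>d<k. f (int d)) + f (int k)" .
  moreover have "f (int k) = f 0" using per[of 0] by simp
  ultimately have "(\<Sum>d<k. f (int d)) = (\<Sum>l=1..k. f (- (int 0 - int l)))" by simp
  also have "\<dots> = (\<Sum>d<k. f (- int d))" by (rule sum_periodic_shift[of "\<lambda>x. f (- x)", OF per'])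
  also have "\<dots> = cnj (\<Sum>d<k. f (int d))"
    by (simp add: f_def weight_minus rootk_uminus[symmetric])
  finally have "(\<Sum>d<k. f (int d)) = cnj (\<Sum>d<k. f (int d))" .
  hence "Im (\<Sum>d<k. f (int d)) = Im (cnj (\<Sum>d<k. f (int d)))" by (rule arg_cong)
  hence "Im (\<Sum>d<k. f (int d)) = 0" unfolding cnj.simps(2) by linarith
  moreover have "Re (\<Sum>d<k. f (int d)) = wsum \<alpha> k m"
    by (simp add: f_def wsum_def rootk_def Re_sum mult.assoc)
  ultimately show ?thesis by (simp add: complex_eq_iff f_def)
qed

text \<open>
  Summation over \<open>l\<close> gives the Fourier coefficient of the even periodic weight.
\<close>

lemma convolution_left:
  assumes k: "k > 0"
  shows "(\<Sum>j=1..k. \<Sum>l=1..k. rootk k (a * int j + b * int l) * of_real (weight \<alpha> k (int j - int l)) * F j)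
     = of_real (wsum \<alpha> k b) * (\<Sum>j=1..k. rootk k ((a + b) * int j) * F j)"
  unfolding sum_distrib_left
proof (intro sum.cong refl)
  fix j
  define f where "f x = of_real (weight \<alpha> k x) * rootk k (- b * x)" for x
  have per: "f (x + int k) = f x" for x
    using rootk_add[of k "- b * x" "int k * - b"] rootk_k[OF k, of "- b"]
    by (simp add: f_def weight_periodic[OF k] algebra_simps)
  have "(\<Sum>l=1..k. rootk k (a * int j + b * int l) * of_real (weight \<alpha> k (int j - int l)) * F j)
     = (\<Sum>l=1..k. rootk k ((a + b) * int j) * F j * f (int j - int l))"
  proof (intro sum.cong refl)
    fix l
    have "rootk k (a * int j + b * int l) = rootk k ((a + b) * int j) * rootk k (- b * (int j - int l))"
      unfolding rootk_add[symmetric] by (rule arg_cong[of _ _ "rootk k"]) (simp add: algebra_simps)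
    thus "rootk k (a * int j + b * int l) * of_real (weight \<alpha> k (int j - int l)) * F j = rootk k ((a + b) * int j) * F j * f (int j - int l)"
      by (simp only: f_def mult_ac)
  qed
  also have "\<dots> = rootk k ((a + b) * int j) * F j * (\<Sum>d<k. f (int d))"
    unfolding sum_distrib_left[symmetric] sum_periodic_shift[of f, OF per] ..
  also have "(\<Sum>d<k. f (int d)) = of_real (wsum \<alpha> k b)"
    unfolding f_def weight_transform[OF k] wsum_minus ..
  finally show "(\<Sum>l=1..k. rootk k (a * int j + b * int l) * of_real (weight \<alpha> k (int j - int l)) * F j)
    = of_real (wsum \<alpha> k b) * (rootk k ((a + b) * int j) * F j)" by (simp only: mult_ac)
qed

lemma convolution_right:
  assumes k: "k > 0"
  shows "(\<Sum>j=1..k. \<Sum>l=1..k. rootk k (a * int j + b * int l) * of_real (weight \<alpha> k (int j - int l)) * F l)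
     = of_real (wsum \<alpha> k a) * (\<Sum>l=1..k. rootk k ((a + b) * int l) * F l)"
proof -
  have "(\<Sum>j=1..k. \<Sum>l=1..k. rootk k (a * int j + b * int l) * of_real (weight \<alpha> k (int j - int l)) * F l)
      = (\<Sum>l=1..k. \<Sum>j=1..k. rootk k (b * int l + a * int j) * of_real (weight \<alpha> k (int l - int j)) * F l)"
    by (subst sum.swap) (simp only: weight_minus[of \<alpha> k "int _ - int _", unfolded minus_diff_eq] add.commute)
  also have "\<dots> = of_real (wsum \<alpha> k a) * (\<Sum>l=1..k. rootk k ((b + a) * int l) * F l)"
    by (rule convolution_left[OF k])
  finally show ?thesis by (simp only: add.commute)
qed

lemma point_polygon: "j \<in> {1..k} \<Longrightarrow> point (polygon \<alpha> k j) = of_real (radius \<alpha> k) * rootk k (int j)"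
  by (simp add: polygon_eq rootk_def complex_eq_iff)

lemma cmod_rootk_diff: "cmod (rootk k a - rootk k b) = 2 * \<bar>sin (of_int (a - b) * pi / real k)\<bar>"
proof -
  define x y where "x = of_int a * (2 * pi / real k)" and "y = of_int b * (2 * pi / real k)"
  have xy: "x - y = 2 * (of_int (a - b) * pi / real k)"
  proof -
    have "x = 2 * (of_int a * pi / real k)" "y = 2 * (of_int b * pi / real k)" by (simp_all add: x_def y_def)
    thus ?thesis by (simp only: of_int_diff left_diff_distrib diff_divide_distrib right_diff_distrib)
  qed
  have "(cmod (rootk k a - rootk k b))\<^sup>2 = (cos x - cos y)\<^sup>2 + (sin x - sin y)\<^sup>2"
    by (simp add: rootk_def cmod_power2 x_def y_def)
  also have "\<dots> = 2 - 2 * cos (x - y)"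
    using sin_cos_squared_add[of x] sin_cos_squared_add[of y]
    by (simp add: cos_diff power2_diff algebra_simps)
  also have "\<dots> = (2 * \<bar>sin (of_int (a - b) * pi / real k)\<bar>)\<^sup>2"
    unfolding xy cos_double_sin by (simp add: power_mult_distrib)
  finally show ?thesis by (rule power2_eq_imp_eq) simp_all
qed

lemma norm_point: "norm d = cmod (point d)"
  by (simp add: norm_vec_def L2_set_def sum_2 cmod_def)

lemma norm_polygon_diff:
  assumes "j \<in> {1..k}" "l \<in> {1..k}"
  shows "norm (polygon \<alpha> k j - polygon \<alpha> k l) = \<bar>radius \<alpha> k\<bar> * (2 * \<bar>sin (of_int (int j - int l) * pi / real k)\<bar>)"
proof -
  have "point (polygon \<alpha> k j - polygon \<alpha> k l) = of_real (radius \<alpha> k) * (rootk k (int j) - rootk k (int l))"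
    using point_polygon[OF assms(1), of \<alpha>] point_polygon[OF assms(2), of \<alpha>]
    by (simp add: complex_eq_iff algebra_simps)
  thus ?thesis unfolding norm_point by (simp add: norm_mult cmod_rootk_diff)
qed

lemma polygon_collision_free:
  assumes "k \<ge> 2"
  shows "collision_free k (polygon \<alpha> k)"
  unfolding collision_free_def
proof (intro ballI impI notI)
  fix i j assume ij: "i \<in> {1..k}" "j \<in> {1..k}" "i \<noteq> j" "polygon \<alpha> k i = polygon \<alpha> k j"
  hence "rootk k (int i) = rootk k (int j)"
    using point_polygon[OF ij(1), of \<alpha>] point_polygon[OF ij(2), of \<alpha>] radius_pos[OF assms, of \<alpha>] by simp
  hence "rootk k (int i - int j) = 1"
    using rootk_add[of k "int i" "- int j"] rootk_add[of k "int j" "- int j"] by simp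
  hence "int k dvd int i - int j" using rootk_eq_1_iff[of k] assms by simp
  moreover have "\<bar>int i - int j\<bar> < int k" using ij by auto
  ultimately have "int i - int j = 0" by (metis abs_of_nat dvd_imp_le_int linorder_not_less)
  thus False using ij by simp
qed

lemma norm_polygon_powr:
  assumes k: "k \<ge> 2" and a: "\<alpha> + 1 \<noteq> 0" and j: "j \<in> {1..k}" "l \<in> {1..k}"
  shows "norm (polygon \<alpha> k j - polygon \<alpha> k l) powr (- \<alpha> - 1) = weight \<alpha> k (int j - int l)"
proof -
  have "- \<alpha> - 1 = - (\<alpha> + 1)" by simp
  thus ?thesis
    unfolding norm_polygon_diff[OF j] weight_def using radius_pos[OF k, of \<alpha>] radius_powr[OF k a]
    by (simp add: powr_mult)
qed

text \<open>
  In complex notation \<open>z = z\<^sub>1 + \<i> z\<^sub>2\<close> for the chord \<open>d\<close>, the map \<open>w \<mapsto> (d \<bullet> w) d\<close> has the coordinate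
  \<open>z (cnj z x + z y)/2\<close>.  A chord \<open>z = r (u - v)\<close> with \<open>\<bar>u\<bar> = \<bar>v\<bar> = 1\<close> satisfies \<open>z\<^sup>2 = - \<bar>z\<bar>\<^sup>2 u v\<close>, which produces the
  product of the two roots of unity.
\<close>

lemma pair_hess_polygon:
  assumes k: "k \<ge> 2" and a: "\<alpha> + 1 \<noteq> 0" and j: "j \<in> {1..k}" "l \<in> {1..k}"
  fixes W :: "complex^2"
  defines "d \<equiv> polygon \<alpha> k j - polygon \<alpha> k l" and "N \<equiv> complex_of_real (weight \<alpha> k (int j - int l))"
  defines "B \<equiv> (\<chi> p. \<Sum>q\<in>UNIV. of_real (pair_hess \<alpha> d (axis p 1) $ q) * W $ q)"
  shows "xco B = N * (of_real ((\<alpha> - 1) / 2) * xco W - of_real ((\<alpha> + 1) / 2) * rootk k (int j + int l) * yco W)"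
    "yco B = N * (of_real ((\<alpha> - 1) / 2) * yco W - of_real ((\<alpha> + 1) / 2) * rootk k (- int j - int l) * xco W)"
proof -
  define z where "z = point d"
  define N' where "N' = complex_of_real (norm d powr (- \<alpha> - 3))"
  have N: "N = complex_of_real (norm d powr (- \<alpha> - 1))"
    unfolding N_def d_def norm_polygon_powr[OF k a j] ..
  have zz: "z * cnj z = of_real ((norm d)\<^sup>2)"
    unfolding z_def norm_point by (rule complex_norm_square[symmetric])
  have NN: "N = N' * (z * cnj z)"
  proof (cases "d = 0")
    case True
    thus ?thesis by (simp add: N N'_def)
  next
    case False
    hence "norm d powr (- \<alpha> - 1) = norm d powr (- \<alpha> - 3) * norm d powr 2"
      unfolding powr_add[symmetric] by (intro arg_cong[where f = "(powr) (norm d)"]) simp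
    thus ?thesis unfolding zz N N'_def using False by (simp add: powr_numeral)
  qed
  have z: "z = of_real (radius \<alpha> k) * (rootk k (int j) - rootk k (int l))"
    using point_polygon[OF j(1), of \<alpha>] point_polygon[OF j(2), of \<alpha>]
    by (simp add: z_def d_def complex_eq_iff algebra_simps)
  have u: "rootk k (int i) * cnj (rootk k (int i)) = 1" for i
    using rootk_add[of k "int i" "- int i"] by (simp add: rootk_uminus)
  have z2: "z * z = - (z * cnj z) * (rootk k (int j) * rootk k (int l))"
    unfolding z using u[of j] u[of l] by (simp, algebra)
  have z2': "cnj z * cnj z = - (z * cnj z) * cnj (rootk k (int j) * rootk k (int l))"
    using arg_cong[OF z2, of cnj] by (simp add: mult_ac)
  have comp: "pair_hess \<alpha> d (axis p 1) $ q = (\<alpha> + 1) * norm d powr (- \<alpha> - 3) * d $ p * d $ q - norm d powr (- \<alpha> - 1) * (if p = q then 1 else 0)" for p q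
  proof -
    have "d \<bullet> axis p 1 = d $ p" by (simp add: inner_axis)
    moreover have "axis p (1::real) $ q = (if p = q then 1 else 0)" by (simp add: axis_def)
    ultimately show ?thesis by (simp add: pair_hess_def)
  qed
  have Re: "of_real (d $ 1) = (z + cnj z) / 2" "of_real (d $ 2) = (z - cnj z) / (2 * \<i>)"
    by (simp_all add: z_def complex_eq_iff)
  have dW: "of_real (d $ 1) * W $ 1 + of_real (d $ 2) * W $ 2 = (cnj z * xco W + z * yco W) / 2"
    unfolding Re xco_def yco_def by (simp add: field_simps)
  define E where "E = (cnj z * xco W + z * yco W) / 2"
  have B: "B $ p = of_real (\<alpha> + 1) * N' * of_real (d $ p) * E - N * W $ p" for p
    unfolding E_def dW[symmetric] using exhaust_2[of p] by (auto simp: B_def comp N N'_def sum_2 algebra_simps)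
  have zd: "of_real (d $ 1) + \<i> * of_real (d $ 2) = z" "of_real (d $ 1) - \<i> * of_real (d $ 2) = cnj z"
    by (simp_all add: z_def complex_eq_iff)
  have "xco B = of_real (\<alpha> + 1) * N' * (of_real (d $ 1) + \<i> * of_real (d $ 2)) * E - N * xco W"
    unfolding xco_def[of B] B xco_def[of W] by (simp add: algebra_simps)
  also have "\<dots> = of_real (\<alpha> + 1) / 2 * ((N' * (z * cnj z)) * xco W + N' * (z * z) * yco W) - N * xco W"
    unfolding zd E_def by (simp add: field_simps)
  also have "\<dots> = N * (of_real ((\<alpha> - 1) / 2) * xco W - of_real ((\<alpha> + 1) / 2) * (rootk k (int j) * rootk k (int l)) * yco W)"
    unfolding z2 by (simp add: NN field_simps)
  finally show "xco B = N * (of_real ((\<alpha> - 1) / 2) * xco W - of_real ((\<alpha> + 1) / 2) * rootk k (int j + int l) * yco W)"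
    unfolding rootk_add .
  have "yco B = of_real (\<alpha> + 1) * N' * (of_real (d $ 1) - \<i> * of_real (d $ 2)) * E - N * yco W"
    unfolding yco_def[of B] B yco_def[of W] by (simp add: algebra_simps)
  also have "\<dots> = of_real (\<alpha> + 1) / 2 * ((N' * (z * cnj z)) * yco W + N' * (cnj z * cnj z) * xco W) - N * yco W"
    unfolding zd E_def by (simp add: field_simps)
  also have "\<dots> = N * (of_real ((\<alpha> - 1) / 2) * yco W - of_real ((\<alpha> + 1) / 2) * cnj (rootk k (int j) * rootk k (int l)) * xco W)"
    unfolding z2' by (simp add: NN field_simps)
  also have "cnj (rootk k (int j) * rootk k (int l)) = rootk k (- int j - int l)"
    unfolding rootk_add[symmetric] rootk_uminus[symmetric] by simp
  finally show "yco B = N * (of_real ((\<alpha> - 1) / 2) * yco W - of_real ((\<alpha> + 1) / 2) * rootk k (- int j - int l) * xco W)" .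
qed

lemma xco_add: "xco (v + w) = xco v + xco w" and yco_add: "yco (v + w) = yco v + yco w"
  and xco_diff: "xco (v - w) = xco v - xco w" and yco_diff: "yco (v - w) = yco v - yco w"
  and xco_scale: "xco (c *s v) = c * xco v" and yco_scale: "yco (c *s v) = c * yco v"
  and xco_0 [simp]: "xco 0 = 0" and yco_0 [simp]: "yco 0 = 0"
  by (simp_all add: xco_def yco_def algebra_simps)

lemma xco_sum: "xco (sum f A) = (\<Sum>a\<in>A. xco (f a))" and yco_sum: "yco (sum f A) = (\<Sum>a\<in>A. yco (f a))"
  by (simp_all add: xco_def yco_def sum.distrib sum_subtractf sum_distrib_left sum_component)

lemma hessV_polygon:
  assumes k: "k \<ge> 2" and a: "\<alpha> > 1" and j: "j \<in> {1..k}"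
  shows "xco (hessV \<alpha> k (polygon \<alpha> k) w j) = xco (w j) + (\<Sum>l=1..k. of_real (weight \<alpha> k (int j - int l)) *
       (of_real ((\<alpha> - 1) / 2) * (xco (w j) - xco (w l)) - of_real ((\<alpha> + 1) / 2) * rootk k (int j + int l) * (yco (w j) - yco (w l))))"
    "yco (hessV \<alpha> k (polygon \<alpha> k) w j) = yco (w j) + (\<Sum>l=1..k. of_real (weight \<alpha> k (int j - int l)) *
       (of_real ((\<alpha> - 1) / 2) * (yco (w j) - yco (w l)) - of_real ((\<alpha> + 1) / 2) * rootk k (- int j - int l) * (xco (w j) - xco (w l))))"
proof -
  have h: "hessV \<alpha> k (polygon \<alpha> k) w j = w j + (\<Sum>l=1..k. (\<chi> p. \<Sum>q\<in>UNIV.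
      of_real (pair_hess \<alpha> (polygon \<alpha> k j - polygon \<alpha> k l) (axis p 1) $ q) * (w j - w l) $ q))"
    using hessV_eq[OF polygon_collision_free[OF k] j, of \<alpha> \<alpha> w] a by (simp add: vec_eq_iff sum_component)
  have a1: "\<alpha> + 1 \<noteq> 0" using a by simp
  show "xco (hessV \<alpha> k (polygon \<alpha> k) w j) = xco (w j) + (\<Sum>l=1..k. of_real (weight \<alpha> k (int j - int l)) *
       (of_real ((\<alpha> - 1) / 2) * (xco (w j) - xco (w l)) - of_real ((\<alpha> + 1) / 2) * rootk k (int j + int l) * (yco (w j) - yco (w l))))"
    unfolding h xco_add xco_sum xco_diff[symmetric] yco_diff[symmetric]
    by (intro arg_cong2[where f = "(+)"] refl sum.cong pair_hess_polygon(1)[OF k a1 j])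
  show "yco (hessV \<alpha> k (polygon \<alpha> k) w j) = yco (w j) + (\<Sum>l=1..k. of_real (weight \<alpha> k (int j - int l)) *
       (of_real ((\<alpha> - 1) / 2) * (yco (w j) - yco (w l)) - of_real ((\<alpha> + 1) / 2) * rootk k (- int j - int l) * (xco (w j) - xco (w l))))"
    unfolding h yco_add yco_sum xco_diff[symmetric] yco_diff[symmetric]
    by (intro arg_cong2[where f = "(+)"] refl sum.cong pair_hess_polygon(2)[OF k a1 j])
qed

text \<open>
  The diagonal terms produce \<open>wsum\<close> at \<open>0\<close> and \<open>n \<plusminus> 1\<close>; in the mixed terms, the product of the roots of
  unity at \<open>j\<close> and \<open>l\<close> is absorbed by the difference of the two frequency shifts, which leaves the
  frequencies \<open>1\<close> and \<open>n\<close>.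
\<close>

lemma hessV_hat:
  assumes k: "k \<ge> 2" and a: "\<alpha> > 1"
  shows "xhat k (hessV \<alpha> k (polygon \<alpha> k) w) n =
     of_real (1 + (\<alpha> - 1) / 2 * stiffness \<alpha> k (n + 1)) * xhat k w n - of_real ((\<alpha> + 1) / 2 * (wsum \<alpha> k 1 - wsum \<alpha> k n)) * yhat k w n"
   "yhat k (hessV \<alpha> k (polygon \<alpha> k) w) n =
     of_real (1 + (\<alpha> - 1) / 2 * stiffness \<alpha> k (n - 1)) * yhat k w n - of_real ((\<alpha> + 1) / 2 * (wsum \<alpha> k 1 - wsum \<alpha> k n)) * xhat k w n"
proof -
  have k0: "k > 0" using k by simp
  define X Y where "X j = xco (w j)" and "Y j = yco (w j)" for j
  define p q where "p = complex_of_real ((\<alpha> - 1) / 2)" and "q = complex_of_real ((\<alpha> + 1) / 2)"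
  define W where "W j l = complex_of_real (weight \<alpha> k (int j - int l))" for j l
  let ?S = "\<lambda>a b F. (\<Sum>j=1..k. \<Sum>l=1..k. rootk k (a * int j + b * int l) * W j l * F j l)"
  note conv = convolution_left[OF k0, where \<alpha>=\<alpha>, folded W_def] convolution_right[OF k0, where \<alpha>=\<alpha>, folded W_def]
  define sx sy where "sx = (\<Sum>j=1..k. rootk k (- (n + 1) * int j) * X j)" and "sy = (\<Sum>j=1..k. rootk k (- (n - 1) * int j) * Y j)"
  have "(\<Sum>j=1..k. rootk k (- (n + 1) * int j) * xco (hessV \<alpha> k (polygon \<alpha> k) w j)) =
     (\<Sum>j=1..k. rootk k (- (n + 1) * int j) * X j + (\<Sum>l=1..k.
        p * (rootk k (- (n + 1) * int j + 0 * int l) * W j l * X j) - p * (rootk k (- (n + 1) * int j + 0 * int l) * W j l * X l)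
      - (q * (rootk k (- n * int j + 1 * int l) * W j l * Y j) - q * (rootk k (- n * int j + 1 * int l) * W j l * Y l))))"
  proof (intro sum.cong refl)
    fix j assume j: "j \<in> {1..k}"
    have r: "rootk k (- n * int j + 1 * int l) = rootk k (- (n + 1) * int j) * rootk k (int j + int l)" for l
      unfolding rootk_add[symmetric] by (rule arg_cong[of _ _ "rootk k"]) (simp add: algebra_simps)
    show "rootk k (- (n + 1) * int j) * xco (hessV \<alpha> k (polygon \<alpha> k) w j) =
     rootk k (- (n + 1) * int j) * X j + (\<Sum>l=1..k.
        p * (rootk k (- (n + 1) * int j + 0 * int l) * W j l * X j) - p * (rootk k (- (n + 1) * int j + 0 * int l) * W j l * X l)
      - (q * (rootk k (- n * int j + 1 * int l) * W j l * Y j) - q * (rootk k (- n * int j + 1 * int l) * W j l * Y l)))"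
      unfolding hessV_polygon(1)[OF k a j] r X_def[symmetric] Y_def[symmetric] W_def[symmetric] p_def[symmetric] q_def[symmetric]
        distrib_left sum_distrib_left mult_zero_left add_0_right
      by (intro arg_cong2[where f = "(+)"] refl sum.cong) (simp only: right_diff_distrib left_diff_distrib mult_ac)
  qed
  also have "\<dots> = sx + p * of_real (wsum \<alpha> k 0) * sx - p * of_real (wsum \<alpha> k (n + 1)) * sx
      - q * of_real (wsum \<alpha> k 1) * sy + q * of_real (wsum \<alpha> k n) * sy"
  proof -
    have e: "- (n + 1) + 0 = - (n + 1)" "- n + 1 = - (n - 1)" by simp_all
    show ?thesis
      unfolding sum.distrib sum_subtractf sum_distrib_left[symmetric] conv e wsum_minus sx_def[symmetric] sy_def[symmetric]
      by (simp add: algebra_simps)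
  qed
  finally have x: "(\<Sum>j=1..k. rootk k (- (n + 1) * int j) * xco (hessV \<alpha> k (polygon \<alpha> k) w j)) = \<dots>" .
  have h: "xhat k w n = sx / of_nat k" "yhat k w n = sy / of_nat k"
    by (simp_all add: xhat_def yhat_def sx_def sy_def X_def Y_def)
  show "xhat k (hessV \<alpha> k (polygon \<alpha> k) w) n =
     of_real (1 + (\<alpha> - 1) / 2 * stiffness \<alpha> k (n + 1)) * xhat k w n - of_real ((\<alpha> + 1) / 2 * (wsum \<alpha> k 1 - wsum \<alpha> k n)) * yhat k w n"
    unfolding xhat_def[of k "hessV _ _ _ _"] x h stiffness_def of_real_mult of_real_add of_real_diff p_def[symmetric] q_def[symmetric] of_real_1
    using k0 by (simp add: divide_simps) (simp add: algebra_simps)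
  have "(\<Sum>j=1..k. rootk k (- (n - 1) * int j) * yco (hessV \<alpha> k (polygon \<alpha> k) w j)) =
     (\<Sum>j=1..k. rootk k (- (n - 1) * int j) * Y j + (\<Sum>l=1..k.
        p * (rootk k (- (n - 1) * int j + 0 * int l) * W j l * Y j) - p * (rootk k (- (n - 1) * int j + 0 * int l) * W j l * Y l)
      - (q * (rootk k (- n * int j + - 1 * int l) * W j l * X j) - q * (rootk k (- n * int j + - 1 * int l) * W j l * X l))))"
  proof (intro sum.cong refl)
    fix j assume j: "j \<in> {1..k}"
    have r: "rootk k (- n * int j + - 1 * int l) = rootk k (- (n - 1) * int j) * rootk k (- int j - int l)" for l
      unfolding rootk_add[symmetric] by (rule arg_cong[of _ _ "rootk k"]) (simp add: algebra_simps)
    show "rootk k (- (n - 1) * int j) * yco (hessV \<alpha> k (polygon \<alpha> k) w j) =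
     rootk k (- (n - 1) * int j) * Y j + (\<Sum>l=1..k.
        p * (rootk k (- (n - 1) * int j + 0 * int l) * W j l * Y j) - p * (rootk k (- (n - 1) * int j + 0 * int l) * W j l * Y l)
      - (q * (rootk k (- n * int j + - 1 * int l) * W j l * X j) - q * (rootk k (- n * int j + - 1 * int l) * W j l * X l)))"
      unfolding hessV_polygon(2)[OF k a j] r X_def[symmetric] Y_def[symmetric] W_def[symmetric] p_def[symmetric] q_def[symmetric]
        distrib_left sum_distrib_left mult_zero_left add_0_right
      by (intro arg_cong2[where f = "(+)"] refl sum.cong) (simp only: right_diff_distrib left_diff_distrib mult_ac)
  qed
  also have "\<dots> = sy + p * of_real (wsum \<alpha> k 0) * sy - p * of_real (wsum \<alpha> k (n - 1)) * sy
      - q * of_real (wsum \<alpha> k 1) * sx + q * of_real (wsum \<alpha> k n) * sx"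
  proof -
    have e: "- (n - 1) + 0 = - (n - 1)" "- n + - 1 = - (n + 1)" by simp_all
    show ?thesis
      unfolding sum.distrib sum_subtractf sum_distrib_left[symmetric] conv e wsum_minus sx_def[symmetric] sy_def[symmetric]
      by (simp add: algebra_simps)
  qed
  finally have y: "(\<Sum>j=1..k. rootk k (- (n - 1) * int j) * yco (hessV \<alpha> k (polygon \<alpha> k) w j)) = \<dots>" .
  show "yhat k (hessV \<alpha> k (polygon \<alpha> k) w) n =
     of_real (1 + (\<alpha> - 1) / 2 * stiffness \<alpha> k (n - 1)) * yhat k w n - of_real ((\<alpha> + 1) / 2 * (wsum \<alpha> k 1 - wsum \<alpha> k n)) * xhat k w n"
    unfolding yhat_def[of k "hessV _ _ _ _"] y h stiffness_def of_real_mult of_real_add of_real_diff p_def[symmetric] q_def[symmetric] of_real_1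
    using k0 by (simp add: divide_simps) (simp add: algebra_simps)
qed

section \<open>The stiffness numbers\<close>

lemma stiffness_eq: "stiffness \<alpha> k m = (\<Sum>d<k. weight \<alpha> k (int d) * (2 * (sin (of_int m * (real d * pi / real k)))\<^sup>2))"
proof -
  have c: "cos (of_int m * of_int (int d) * (2 * pi / real k)) = 1 - 2 * (sin (of_int m * (real d * pi / real k)))\<^sup>2" for d
  proof -
    have "of_int m * of_int (int d) * (2 * pi / real k) = 2 * (of_int m * (real d * pi / real k))" by simp
    thus ?thesis by (simp only: cos_double_sin)
  qed
  have "stiffness \<alpha> k m = (\<Sum>d<k. weight \<alpha> k (int d) - weight \<alpha> k (int d) * cos (of_int m * of_int (int d) * (2 * pi / real k)))"
    by (simp add: stiffness_def wsum_def sum_subtractf)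
  thus ?thesis unfolding c by (simp add: algebra_simps)
qed

lemma stiffness_0 [simp]: "stiffness \<alpha> k 0 = 0"
  by (simp add: stiffness_def)

lemma stiffness_minus: "stiffness \<alpha> k (- m) = stiffness \<alpha> k m"
  by (simp add: stiffness_def wsum_minus)

lemma stiffness_reflect:
  assumes k: "k > 0"
  shows "stiffness \<alpha> k (int k - m) = stiffness \<alpha> k m"
proof -
  have "cos (of_int (int k - m) * of_int (int d) * (2 * pi / real k)) = cos (of_int m * of_int (int d) * (2 * pi / real k))" for d
  proof -
    have "of_int (int k - m) * of_int (int d) * (2 * pi / real k) = 2 * pi * of_int (int d) - of_int m * of_int (int d) * (2 * pi / real k)"
      using k by (simp add: field_simps)
    also have "cos \<dots> = cos (of_int m * of_int (int d) * (2 * pi / real k))"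
      by (simp only: cos_diff cos_int_2pin sin_int_2pin mult_1 mult_zero_left add_0_right)
    finally show ?thesis .
  qed
  thus ?thesis by (simp add: stiffness_def wsum_def)
qed

lemma sum_drop_zero:
  fixes f :: "nat \<Rightarrow> 'a :: comm_monoid_add"
  assumes "k > 0" "f 0 = 0"
  shows "(\<Sum>d<k. f d) = (\<Sum>d=1..<k. f d)"
proof -
  have "{..<k} = insert 0 {1..<k}" using assms(1) by auto
  thus ?thesis using assms(2) by simp
qed

text \<open>
  The normalization of the polygon by \<open>s1\<close> is exactly what makes this equal to \<open>1\<close>.
\<close>

lemma stiffness_1:
  assumes k: "k \<ge> 2"
  shows "stiffness \<alpha> k 1 = 1"
proof -
  define s where "s d = sin (real d * pi / real k)" for d
  have "stiffness \<alpha> k 1 = (\<Sum>d=1..<k. weight \<alpha> k (int d) * (2 * (s d)\<^sup>2))"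
    unfolding stiffness_eq s_def using k by (subst sum_drop_zero) simp_all
  also have "\<dots> = (\<Sum>d=1..<k. (1 / 2 powr \<alpha>) * (1 / s d powr (\<alpha> - 1)) / s1 \<alpha> k)"
  proof (intro sum.cong refl)
    fix d assume d: "d \<in> {1..<k}"
    hence p: "s d > 0" unfolding s_def by (intro sin_node_pos) auto
    have "(2 * s d) powr (- (\<alpha> + 1)) * (2 * (s d)\<^sup>2) = (2 powr (- (\<alpha> + 1)) * 2 powr 1) * (s d powr (- (\<alpha> + 1)) * s d powr 2)"
      using p by (simp add: powr_mult powr_numeral)
    also have "\<dots> = 2 powr (- \<alpha>) * s d powr (- (\<alpha> - 1))"
      unfolding powr_add[symmetric] by (simp add: algebra_simps)
    also have "\<dots> = (1 / 2 powr \<alpha>) * (1 / s d powr (\<alpha> - 1))"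
      unfolding powr_minus_divide by simp
    finally show "weight \<alpha> k (int d) * (2 * (s d)\<^sup>2) = (1 / 2 powr \<alpha>) * (1 / s d powr (\<alpha> - 1)) / s1 \<alpha> k"
      using p by (simp add: weight_def s_def)
  qed
  also have "\<dots> = s1 \<alpha> k / s1 \<alpha> k"
  proof -
    have "{1..<k} = {1..k-1}" using k by auto
    hence "s1 \<alpha> k = (\<Sum>d=1..<k. (1 / 2 powr \<alpha>) * (1 / s d powr (\<alpha> - 1)))"
      by (simp add: s1_def s_def sum_distrib_left)
    thus ?thesis by (simp only: sum_divide_distrib[symmetric])
  qed
  also have "\<dots> = 1" using s1_pos[OF k, of \<alpha>] by simp
  finally show ?thesis .
qed

lemma stiffness_nonneg:
  assumes "k \<ge> 2"
  shows "stiffness \<alpha> k m \<ge> 0"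
  unfolding stiffness_eq weight_def using s1_pos[OF assms, of \<alpha>] by (intro sum_nonneg) simp

lemma stiffness_2_pos:
  assumes k: "k \<ge> 4"
  shows "stiffness \<alpha> k 2 > 0"
proof -
  have s: "0 < sin (pi / real k)" using sin_node_pos[of 1 k] k by simp
  have "0 < sin (2 * pi / real k)" using sin_node_pos[of 2 k] k by simp
  hence "0 < weight \<alpha> k (int 1) * (2 * (sin (of_int 2 * (real 1 * pi / real k)))\<^sup>2)"
    using s s1_pos[of k \<alpha>] k by (simp add: weight_def)
  also have "\<dots> \<le> stiffness \<alpha> k 2"
    unfolding stiffness_eq using s1_pos[of k \<alpha>] k
    by (intro member_le_sum[of 1 "{..<k}" "\<lambda>d. weight \<alpha> k (int d) * (2 * (sin (of_int 2 * (real d * pi / real k)))\<^sup>2)"])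
       (simp_all add: weight_def)
  finally show ?thesis .
qed

section \<open>The reduced space\<close>

lemma complexify_Ek_red:
  "w \<in> complexify (Ek_red k) \<longleftrightarrow> (\<forall>j. j \<notin> {1..k} \<longrightarrow> w j = 0) \<and> (\<Sum>j=1..k. w j) = 0"
proof
  assume "w \<in> complexify (Ek_red k)"
  then obtain x y where w: "w = (\<lambda>j. \<chi> p. of_real (x j $ p) + \<i> * of_real (y j $ p))" and xy: "x \<in> Ek_red k" "y \<in> Ek_red k"
    by (auto simp: complexify_def)
  have "(\<Sum>j=1..k. w j) $ p = of_real ((\<Sum>j=1..k. x j) $ p) + \<i> * of_real ((\<Sum>j=1..k. y j) $ p)" for p
    by (simp add: w sum_component sum.distrib sum_distrib_left)
  moreover have "(\<Sum>j=1..k. x j) = 0" "(\<Sum>j=1..k. y j) = 0" using xy by (simp_all add: Ek_red_def)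
  ultimately have "(\<Sum>j=1..k. w j) = 0" unfolding vec_eq_iff by (simp only: zero_index) simp
  moreover have "\<forall>j. j \<notin> {1..k} \<longrightarrow> w j = 0" using xy by (simp add: w Ek_red_def Ek_def vec_eq_iff)
  ultimately show "(\<forall>j. j \<notin> {1..k} \<longrightarrow> w j = 0) \<and> (\<Sum>j=1..k. w j) = 0" by blast
next
  assume a: "(\<forall>j. j \<notin> {1..k} \<longrightarrow> w j = 0) \<and> (\<Sum>j=1..k. w j) = 0"
  define x y :: "real config" where "x j = (\<chi> p. Re (w j $ p))" and "y j = (\<chi> p. Im (w j $ p))" for j
  have e: "(\<Sum>j=1..k. x j) $ p = Re ((\<Sum>j=1..k. w j) $ p)" "(\<Sum>j=1..k. y j) $ p = Im ((\<Sum>j=1..k. w j) $ p)" for p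
    by (simp_all add: x_def y_def sum_component)
  have "(\<Sum>j=1..k. x j) = 0" "(\<Sum>j=1..k. y j) = 0" unfolding vec_eq_iff e a[THEN conjunct2] by simp_all
  moreover have "\<forall>j. j \<notin> {1..k} \<longrightarrow> x j = 0 \<and> y j = 0" using a by (simp add: x_def y_def vec_eq_iff)
  ultimately have "x \<in> Ek_red k" "y \<in> Ek_red k" unfolding Ek_red_def Ek_def by blast+
  moreover have "w = (\<lambda>j. \<chi> p. of_real (x j $ p) + \<i> * of_real (y j $ p))"
    by (simp add: x_def y_def fun_eq_iff vec_eq_iff complex_eq[symmetric])
  ultimately show "w \<in> complexify (Ek_red k)" by (auto simp: complexify_def)
qed

text \<open>
  The center of mass is one Fourier coefficient in each of the two coordinates.
\<close>

lemma complexify_Ek_red_hat: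
  assumes k: "k > 0"
  shows "w \<in> complexify (Ek_red k) \<longleftrightarrow> (\<forall>j. j \<notin> {1..k} \<longrightarrow> w j = 0) \<and> xhat k w (int k - 1) = 0 \<and> yhat k w 1 = 0"
proof -
  have "rootk k (- int k * int j) = 1" for j using rootk_k[OF k, of "- int j"] by simp
  hence "xhat k w (int k - 1) = xco (\<Sum>j=1..k. w j) / of_nat k" "yhat k w 1 = yco (\<Sum>j=1..k. w j) / of_nat k"
    by (simp_all add: xhat_def yhat_def xco_sum yco_sum)
  moreover have "(\<Sum>j=1..k. w j) = 0 \<longleftrightarrow> xco (\<Sum>j=1..k. w j) = 0 \<and> yco (\<Sum>j=1..k. w j) = 0"
    by (simp add: co_eq_iff)
  ultimately show ?thesis unfolding complexify_Ek_red using k by simp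
qed

lemma herm_inner_self_zero:
  assumes "herm_inner k v v = 0" "j \<in> {1..k}"
  shows "v j = 0"
proof -
  have "herm_inner k v v = of_real (\<Sum>j=1..k. \<Sum>p\<in>UNIV. (cmod (v j $ p))\<^sup>2)"
    unfolding herm_inner_def of_real_sum complex_norm_square ..
  hence "(\<Sum>j=1..k. \<Sum>p\<in>UNIV. (cmod (v j $ p))\<^sup>2) = 0" using assms(1) by (metis of_real_eq_0_iff)
  hence "\<forall>j\<in>{1..k}. (\<Sum>p\<in>UNIV. (cmod (v j $ p))\<^sup>2) = 0"
    by (subst (asm) sum_nonneg_eq_0_iff) (auto intro: sum_nonneg)
  hence "(\<Sum>p\<in>UNIV. (cmod (v j $ p))\<^sup>2) = 0" using assms(2) by blast
  hence "\<forall>p\<in>UNIV. (cmod (v j $ p))\<^sup>2 = 0"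
    by (subst (asm) sum_nonneg_eq_0_iff) auto
  thus ?thesis by (simp add: vec_eq_iff)
qed

text \<open>
  The operator preserves the reduced space, so this is the only case of the projection that occurs.
  Uniqueness holds because \<open>herm_inner\<close> is positive definite on configurations supported on \<open>{1..k}\<close>.
\<close>

lemma orth_proj_self:
  assumes w: "w \<in> complexify (Ek_red k)"
  shows "orth_proj k (complexify (Ek_red k)) w = w"
  unfolding orth_proj_def
proof (rule the_equality)
  show "w \<in> complexify (Ek_red k) \<and> (\<forall>s\<in>complexify (Ek_red k). herm_inner k (\<lambda>j. w j - w j) s = 0)"
    using w by (simp add: herm_inner_def)
next
  fix v assume v: "v \<in> complexify (Ek_red k) \<and> (\<forall>s\<in>complexify (Ek_red k). herm_inner k (\<lambda>j. w j - v j) s = 0)"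
  have "(\<lambda>j. w j - v j) \<in> complexify (Ek_red k)"
    using v w unfolding complexify_Ek_red by (simp add: sum_subtractf)
  hence "herm_inner k (\<lambda>j. w j - v j) (\<lambda>j. w j - v j) = 0" using v by blast
  hence "w j - v j = 0" if "j \<in> {1..k}" for j using herm_inner_self_zero[OF _ that] by blast
  thus "v = w" using v w unfolding complexify_Ek_red by (auto simp: fun_eq_iff) (metis eq_iff_diff_eq_0)+
qed

section \<open>The blocks\<close>

text \<open>
  Diagonal entries of the block of the mode \<open>n\<close>; the off-diagonal entries are \<open>- coupling \<alpha> k n\<close>.
\<close>

definition block_x :: "real \<Rightarrow> nat \<Rightarrow> int \<Rightarrow> real \<Rightarrow> real" where
  "block_x \<alpha> k n l = (l + 1)\<^sup>2 + (\<alpha> - 1) / 2 * stiffness \<alpha> k (n + 1)"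

definition block_y :: "real \<Rightarrow> nat \<Rightarrow> int \<Rightarrow> real \<Rightarrow> real" where
  "block_y \<alpha> k n l = (l - 1)\<^sup>2 + (\<alpha> - 1) / 2 * stiffness \<alpha> k (n - 1)"

definition coupling :: "real \<Rightarrow> nat \<Rightarrow> int \<Rightarrow> real" where
  "coupling \<alpha> k n = (\<alpha> + 1) / 2 * (stiffness \<alpha> k n - 1)"

definition block_det :: "real \<Rightarrow> nat \<Rightarrow> int \<Rightarrow> real \<Rightarrow> real" where
  "block_det \<alpha> k n l = block_x \<alpha> k n l * block_y \<alpha> k n l - (coupling \<alpha> k n)\<^sup>2"

lemma Jk_co: "xco (Jk w j) = \<i> * xco (w j)" "yco (Jk w j) = - \<i> * yco (w j)"
  by (simp_all add: Jk_def xco_def yco_def Jmat_def matrix_vector_mult_def sum_2 vector_2 algebra_simps)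

lemma M_op_hat:
  assumes k: "k \<ge> 2" and a: "\<alpha> > 1"
  shows "xhat k (M_op \<alpha> k (polygon \<alpha> k) (of_real l) w) n = of_real (block_x \<alpha> k n l) * xhat k w n - of_real (coupling \<alpha> k n) * yhat k w n"
    "yhat k (M_op \<alpha> k (polygon \<alpha> k) (of_real l) w) n = of_real (block_y \<alpha> k n l) * yhat k w n - of_real (coupling \<alpha> k n) * xhat k w n"
proof -
  define h where "h = hessV \<alpha> k (polygon \<alpha> k) w"
  have c: "coupling \<alpha> k n = (\<alpha> + 1) / 2 * (wsum \<alpha> k 1 - wsum \<alpha> k n)"
    using stiffness_1[OF k, of \<alpha>] by (simp add: coupling_def stiffness_def)
  have "xco (M_op \<alpha> k (polygon \<alpha> k) (of_real l) w j) = of_real (l\<^sup>2 + 2 * l) * xco (w j) + xco (h j)" for j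
    unfolding M_op_def xco_add xco_diff xco_scale Jk_co h_def by (simp add: algebra_simps)
  hence "xhat k (M_op \<alpha> k (polygon \<alpha> k) (of_real l) w) n = of_real (l\<^sup>2 + 2 * l) * xhat k w n + xhat k h n"
    by (simp add: xhat_def sum.distrib sum_distrib_left distrib_left add_divide_distrib mult.left_commute del: of_real_add of_real_mult)
  thus "xhat k (M_op \<alpha> k (polygon \<alpha> k) (of_real l) w) n = of_real (block_x \<alpha> k n l) * xhat k w n - of_real (coupling \<alpha> k n) * yhat k w n"
    unfolding h_def hessV_hat[OF k a] c[symmetric] block_x_def by (simp add: power2_eq_square algebra_simps)
  have "yco (M_op \<alpha> k (polygon \<alpha> k) (of_real l) w j) = of_real (l\<^sup>2 - 2 * l) * yco (w j) + yco (h j)" for j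
    unfolding M_op_def yco_add yco_diff yco_scale Jk_co h_def by (simp add: algebra_simps)
  hence "yhat k (M_op \<alpha> k (polygon \<alpha> k) (of_real l) w) n = of_real (l\<^sup>2 - 2 * l) * yhat k w n + yhat k h n"
    by (simp add: yhat_def sum.distrib sum_distrib_left distrib_left add_divide_distrib mult.left_commute del: of_real_diff of_real_mult)
  thus "yhat k (M_op \<alpha> k (polygon \<alpha> k) (of_real l) w) n = of_real (block_y \<alpha> k n l) * yhat k w n - of_real (coupling \<alpha> k n) * xhat k w n"
    unfolding h_def hessV_hat[OF k a] c[symmetric] block_y_def by (simp add: power2_eq_square algebra_simps)
qed

lemma M_op_outside: "w \<in> complexify (Ek_red k) \<Longrightarrow> j \<notin> {1..k} \<Longrightarrow> M_op \<alpha> k u z w j = 0"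
  by (auto simp: complexify_Ek_red M_op_def Jk_def hessV_def)

text \<open>
  In the two modes that contain the center of mass, the two coordinates decouple.
\<close>

lemma coupling_1:
  assumes "k \<ge> 2"
  shows "coupling \<alpha> k 1 = 0" "coupling \<alpha> k (int k - 1) = 0"
  using stiffness_1[OF assms, of \<alpha>] stiffness_reflect[of k \<alpha> 1] assms by (simp_all add: coupling_def)

lemma M_red_eq_M_op:
  assumes k: "k \<ge> 2" and a: "\<alpha> > 1" and w: "w \<in> complexify (Ek_red k)"
  shows "M_op \<alpha> k (polygon \<alpha> k) (of_real l) w \<in> complexify (Ek_red k)"
    "M_red \<alpha> k (polygon \<alpha> k) (of_real l) w = M_op \<alpha> k (polygon \<alpha> k) (of_real l) w"
proof -
  have k0: "k > 0" using k by simp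
  show *: "M_op \<alpha> k (polygon \<alpha> k) (of_real l) w \<in> complexify (Ek_red k)"
    using w M_op_outside[OF w] unfolding complexify_Ek_red_hat[OF k0] M_op_hat[OF k a] by (simp add: coupling_1[OF k])
  show "M_red \<alpha> k (polygon \<alpha> k) (of_real l) w = M_op \<alpha> k (polygon \<alpha> k) (of_real l) w"
    unfolding M_red_def by (rule orth_proj_self[OF *])
qed

lemma block_det_0:
  assumes "k \<ge> 2"
  shows "block_det \<alpha> k 0 l = l\<^sup>2 * (l\<^sup>2 + \<alpha> - 3)"
  using stiffness_1[OF assms, of \<alpha>] stiffness_minus[of \<alpha> k 1]
  by (simp add: block_det_def block_x_def block_y_def coupling_def power2_eq_square field_simps)

lemma ex1_eq: "\<exists>!p. P p \<Longrightarrow> P a \<Longrightarrow> P b \<Longrightarrow> a = b"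
  by blast

lemma ex1_linear_system:
  fixes A D q :: real and x y :: complex
  assumes "A * D - q\<^sup>2 \<noteq> 0"
  shows "\<exists>!p. of_real A * fst p - of_real q * snd p = x \<and> of_real D * snd p - of_real q * fst p = y"
proof -
  define d where "d = complex_of_real (A * D - q\<^sup>2)"
  have d: "d \<noteq> 0" using assms by (simp only: d_def of_real_eq_0_iff not_False_eq_True)
  have dd: "d = of_real A * of_real D - of_real q * of_real q" by (simp add: d_def power2_eq_square)
  let ?p = "((of_real D * x + of_real q * y) / d, (of_real A * y + of_real q * x) / d)"
  show ?thesis
  proof (rule ex1I[of _ ?p])
    have "(of_real A * (of_real D * x + of_real q * y) - of_real q * (of_real A * y + of_real q * x)) = d * x"
      "(of_real D * (of_real A * y + of_real q * x) - of_real q * (of_real D * x + of_real q * y)) = d * y"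
      unfolding dd by (simp_all add: algebra_simps)
    thus "of_real A * fst ?p - of_real q * snd ?p = x \<and> of_real D * snd ?p - of_real q * fst ?p = y"
      using d by (simp only: fst_conv snd_conv times_divide_eq_right diff_divide_distrib[symmetric]) simp
  next
    fix p assume e: "of_real A * fst p - of_real q * snd p = x \<and> of_real D * snd p - of_real q * fst p = y"
    have "fst p * d = of_real D * x + of_real q * y" "snd p * d = of_real A * y + of_real q * x"
      unfolding dd e[THEN conjunct1, symmetric] e[THEN conjunct2, symmetric] by (simp_all add: algebra_simps)
    hence "fst p = fst ?p" "snd p = snd ?p" unfolding fst_conv snd_conv nonzero_eq_divide_eq[OF d] by blast+
    thus "p = ?p" by (rule prod_eqI)
  qed
qed

text \<open>
  In the modes \<open>1\<close> and \<open>k - 1\<close> one coordinate is fixed to \<open>0\<close> and the other one is multiplied by a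
  positive number; elsewhere the determinant decides.
\<close>

lemma block_solvable:
  fixes x y :: complex
  assumes k: "k \<ge> 4" and a: "\<alpha> > 1" and n: "n < k"
    and det: "n \<noteq> 1 \<Longrightarrow> n \<noteq> k - 1 \<Longrightarrow> block_det \<alpha> k (int n) l \<noteq> 0"
    and xy: "n = 1 \<Longrightarrow> y = 0" "n = k - 1 \<Longrightarrow> x = 0"
  shows "\<exists>!p. of_real (block_x \<alpha> k (int n) l) * fst p - of_real (coupling \<alpha> k (int n)) * snd p = x \<and>
       of_real (block_y \<alpha> k (int n) l) * snd p - of_real (coupling \<alpha> k (int n)) * fst p = y \<and>
       (n = 1 \<longrightarrow> snd p = 0) \<and> (n = k - 1 \<longrightarrow> fst p = 0)"
proof -
  have k2: "k \<ge> 2" using k by simp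
  consider "n = 1" | "n = k - 1" | "n \<noteq> 1" "n \<noteq> k - 1" by blast
  thus ?thesis
  proof cases
    case 1
    define A where "A = complex_of_real (block_x \<alpha> k (int n) l)"
    have "block_x \<alpha> k (int n) l > 0"
      using stiffness_2_pos[OF k, of \<alpha>] a 1 by (simp add: block_x_def add_nonneg_pos)
    hence A: "A \<noteq> 0" by (simp add: A_def)
    have ne: "n \<noteq> k - 1" using 1 k by simp
    have q: "coupling \<alpha> k (int n) = 0" using 1 coupling_1[OF k2] by simp
    show ?thesis unfolding A_def[symmetric] q
      by (rule ex1I[of _ "(x / A, 0)"]) (use A 1 ne xy in \<open>auto simp: field_simps\<close>)
  next
    case 2
    define D where "D = complex_of_real (block_y \<alpha> k (int n) l)"
    have i: "int n = int k - 1" using 2 k by simp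
    have "stiffness \<alpha> k (int n - 1) = stiffness \<alpha> k 2"
      using stiffness_reflect[of k \<alpha> 2] k i by simp
    hence "block_y \<alpha> k (int n) l > 0"
      using stiffness_2_pos[OF k, of \<alpha>] a by (simp add: block_y_def add_nonneg_pos)
    hence D: "D \<noteq> 0" by (simp add: D_def)
    have ne: "n \<noteq> 1" using 2 k by simp
    have q: "coupling \<alpha> k (int n) = 0" using i coupling_1[OF k2] by simp
    show ?thesis unfolding D_def[symmetric] q
      by (rule ex1I[of _ "(0, y / D)"]) (use D 2 ne xy in \<open>auto simp: field_simps\<close>)
  next
    case 3
    from ex1_linear_system[OF det[OF 3, unfolded block_det_def], of x y] show ?thesis using 3 by simp
  qed
qed

text \<open>
  Infinitesimal rotation of the polygon lies in the mode \<open>0\<close>.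
\<close>

lemma rotation_hat:
  assumes k: "k > 0"
  shows "xhat k (\<lambda>j. c *s of_real_config (Jk (polygon \<alpha> k)) j) n = (if int k dvd n then c * \<i> * of_real (radius \<alpha> k) else 0)"
    "yhat k (\<lambda>j. c *s of_real_config (Jk (polygon \<alpha> k)) j) n = (if int k dvd n then - c * \<i> * of_real (radius \<alpha> k) else 0)"
proof -
  have co: "xco (of_real_config (Jk (polygon \<alpha> k)) j) = \<i> * of_real (radius \<alpha> k) * rootk k (int j)"
    "yco (of_real_config (Jk (polygon \<alpha> k)) j) = - \<i> * of_real (radius \<alpha> k) * rootk k (- int j)" if "j \<in> {1..k}" for j
  proof -
    have "xco (of_real_config (Jk (polygon \<alpha> k)) j) = \<i> * point (polygon \<alpha> k j)"
      "yco (of_real_config (Jk (polygon \<alpha> k)) j) = - \<i> * cnj (point (polygon \<alpha> k j))"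
      by (simp_all add: of_real_config_def Jk_def xco_def yco_def Jmat_def matrix_vector_mult_def sum_2 vector_2 complex_eq_iff)
    thus "xco (of_real_config (Jk (polygon \<alpha> k)) j) = \<i> * of_real (radius \<alpha> k) * rootk k (int j)"
    "yco (of_real_config (Jk (polygon \<alpha> k)) j) = - \<i> * of_real (radius \<alpha> k) * rootk k (- int j)"
      unfolding point_polygon[OF that] by (simp_all add: rootk_uminus)
  qed
  have "xhat k (\<lambda>j. c *s of_real_config (Jk (polygon \<alpha> k)) j) n = c * \<i> * of_real (radius \<alpha> k) * (\<Sum>j=1..k. rootk k (- n * int j)) / of_nat k"
  proof -
    have "rootk k (- (n + 1) * int j) * xco (c *s of_real_config (Jk (polygon \<alpha> k)) j) = c * \<i> * of_real (radius \<alpha> k) * rootk k (- n * int j)" if "j \<in> {1..k}" for j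
    proof -
      have "rootk k (- n * int j) = rootk k (- (n + 1) * int j) * rootk k (int j)"
        unfolding rootk_add[symmetric] by (rule arg_cong[of _ _ "rootk k"]) (simp add: algebra_simps)
      thus ?thesis unfolding xco_scale co[OF that] by (simp only: mult_ac)
    qed
    thus ?thesis by (simp add: xhat_def sum_distrib_left)
  qed
  thus "xhat k (\<lambda>j. c *s of_real_config (Jk (polygon \<alpha> k)) j) n = (if int k dvd n then c * \<i> * of_real (radius \<alpha> k) else 0)"
    unfolding sum_rootk_1k[OF k] using k by simp
  have "yhat k (\<lambda>j. c *s of_real_config (Jk (polygon \<alpha> k)) j) n = - c * \<i> * of_real (radius \<alpha> k) * (\<Sum>j=1..k. rootk k (- n * int j)) / of_nat k"
  proof -
    have "rootk k (- (n - 1) * int j) * yco (c *s of_real_config (Jk (polygon \<alpha> k)) j) = - c * \<i> * of_real (radius \<alpha> k) * rootk k (- n * int j)" if "j \<in> {1..k}" for j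
    proof -
      have "rootk k (- n * int j) = rootk k (- (n - 1) * int j) * rootk k (- int j)"
        unfolding rootk_add[symmetric] by (rule arg_cong[of _ _ "rootk k"]) (simp add: algebra_simps)
      thus ?thesis unfolding yco_scale co[OF that] by (simp only: mult_minus_left mult_minus_right mult_ac)
    qed
    thus ?thesis by (simp add: yhat_def sum_distrib_left)
  qed
  thus "yhat k (\<lambda>j. c *s of_real_config (Jk (polygon \<alpha> k)) j) n = (if int k dvd n then - c * \<i> * of_real (radius \<alpha> k) else 0)"
    unfolding sum_rootk_1k[OF k] using k by simp
qed

lemma rotation_mem:
  assumes k: "k \<ge> 2"
  shows "(\<lambda>j. c *s of_real_config (Jk (polygon \<alpha> k)) j) \<in> complexify (Ek_red k)"
proof -
  have k0: "k > 0" using k by simp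
  have d: "\<not> int k dvd int k - 1" "\<not> int k dvd 1"
  proof -
    show "\<not> int k dvd 1" using k by simp
    thus "\<not> int k dvd int k - 1" using dvd_diff_right_iff[of "int k" "int k" 1] by simp
  qed
  have "of_real_config (Jk (polygon \<alpha> k)) j = 0" if "j \<notin> {1..k}" for j
    using that by (auto simp: of_real_config_def Jk_def polygon_def vec_eq_iff)
  thus ?thesis unfolding complexify_Ek_red_hat[OF k0] rotation_hat[OF k0] using d by simp
qed

text \<open>
  Injectivity and surjectivity on each mode are the two halves of unique solvability; Fourier
  inversion assembles the modes.
\<close>

lemma M_red_bij:
  assumes k: "k \<ge> 4" and a: "\<alpha> > 1"
    and det: "\<And>n. n < k \<Longrightarrow> n \<noteq> 1 \<Longrightarrow> n \<noteq> k - 1 \<Longrightarrow> block_det \<alpha> k (int n) l \<noteq> 0"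
  shows "bij_betw (M_red \<alpha> k (polygon \<alpha> k) (of_real l)) (complexify (Ek_red k)) (complexify (Ek_red k))"
proof -
  have k2: "k \<ge> 2" and k0: "k > 0" using k by simp_all
  define C where "C = complexify (Ek_red k)"
  define M where "M = M_op \<alpha> k (polygon \<alpha> k) (of_real l)"
  note M_mem = M_red_eq_M_op(1)[OF k2 a, of _ l, folded M_def C_def]
  note hat = M_op_hat[OF k2 a, where l=l, folded M_def]
  have edge: "(n = 1 \<longrightarrow> yhat k w (int n) = 0) \<and> (n = k - 1 \<longrightarrow> xhat k w (int n) = 0)" if "w \<in> C" for w n
    using that k unfolding C_def complexify_Ek_red_hat[OF k0] by auto
  have out: "w j = 0" if "w \<in> C" "j \<notin> {1..k}" for w j
    using that unfolding C_def complexify_Ek_red_hat[OF k0] by blast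
  define P where "P v n p \<longleftrightarrow> of_real (block_x \<alpha> k (int n) l) * fst p - of_real (coupling \<alpha> k (int n)) * snd p = xhat k v (int n) \<and>
       of_real (block_y \<alpha> k (int n) l) * snd p - of_real (coupling \<alpha> k (int n)) * fst p = yhat k v (int n) \<and>
       (n = 1 \<longrightarrow> snd p = 0) \<and> (n = k - 1 \<longrightarrow> fst p = 0)" for v n p
  have ex1: "\<exists>!p. P v n p" if "v \<in> C" "n < k" for v n
    unfolding P_def
  proof (rule block_solvable[OF k a that(2)])
    show "block_det \<alpha> k (int n) l \<noteq> 0" if "n \<noteq> 1" "n \<noteq> k - 1" by (rule det[OF \<open>n < k\<close> that])
    show "n = 1 \<Longrightarrow> yhat k v (int n) = 0" "n = k - 1 \<Longrightarrow> xhat k v (int n) = 0" using edge[OF that(1), of n] by blast+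
  qed
  have PM: "P (M w) n (xhat k w (int n), yhat k w (int n))" if "w \<in> C" for w n
    unfolding P_def fst_conv snd_conv hat using edge[OF that, of n] by blast
  have "bij_betw M C C"
    unfolding bij_betw_def
  proof
    show "inj_on M C"
    proof (rule inj_onI)
      fix v w assume vw: "v \<in> C" "w \<in> C" "M v = M w"
      show "v = w"
      proof (rule config_eq_of_hat[OF k0])
        fix n assume n: "n < k"
        have "(xhat k v (int n), yhat k v (int n)) = (xhat k w (int n), yhat k w (int n))"
          by (rule ex1_eq[OF ex1[OF M_mem[OF vw(1)] n] PM[OF vw(1)] PM[OF vw(2), folded vw(3)]])
        thus "xhat k v (int n) = xhat k w (int n) \<and> yhat k v (int n) = yhat k w (int n)" by simp
      next
        fix j assume "j \<notin> {1..k}"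
        thus "v j = w j" using out vw by metis
      qed
    qed
    show "M ` C = C"
    proof
      show "M ` C \<subseteq> C" using M_mem by blast
      show "C \<subseteq> M ` C"
      proof
        fix v assume v: "v \<in> C"
        have "\<forall>n. \<exists>p. n < k \<longrightarrow> P v n p" using ex1[OF v] by blast
        from choice[OF this] obtain p where p: "\<And>n. n < k \<Longrightarrow> P v n (p n)" by blast
        obtain w where w: "\<And>n. n < k \<Longrightarrow> xhat k w (int n) = fst (p n)" "\<And>n. n < k \<Longrightarrow> yhat k w (int n) = snd (p n)"
          "\<And>j. j \<notin> {1..k} \<Longrightarrow> w j = 0" by (rule config_of_hat[OF k0, of "\<lambda>n. fst (p n)" "\<lambda>n. snd (p n)"]) (rule that, blast+)
        have wC: "w \<in> C"
          unfolding C_def complexify_Ek_red_hat[OF k0]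
        proof (intro conjI)
          show "\<forall>j. j \<notin> {1..k} \<longrightarrow> w j = 0" using w(3) by blast
          have "fst (p (k - 1)) = 0" "snd (p 1) = 0" using p[of "k - 1"] p[of 1] k by (simp_all add: P_def)
          thus "xhat k w (int k - 1) = 0" "yhat k w 1 = 0" using w(1)[of "k - 1"] w(2)[of 1] k by (simp_all add: of_nat_diff)
        qed
        have "M w = v"
        proof (rule config_eq_of_hat[OF k0])
          fix n assume n: "n < k"
          show "xhat k (M w) (int n) = xhat k v (int n) \<and> yhat k (M w) (int n) = yhat k v (int n)"
            using p[OF n] unfolding hat w(1)[OF n] w(2)[OF n] P_def by blast
        next
          fix j assume "j \<notin> {1..k}"
          thus "M w j = v j" using out[OF M_mem[OF wC]] out[OF v] by simp
        qed
        thus "v \<in> M ` C" using wC by blast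
      qed
    qed
  qed
  moreover have "bij_betw M C C = bij_betw (M_red \<alpha> k (polygon \<alpha> k) (of_real l)) C C"
    unfolding M_def C_def by (rule bij_betw_cong) (rule M_red_eq_M_op(2)[OF k2 a, symmetric])
  ultimately show ?thesis by (simp add: C_def)
qed

text \<open>
  At \<open>l = 0\<close> the block of the mode \<open>0\<close> has all entries equal to \<open>(\<alpha> + 1)/2\<close>.
\<close>

lemma M_red_kernel:
  assumes k: "k \<ge> 4" and a: "\<alpha> > 1"
    and det: "\<And>n. 2 \<le> n \<Longrightarrow> n + 2 \<le> k \<Longrightarrow> block_det \<alpha> k (int n) 0 \<noteq> 0"
  shows "{w \<in> complexify (Ek_red k). M_red \<alpha> k (polygon \<alpha> k) 0 w = (\<lambda>j. 0)}
       = {\<lambda>j. c *s of_real_config (Jk (polygon \<alpha> k)) j | c. True}"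
proof -
  have k2: "k \<ge> 2" and k0: "k > 0" using k by simp_all
  define C where "C = complexify (Ek_red k)"
  define M where "M = M_op \<alpha> k (polygon \<alpha> k) 0"
  define \<rho> where "\<rho> = complex_of_real (radius \<alpha> k)"
  have \<rho>: "\<rho> \<noteq> 0" using radius_pos[OF k2, of \<alpha>] by (simp add: \<rho>_def)
  have M_red: "M_red \<alpha> k (polygon \<alpha> k) 0 w = M w" "M w \<in> C" if "w \<in> C" for w
    using M_red_eq_M_op[OF k2 a that[unfolded C_def], of 0] by (simp_all add: M_def C_def)
  have hat: "xhat k (M w) n = of_real (block_x \<alpha> k n 0) * xhat k w n - of_real (coupling \<alpha> k n) * yhat k w n"
    "yhat k (M w) n = of_real (block_y \<alpha> k n 0) * yhat k w n - of_real (coupling \<alpha> k n) * xhat k w n" for w n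
    using M_op_hat[OF k2 a, of 0 w n] by (simp_all add: M_def)
  have s: "stiffness \<alpha> k 1 = 1" "stiffness \<alpha> k (- 1) = 1" using stiffness_1[OF k2] stiffness_minus by simp_all
  have b0: "block_x \<alpha> k 0 0 = (\<alpha> + 1) / 2" "block_y \<alpha> k 0 0 = (\<alpha> + 1) / 2" "coupling \<alpha> k 0 = - ((\<alpha> + 1) / 2)"
    using s by (simp_all add: block_x_def block_y_def coupling_def field_simps)
  have z0: "xhat k (\<lambda>j. 0) n = 0" "yhat k (\<lambda>j. 0) n = 0" for n by (simp_all add: xhat_def yhat_def)
  have dvd: "int k dvd int n \<longleftrightarrow> n = 0" if "n < k" for n using that by (auto dest: dvd_imp_le)
  have "M w = (\<lambda>j. 0) \<longleftrightarrow> (\<exists>c. w = (\<lambda>j. c *s of_real_config (Jk (polygon \<alpha> k)) j))" if w: "w \<in> C" for w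
  proof
    assume Mw: "M w = (\<lambda>j. 0)"
    have nz: "xhat k w (int n) = 0 \<and> yhat k w (int n) = 0" if n: "n < k" "n \<noteq> 0" for n
    proof -
      have "n \<noteq> 1 \<Longrightarrow> n \<noteq> k - 1 \<Longrightarrow> block_det \<alpha> k (int n) 0 \<noteq> 0" using n by (intro det) auto
      from block_solvable[OF k a n(1) this, of 0 0] have
        u: "\<exists>!p. of_real (block_x \<alpha> k (int n) 0) * fst p - of_real (coupling \<alpha> k (int n)) * snd p = 0 \<and>
       of_real (block_y \<alpha> k (int n) 0) * snd p - of_real (coupling \<alpha> k (int n)) * fst p = 0 \<and>
       (n = 1 \<longrightarrow> snd p = 0) \<and> (n = k - 1 \<longrightarrow> fst p = (0::complex))"
        by blast
      have e: "(n = 1 \<longrightarrow> yhat k w (int n) = 0) \<and> (n = k - 1 \<longrightarrow> xhat k w (int n) = 0)"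
        using w k unfolding C_def complexify_Ek_red_hat[OF k0] by auto
      have "(xhat k w (int n), yhat k w (int n)) = (0, 0)"
        by (rule ex1_eq[OF u]) (use e hat[of w "int n"] in \<open>simp_all add: Mw z0\<close>)
      thus ?thesis by simp
    qed
    have "of_real ((\<alpha> + 1) / 2) * (xhat k w 0 + yhat k w 0) = 0"
      using hat(1)[of w 0] unfolding Mw z0 b0 of_real_minus by (simp only: distrib_left) (simp add: algebra_simps)
    hence y0: "yhat k w 0 = - xhat k w 0" using a by (simp add: eq_neg_iff_add_eq_0 add.commute del: of_real_add of_real_divide)
    define c where "c = xhat k w 0 / (\<i> * \<rho>)"
    have c: "c * \<i> * \<rho> = xhat k w 0" using \<rho> by (simp add: c_def)
    have "w = (\<lambda>j. c *s of_real_config (Jk (polygon \<alpha> k)) j)"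
    proof (rule config_eq_of_hat[OF k0])
      fix n assume n: "n < k"
      show "xhat k w (int n) = xhat k (\<lambda>j. c *s of_real_config (Jk (polygon \<alpha> k)) j) (int n) \<and>
         yhat k w (int n) = yhat k (\<lambda>j. c *s of_real_config (Jk (polygon \<alpha> k)) j) (int n)"
        unfolding rotation_hat[OF k0] dvd[OF n] \<rho>_def[symmetric] using nz[OF n] y0 c by auto
    next
      fix j assume "j \<notin> {1..k}"
      thus "w j = c *s of_real_config (Jk (polygon \<alpha> k)) j"
        using w rotation_mem[OF k2, of c \<alpha>] unfolding C_def complexify_Ek_red by simp
    qed
    thus "\<exists>c. w = (\<lambda>j. c *s of_real_config (Jk (polygon \<alpha> k)) j)" by blast
  next
    assume "\<exists>c. w = (\<lambda>j. c *s of_real_config (Jk (polygon \<alpha> k)) j)"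
    then obtain c where wc: "w = (\<lambda>j. c *s of_real_config (Jk (polygon \<alpha> k)) j)" by blast
    show "M w = (\<lambda>j. 0)"
    proof (rule config_eq_of_hat[OF k0])
      fix n assume n: "n < k"
      show "xhat k (M w) (int n) = xhat k (\<lambda>j. 0) (int n) \<and> yhat k (M w) (int n) = yhat k (\<lambda>j. 0) (int n)"
        unfolding hat z0 wc rotation_hat[OF k0] dvd[OF n] by (cases "n = 0") (simp_all add: b0 del: of_real_divide of_real_add)
    next
      fix j assume "j \<notin> {1..k}"
      thus "M w j = 0" using M_red(2)[OF w] unfolding C_def complexify_Ek_red by blast
    qed
  qed
  thus ?thesis using M_red(1) rotation_mem[OF k2, of _ \<alpha>] unfolding C_def[symmetric] by auto
qed

theorem nondegenerate_polygon:
  assumes k: "k \<ge> 4" and a: "\<alpha> > 1"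
    and det: "\<And>l n. m dvd l \<Longrightarrow> 2 \<le> n \<Longrightarrow> n + 2 \<le> k \<Longrightarrow> block_det \<alpha> k (int n) (of_int l) \<noteq> 0"
    and rot: "\<And>l. m dvd l \<Longrightarrow> l \<noteq> 0 \<Longrightarrow> (of_int l)\<^sup>2 + \<alpha> \<noteq> 3"
  shows "nondegenerate m \<alpha> k (polygon \<alpha> k)"
  unfolding nondegenerate_def
proof (intro conjI allI impI)
  fix l assume l: "m dvd l \<and> l \<noteq> 0"
  have "block_det \<alpha> k (int n) (of_int l) \<noteq> 0" if "n < k" "n \<noteq> 1" "n \<noteq> k - 1" for n
  proof (cases "n = 0")
    case True
    have k2: "k \<ge> 2" using k by simp
    show ?thesis using block_det_0[OF k2, of \<alpha> "of_int l"] True rot[of l] l by auto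
  next
    case False
    thus ?thesis using that l by (intro det) auto
  qed
  from M_red_bij[OF k a this]
  show "bij_betw (M_red \<alpha> k (polygon \<alpha> k) (of_int l)) (complexify (Ek_red k)) (complexify (Ek_red k))" by simp
next
  show "of_real_config (Jk (polygon \<alpha> k)) \<noteq> (\<lambda>j. 0)"
  proof
    assume z: "of_real_config (Jk (polygon \<alpha> k)) = (\<lambda>j. 0)"
    have "xhat k (\<lambda>j. 1 *s of_real_config (Jk (polygon \<alpha> k)) j) 0 = 0" unfolding z by (simp add: xhat_def)
    thus False using rotation_hat(1)[of k 1 \<alpha> 0] radius_pos[of k \<alpha>] k by simp
  qed
next
  show "{w \<in> complexify (Ek_red k). M_red \<alpha> k (polygon \<alpha> k) 0 w = (\<lambda>j. 0)}
       = {\<lambda>j. c *s of_real_config (Jk (polygon \<alpha> k)) j | c. True}"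
    by (rule M_red_kernel[OF k a]) (use det[of 0] in simp)
qed

section \<open>The Newtonian exponent\<close>

lemma stiffness_newton:
  assumes k: "k \<ge> 2"
  shows "stiffness 2 k (int n) = csum one_weight k n / csum one_weight k 1"
proof -
  define s where "s d = sin (real d * pi / real k)" for d
  have sp: "s d > 0" if "d \<in> {1..<k}" for d unfolding s_def using that by (intro sin_node_pos) auto
  have c1: "csum one_weight k 1 = (\<Sum>d=1..<k. 1 / s d)"
    unfolding csum_def
  proof (intro sum.cong refl)
    fix d assume "d \<in> {1..<k}"
    thus "1 * (sin (real 1 * (real d * pi / real k)))\<^sup>2 / sin (real d * pi / real k) ^ 3 = 1 / s d"
      using sp[of d] by (simp add: s_def power2_eq_square power3_eq_cube)
  qed
  have s1: "s1 2 k = csum one_weight k 1 / 4"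
  proof -
    have "{1..k-1} = {1..<k}" by auto
    hence "s1 2 k = (1 / 4) * (\<Sum>d=1..<k. 1 / s d powr 1)" by (simp add: s1_def s_def)
    also have "(\<Sum>d=1..<k. 1 / s d powr 1) = (\<Sum>d=1..<k. 1 / s d)"
      using sp by (intro sum.cong refl) (simp add: less_imp_le)
    finally show ?thesis unfolding c1 by simp
  qed
  have "stiffness 2 k (int n) = (\<Sum>d=1..<k. weight 2 k (int d) * (2 * (sin (real n * (real d * pi / real k)))\<^sup>2))"
    unfolding stiffness_eq using k by (subst sum_drop_zero) simp_all
  also have "\<dots> = (\<Sum>d=1..<k. 1 * (sin (real n * (real d * pi / real k)))\<^sup>2 / sin (real d * pi / real k) ^ 3 / (4 * s1 2 k))"
  proof (intro sum.cong refl)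
    fix d assume "d \<in> {1..<k}"
    hence p: "s d > 0" by (rule sp)
    have "(2 * s d) powr (- (2 + 1)) = 1 / (2 * s d) powr 3" by (simp add: powr_minus_divide)
    also have "(2 * s d) powr 3 = 8 * s d ^ 3" using p by (simp add: powr_numeral power_mult_distrib)
    finally have "weight 2 k (int d) = 1 / (8 * s d ^ 3) / s1 2 k" using p by (simp add: weight_def s_def)
    thus "weight 2 k (int d) * (2 * (sin (real n * (real d * pi / real k)))\<^sup>2) =
      1 * (sin (real n * (real d * pi / real k)))\<^sup>2 / sin (real d * pi / real k) ^ 3 / (4 * s1 2 k)"
      by (simp add: s_def)
  qed
  also have "\<dots> = csum one_weight k n / csum one_weight k 1"
    unfolding sum_divide_distrib[symmetric] csum_def[of one_weight k n, symmetric] s1 by simp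
  finally show ?thesis .
qed

lemma block_det_newton:
  assumes k: "k \<ge> 2" and n: "n \<ge> 1"
  defines "R \<equiv> csum one_weight k"
  shows "4 * (R 1)\<^sup>2 * block_det 2 k (int n) l = mode_form l (R 1) (R (n - 1)) (R n) (R (n + 1))"
proof -
  have R: "R 1 \<noteq> 0" using csum_plain_pos[OF k] by (simp add: R_def)
  have s: "stiffness 2 k (int n) = R n / R 1" "stiffness 2 k (int n + 1) = R (n + 1) / R 1"
    "stiffness 2 k (int n - 1) = R (n - 1) / R 1"
    using stiffness_newton[OF k, of n] stiffness_newton[OF k, of "n + 1"] stiffness_newton[OF k, of "n - 1"] n
    by (simp_all add: R_def of_nat_diff add.commute)
  show ?thesis
    unfolding block_det_def block_x_def block_y_def coupling_def s mode_form_def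
    using R by (simp add: field_simps power2_eq_square)
qed

text \<open>
  The modes \<open>n\<close> and \<open>k - n\<close> are exchanged by complex conjugation and \<open>l \<mapsto> -l\<close>.
\<close>

lemma block_det_reflect:
  assumes k: "k > 0"
  shows "block_det \<alpha> k (int k - n) l = block_det \<alpha> k n (- l)"
proof -
  have "stiffness \<alpha> k (int k - n + 1) = stiffness \<alpha> k (n - 1)" "stiffness \<alpha> k (int k - n - 1) = stiffness \<alpha> k (n + 1)"
    using stiffness_reflect[OF k, of \<alpha> "n - 1"] stiffness_reflect[OF k, of \<alpha> "n + 1"] by (simp_all add: algebra_simps)
  moreover have "(- l + 1)\<^sup>2 = (l - 1)\<^sup>2" "(- l - 1)\<^sup>2 = (l + 1)\<^sup>2" by (simp_all add: power2_eq_square algebra_simps)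
  ultimately show ?thesis
    by (simp add: block_det_def block_x_def block_y_def coupling_def stiffness_reflect[OF k])
qed

lemma block_det_newton_nonzero:
  fixes l :: int
  assumes k: "4 \<le> k" "k \<le> 1000" and n: "2 \<le> n" "n + 2 \<le> k"
  shows "block_det 2 k (int n) (of_int l) \<noteq> 0"
proof -
  \<comment> \<open>The estimates cover \<open>n \<le> k/2\<close>; reflection gives the rest.\<close>
  have low: "block_det 2 k (int n) (of_int l) \<noteq> 0" if "2 \<le> n" "2 * n \<le> k" for n and l :: int
    using mode_form_plain_nonzero[OF k that, of l] block_det_newton[of k n "of_int l"] k that by auto
  show ?thesis
  proof (cases "2 * n \<le> k")
    case True
    thus ?thesis by (rule low[OF n(1)])
  next
    case False
    define n' where "n' = k - n"
    have n': "int n = int k - int n'" "2 \<le> n'" "2 * n' \<le> k" using False n by (auto simp: n'_def)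
    show ?thesis unfolding n'(1) using low[OF n'(2,3), of "- l"] block_det_reflect[of k 2 "int n'" "of_int l"] k by simp
  qed
qed

section \<open>Exponents near the Newtonian one\<close>

lemma isCont_s1:
  assumes "k \<ge> 2"
  shows "isCont (\<lambda>\<alpha>. s1 \<alpha> k) \<alpha>"
proof -
  have "isCont (\<lambda>\<alpha>. 1 / sin (real j * (2 * pi / real k) / 2) powr (\<alpha> - 1)) \<alpha>" if "j \<in> {1..k-1}" for j
  proof -
    have "sin (real j * pi / real k) > 0" using that by (intro sin_node_pos) auto
    thus ?thesis by (auto intro!: continuous_intros)
  qed
  hence "isCont (\<lambda>\<alpha>. \<Sum>j=1..k-1. 1 / sin (real j * (2 * pi / real k) / 2) powr (\<alpha> - 1)) \<alpha>"
    by (intro isCont_sum ballI)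
  moreover have "isCont (\<lambda>\<alpha>. 1 / 2 powr \<alpha>) \<alpha>" for \<alpha> :: real by (auto intro!: continuous_intros)
  ultimately show ?thesis unfolding s1_def by (intro isCont_mult)
qed

lemma isCont_stiffness:
  assumes k: "k \<ge> 2"
  shows "isCont (\<lambda>\<alpha>. stiffness \<alpha> k m) \<alpha>"
proof -
  have w: "isCont (\<lambda>\<alpha>. weight \<alpha> k (int d)) \<alpha>" if "d \<in> {1..<k}" for d
  proof -
    have "sin (real d * pi / real k) > 0" using that by (intro sin_node_pos) auto
    thus ?thesis unfolding weight_def using s1_pos[OF k, of \<alpha>] isCont_s1[OF k, of \<alpha>]
      by (auto intro!: continuous_intros)
  qed
  have "(\<lambda>\<alpha>. stiffness \<alpha> k m) = (\<lambda>\<alpha>. \<Sum>d=1..<k. weight \<alpha> k (int d) * (2 * (sin (of_int m * (real d * pi / real k)))\<^sup>2))"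
    unfolding stiffness_eq using k by (subst sum_drop_zero) simp_all
  moreover have "isCont \<dots> \<alpha>" by (intro continuous_intros w)
  ultimately show ?thesis by simp
qed

lemma isCont_block_det:
  assumes k: "k \<ge> 2"
  shows "isCont (\<lambda>\<alpha>. coupling \<alpha> k n) \<alpha>" "isCont (\<lambda>\<alpha>. block_det \<alpha> k n l) \<alpha>"
proof -
  show c: "isCont (\<lambda>\<alpha>. coupling \<alpha> k n) \<alpha>"
    unfolding coupling_def by (intro continuous_intros isCont_stiffness[OF k]) simp_all
  show "isCont (\<lambda>\<alpha>. block_det \<alpha> k n l) \<alpha>"
    unfolding block_det_def block_x_def block_y_def
    by (intro continuous_intros isCont_stiffness[OF k] c) simp_all
qed

text \<open>
  Both diagonal entries are at least \<open>(\<bar>l\<bar> - 1)\<^sup>2\<close>, which exceeds the modulus of the coupling.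
\<close>

lemma block_det_large:
  assumes k: "k \<ge> 2" and a: "\<alpha> \<ge> 1" and l: "\<bar>coupling \<alpha> k n\<bar> + 1 < \<bar>l\<bar>" "2 \<le> \<bar>l\<bar>"
  shows "block_det \<alpha> k n l > 0"
proof -
  define c where "c = \<bar>coupling \<alpha> k n\<bar>"
  have b: "c < (\<bar>l\<bar> - 1)\<^sup>2"
  proof -
    have "c < 1 * (\<bar>l\<bar> - 1)" using l by (simp add: c_def)
    also have "\<dots> \<le> (\<bar>l\<bar> - 1) * (\<bar>l\<bar> - 1)" using l by (intro mult_right_mono) auto
    finally show ?thesis by (simp add: power2_eq_square)
  qed
  have "(\<bar>l\<bar> - 1)\<^sup>2 \<le> (l + 1)\<^sup>2" "(\<bar>l\<bar> - 1)\<^sup>2 \<le> (l - 1)\<^sup>2"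
    by (auto simp: power2_eq_square algebra_simps abs_if)
  moreover have "0 \<le> (\<alpha> - 1) / 2 * stiffness \<alpha> k j" for j
    using a stiffness_nonneg[OF k] by (intro mult_nonneg_nonneg) simp_all
  from this[of "n + 1"] this[of "n - 1"]
  have "(l + 1)\<^sup>2 \<le> block_x \<alpha> k n l" "(l - 1)\<^sup>2 \<le> block_y \<alpha> k n l"
    unfolding block_x_def block_y_def by linarith+
  ultimately have "c < block_x \<alpha> k n l" "c < block_y \<alpha> k n l" using b by linarith+
  hence "c * c < block_x \<alpha> k n l * block_y \<alpha> k n l"
    by (intro mult_strict_mono') (auto simp: c_def)
  thus ?thesis by (simp add: block_det_def c_def power2_eq_square)
qed

text \<open>
  Near \<open>\<alpha> = 2\<close> the coupling is bounded, so \<open>block_det_large\<close> leaves finitely many integers \<open>l\<close>, and for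
  these the determinant is continuous in \<open>\<alpha>\<close>.
\<close>

lemma eventually_block_det_nonzero:
  assumes k: "4 \<le> k" "k \<le> 1000" and n: "2 \<le> n" "n + 2 \<le> k"
  shows "\<forall>\<^sub>F \<alpha> in nhds 2. \<forall>l::int. block_det \<alpha> k (int n) (of_int l) \<noteq> 0"
proof -
  have k2: "k \<ge> 2" using k by simp
  \<comment> \<open>One unit for the variation of the coupling near \<open>2\<close>, the other two for the margins in \<open>block_det_large\<close>.\<close>
  define N where "N = \<lceil>\<bar>coupling 2 k (int n)\<bar>\<rceil> + 3"
  have tend: "((\<lambda>\<alpha>. f \<alpha>) \<longlongrightarrow> f 2) (nhds 2)" if "isCont f 2" for f :: "real \<Rightarrow> real"
    using that by (simp add: isCont_def tendsto_at_iff_tendsto_nhds)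
  have "\<forall>\<^sub>F \<alpha> in nhds 2. \<bar>coupling \<alpha> k (int n)\<bar> < \<bar>coupling 2 k (int n)\<bar> + 1"
    by (rule order_tendstoD(2)[OF tend]) (auto intro!: continuous_intros isCont_block_det[OF k2])
  moreover have "\<forall>\<^sub>F \<alpha> in nhds (2::real). 1 < \<alpha>"
    by (rule order_tendstoD(1)[OF filterlim_ident]) simp
  moreover have "\<forall>\<^sub>F \<alpha> in nhds 2. \<forall>l\<in>{-N..N}. block_det \<alpha> k (int n) (of_int l) \<noteq> 0"
    using block_det_newton_nonzero[OF k n]
    by (intro eventually_ball_finite ballI) (auto intro!: tendsto_imp_eventually_ne[OF tend] isCont_block_det[OF k2])
  ultimately show ?thesis
  proof eventually_elim
    case (elim \<alpha>)
    show ?case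
    proof
      fix l :: int
      show "block_det \<alpha> k (int n) (of_int l) \<noteq> 0"
      proof (cases "l \<in> {-N..N}")
        case True
        thus ?thesis using elim(3) by blast
      next
        case False
        hence "N + 1 \<le> \<bar>l\<bar>" by auto
        hence "of_int (N + 1) \<le> (of_int \<bar>l\<bar> :: real)" by (simp only: of_int_le_iff)
        moreover have "\<bar>coupling 2 k (int n)\<bar> + 4 \<le> of_int (N + 1)" unfolding N_def by linarith
        ultimately have "\<bar>coupling 2 k (int n)\<bar> + 4 \<le> \<bar>of_int l\<bar>" by simp
        hence "block_det \<alpha> k (int n) (of_int l) > 0"
          using elim(1,2) by (intro block_det_large[OF k2]) auto
        thus ?thesis by simp
      qed
    qed
  qed
qed

lemma int_square_plus_ne_3:
  fixes l :: int and \<alpha> :: real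
  assumes "l \<noteq> 0" "0 < \<alpha>" "\<alpha> < 3" "\<alpha> \<noteq> 2"
  shows "(of_int l)\<^sup>2 + \<alpha> \<noteq> 3"
proof
  assume e: "(of_int l)\<^sup>2 + \<alpha> = 3"
  hence "of_int (l\<^sup>2) < (of_int 3 :: real)" "of_int 0 < (of_int (l\<^sup>2) :: real)" using assms by simp_all
  hence "l\<^sup>2 < 3" "0 < l\<^sup>2" by (simp_all only: of_int_less_iff)
  hence "l\<^sup>2 = 1 \<or> l\<^sup>2 = 2" by linarith
  moreover have "l\<^sup>2 \<noteq> 2"
  proof
    assume "l\<^sup>2 = 2"
    hence "\<bar>l\<bar> * \<bar>l\<bar> = 2" by (simp add: power2_eq_square abs_mult[symmetric])
    moreover have "\<bar>l\<bar> = 1 \<or> 2 \<le> \<bar>l\<bar>" using assms(1) by linarith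
    moreover have "4 \<le> \<bar>l\<bar> * \<bar>l\<bar>" if "2 \<le> \<bar>l\<bar>" using mult_mono[OF that that] by simp
    ultimately show False by fastforce
  qed
  ultimately have "of_int (l\<^sup>2) = (1::real)" by simp
  thus False using e assms(4) by simp
qed

theorem theorem4p8:
  shows "(\<forall>m::int. m > 1 \<longrightarrow> (\<forall>k::nat. 4 \<le> k \<and> k \<le> 1000 \<longrightarrow> nondegenerate m 2 k (polygon 2 k))) \<and>
    (\<exists>\<delta>::real. \<delta> > 0 \<and> (\<forall>\<alpha>::real. \<alpha> \<in> {2 - \<delta><..<2 + \<delta>} - {2} \<longrightarrow>
       (\<forall>k::nat. 4 \<le> k \<and> k \<le> 1000 \<longrightarrow> nondegenerate 1 \<alpha> k (polygon \<alpha> k))))"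
proof (intro conjI allI impI)
  fix m :: int and k :: nat
  assume m: "m > 1" and k: "4 \<le> k \<and> k \<le> 1000"
  show "nondegenerate m 2 k (polygon 2 k)"
  proof (rule nondegenerate_polygon)
    fix l :: int assume l: "m dvd l" "l \<noteq> 0"
    have "m \<le> \<bar>l\<bar>" using dvd_imp_le_int[OF l(2,1)] m by simp
    hence "2 \<le> \<bar>l\<bar>" using m by simp
    hence "2 * 2 \<le> \<bar>l\<bar> * \<bar>l\<bar>" by (intro mult_mono) auto
    hence "4 \<le> l\<^sup>2" by (simp add: power2_eq_square)
    hence "of_int 4 \<le> (of_int (l\<^sup>2) :: real)" by (simp only: of_int_le_iff)
    thus "(of_int l)\<^sup>2 + 2 \<noteq> (3::real)" by simp
  qed (use k block_det_newton_nonzero in auto)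
next
  have "\<forall>\<^sub>F \<alpha> in nhds 2. \<forall>k\<in>{4..1000}. \<forall>n\<in>{2..k - 2}. \<forall>l::int. block_det \<alpha> k (int n) (of_int l) \<noteq> 0"
    by (intro eventually_ball_finite ballI finite_atLeastAtMost eventually_block_det_nonzero) auto
  then obtain d where d: "d > 0" "\<And>\<alpha>. dist \<alpha> 2 < d \<Longrightarrow> \<forall>k\<in>{4..1000}. \<forall>n\<in>{2..k - 2}. \<forall>l::int. block_det \<alpha> k (int n) (of_int l) \<noteq> 0"
    unfolding eventually_nhds_metric by blast
  show "\<exists>\<delta>::real. \<delta> > 0 \<and> (\<forall>\<alpha>::real. \<alpha> \<in> {2 - \<delta><..<2 + \<delta>} - {2} \<longrightarrow>
       (\<forall>k::nat. 4 \<le> k \<and> k \<le> 1000 \<longrightarrow> nondegenerate 1 \<alpha> k (polygon \<alpha> k)))"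
  proof (intro exI[of _ "min d 1"] conjI allI impI)
    show "0 < min d 1" using d(1) by simp
    fix \<alpha> :: real and k :: nat
    assume a: "\<alpha> \<in> {2 - min d 1<..<2 + min d 1} - {2}" and k: "4 \<le> k \<and> k \<le> 1000"
    have dist: "dist \<alpha> 2 < d" using a by (auto simp: dist_real_def)
    show "nondegenerate 1 \<alpha> k (polygon \<alpha> k)"
    proof (rule nondegenerate_polygon)
      fix l :: int and n :: nat assume "2 \<le> n" "n + 2 \<le> k"
      thus "block_det \<alpha> k (int n) (of_int l) \<noteq> 0" using d(2)[OF dist] k by auto
    next
      fix l :: int assume "l \<noteq> 0"
      thus "(of_int l)\<^sup>2 + \<alpha> \<noteq> 3" by (rule int_square_plus_ne_3) (use a in auto)
    qed (use k a in auto)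
  qed
qed

end
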